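(* Let $f(z)=\sum_{j=0}^\infty a_jz^j$ be a transcendental entire function and let $f_\omega(z)=\sum_{j=0}^\infty \chi_j(\omega)a_jz^j$ be the associated random entire function. Then, for any $\epsilon>0$, for almost every $\omega\in\Omega$ there exists $r_0=r_0(\omega,\epsilon)$ such that, for all $r>r_0$: (i) if $f_\omega$ is a Gaussian entire function, then $$T(r, f) \leq N(r,0, f_\omega)+\frac{1+\epsilon}{2} \log T(r,f);$$ (ii) if $f_\omega$ is a Rademacher entire function, then $$T(r, f) \leq N(r,0, f_\omega)+ \Big(\Big(\frac{eC_0}6\Big)^6 +\epsilon \Big) \bigl(\log T(r,f)\bigr)^6,$$ where $C_0$ is the absolute constant described in the context; (iii) if $f_\omega$ is a Steinhaus entire function, then $$T(r, f) \leq N(r,0, f_\omega)+(1+\epsilon) \log T(r,f).$$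
   Context: $(\Omega,\mathcal F,\mu)$ is a probability space and $\chi_j$ ($j=0,1,2,\dots$) are independent, identically distributed complex-valued random variables on it. $f_\omega$ is called a Gaussian entire function if the $\chi_j$ are standard complex Gaussian (density $e^{-|z|^2}/\pi$ with respect to Lebesgue measure on $\mathbb C$); a Rademacher entire function if the $\chi_j$ take the values $\pm1$ with probability $1/2$ each; a Steinhaus entire function if $\chi_j=e^{2\pi i\theta_j}$ with $\theta_j$ independent and uniformly distributed on $[0,1]$. In each case $f_\omega$ is entire for almost every $\omega$. "Almost every $\omega$" means all $\omega$ outside a $\mu$-null set. For an entire function $g$, the Nevanlinna characteristic is $T(r,g)=\frac1{2\pi}\int_0^{2\pi}\log^+|g(re^{it})|\,dt$. $N(r,0,f_\omega)=\int_0^r\frac{n(t,0,f_\omega)-n(0,0,f_\omega)}{t}\,dt+n(0,0,f_\omega)\log r$, where $n(t,0,f_\omega)$ is the number of zeros (with multiplicity) of $f_\omega$ in the disk of center $0$ and radius $t$, and $n(0,0,f_\omega)$ is the multiplicity of the zero at the origin. The constant $C_0$: it is the absolute constant in the following theorem of Nazarov, Nishry and Sodin (log-integrability). For every Rademacher entire function $f_\omega$, every $r>0$ and every $p\ge1$, $$\mathrm{E}\left(\int_{0}^{2\pi}\bigl|\log|\hat f_\omega(re^{i\theta})|\bigr|^p \,\frac{d\theta}{2\pi}\right)\leq (C_0p)^{6p},$$ where $\hat f_\omega(re^{i\theta})=f_\omega(re^{i\theta})/\sigma(r,f)$ and $\sigma(r,f)=\bigl(\sum_{j=0}^\infty|a_j|^2r^{2j}\bigr)^{1/2}$.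 *)

theory Defs
  imports "HOL-Probability.Probability" "HOL-Complex_Analysis.Complex_Analysis"
begin

definition transcendental_entire :: "(complex \<Rightarrow> complex) \<Rightarrow> bool" where
  "transcendental_entire f \<longleftrightarrow>
     f holomorphic_on UNIV \<and> \<not> (\<exists>p. \<forall>z. f z = poly p z)"

definition random_entire ::
    "(nat \<Rightarrow> 'w \<Rightarrow> complex) \<Rightarrow> (nat \<Rightarrow> complex) \<Rightarrow> 'w \<Rightarrow> complex \<Rightarrow> complex" where
  "random_entire X a \<omega> z = (\<Sum>j. X j \<omega> * a j * z ^ j)"

definition gaussian_seq :: "'w measure \<Rightarrow> (nat \<Rightarrow> 'w \<Rightarrow> complex) \<Rightarrow> bool" where
  "gaussian_seq M X \<longleftrightarrow>
     prob_space.indep_vars M (\<lambda>_. borel) X UNIV \<and>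
     (\<forall>j. distributed M lborel (X j) (\<lambda>z. ennreal (exp (- (cmod z)\<^sup>2) / pi)))"

definition rademacher_seq :: "'w measure \<Rightarrow> (nat \<Rightarrow> 'w \<Rightarrow> complex) \<Rightarrow> bool" where
  "rademacher_seq M X \<longleftrightarrow>
     prob_space.indep_vars M (\<lambda>_. borel) X UNIV \<and>
     (\<forall>j. measure M {\<omega> \<in> space M. X j \<omega> = 1} = 1 / 2 \<and>
          measure M {\<omega> \<in> space M. X j \<omega> = - 1} = 1 / 2)"

definition steinhaus_seq :: "'w measure \<Rightarrow> (nat \<Rightarrow> 'w \<Rightarrow> complex) \<Rightarrow> bool" where
  "steinhaus_seq M X \<longleftrightarrow>
     (\<exists>\<theta> :: nat \<Rightarrow> 'w \<Rightarrow> real.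
        prob_space.indep_vars M (\<lambda>_. borel) \<theta> UNIV \<and>
        (\<forall>j. distributed M lborel (\<theta> j) (indicator {0..1})) \<and>
        (\<forall>j. \<forall>\<omega>\<in>space M. X j \<omega> = exp (2 * of_real pi * \<i> * of_real (\<theta> j \<omega>))))"

(* Since ln 0 = 0, this is 0 at x = 0, as it should be. *)
definition log_plus :: "real \<Rightarrow> real" where
  "log_plus x = max 0 (ln x)"

definition nevanlinna_T :: "real \<Rightarrow> (complex \<Rightarrow> complex) \<Rightarrow> real" where
  "nevanlinna_T r g =
     1 / (2 * pi) * integral {0..2 * pi} (\<lambda>t. log_plus (cmod (g (of_real r * cis t))))"

(* The disk is closed, so zero_count 0 g is the multiplicity of the zero at the
   origin (0 if g does not vanish there). *)
definition zero_count :: "real \<Rightarrow> (complex \<Rightarrow> complex) \<Rightarrow> int" where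
  "zero_count t g = (\<Sum>z\<in>{z \<in> cball 0 t. g z = 0}. zorder g z)"

definition nevanlinna_N :: "real \<Rightarrow> (complex \<Rightarrow> complex) \<Rightarrow> real" where
  "nevanlinna_N r g =
     integral {0..r} (\<lambda>t. of_int (zero_count t g - zero_count 0 g) / t)
     + of_int (zero_count 0 g) * ln r"

definition sigma_norm :: "real \<Rightarrow> (nat \<Rightarrow> complex) \<Rightarrow> real" where
  "sigma_norm r a = sqrt (\<Sum>j. (cmod (a j))\<^sup>2 * r ^ (2 * j))"

(* C0 is a constant for which the log-integrability theorem of Nazarov, Nishry and
   Sodin holds.  The integrals are taken in [0, \<infinity>], so the bound includes
   integrability.  The convention ln 0 = 0 matters only on the null set of angles
   at which the function vanishes. *)
definition log_integrability_constant :: "'w measure \<Rightarrow> real \<Rightarrow> bool" where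
  "log_integrability_constant M C0 \<longleftrightarrow>
     C0 > 0 \<and>
     (\<forall>X a. rademacher_seq M X \<and> (\<forall>z. summable (\<lambda>j. a j * z ^ j)) \<and> (\<exists>j. a j \<noteq> 0) \<longrightarrow>
        (\<forall>r p. r > 0 \<and> p \<ge> 1 \<longrightarrow>
           (\<integral>\<^sup>+\<omega>. (\<integral>\<^sup>+\<theta>\<in>{0..2 * pi}.
               ennreal (\<bar>ln (cmod (random_entire X a \<omega> (of_real r * cis \<theta>) / of_real (sigma_norm r a)))\<bar> powr p
                        / (2 * pi)) \<partial>lborel) \<partial>M)
           \<le> ennreal ((C0 * p) powr (6 * p))))"

end

theory Submission imports Defs "HOL-Real_Asymp.Real_Asymp" begin

text \<open>
  Write \<open>\<sigma>\<close> for \<open>sigma_norm r a\<close>, and \<open>g\<close> for the random function at a fixed \<open>\<omega>\<close>.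
  Jensen's formula turns the counting function into a circle mean: if the series of \<open>f\<close> starts with
  the coefficient of index \<open>k\<close>, then
  \<open>N(r,0,g) = ln \<sigma> + mean of ln (|g| / \<sigma>) on |z| = r - ln |X k * a k|\<close>.
  On the other side, Parseval's identity and the concavity of the logarithm give
  \<open>T(r,f) \<le> ln \<sigma> + 1\<close>. So the theorem says that the circle mean of \<open>ln (|g| / \<sigma>)\<close> is almost surely
  not much below 0, with an error measured by a power of \<open>ln ln \<sigma>\<close>.

  It suffices to control radii \<open>r\<^sub>n\<close> with \<open>\<sigma> = exp n\<close>: between consecutive ones \<open>ln \<sigma>\<close> grows by 1, and
  \<open>N\<close> is monotone, so only a constant is lost. This is why no exceptional set of radii appears.
  At \<open>r\<^sub>n\<close> a first moment argument (\<open>AE_lower_bound_of_moments\<close>) works: if the expected circle mean of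
  some function of \<open>|g| / \<sigma>\<close> is bounded by \<open>Q\<^sub>n e\<^sub>n\<close> with \<open>\<Sum>e\<^sub>n < \<infinity>\<close>, then almost surely that circle mean
  is at most \<open>Q\<^sub>n\<close> for large \<open>n\<close>, and a tangent line inequality converts this into a bound for the mean
  of the logarithm.

  In the Gaussian and Steinhaus cases the function is \<open>(|g| / \<sigma>)\<close> to the power \<open>-p\<close>, whose
  expectation is bounded uniformly for \<open>p < 2\<close> and \<open>p < 1\<close> respectively; with \<open>Q\<^sub>n\<close> the power \<open>p c\<close> of \<open>n\<close>
  the mean logarithm is at least \<open>-c ln n\<close>, and \<open>p c > 1\<close> is needed for summability. This yields every
  \<open>c > 1/2\<close> and every \<open>c > 1\<close>. The uniform bound comes from a small ball estimate
  \<open>P(|S| \<le> t) \<le> C t\<^sup>q\<close> for \<open>S = \<Sum>b\<^sub>j X\<^sub>j\<close> with \<open>\<Sum>|b\<^sub>j|\<^sup>2 = 1\<close>, which follows from decay of the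
  Fourier transform of \<open>S\<close>. For Gaussian variables that transform is a Gaussian. For Steinhaus
  variables it is a product of Bessel functions, and the bound
  \<open>|J\<^sub>0(s)| \<le> (1 + c s\<^sup>2)\<close> to the power \<open>-1/4\<close> makes the product decay like \<open>1/s\<close> unless one \<open>|b\<^sub>m|\<^sup>2\<close>
  exceeds 1/2; then conditioning on the other variables gives the estimate directly.

  In the Rademacher case the function is \<open>|ln (|g| / \<sigma>)|\<close> to the power \<open>p\<close>, with \<open>p\<close> growing like
  \<open>ln n\<close>. The log-integrability inequality and the optimal choice of \<open>p\<close> give the power 6 of the
  logarithm and the constant \<open>(e C0 / 6)\<^sup>6\<close>.

  Finally \<open>x - c (ln x)\<^sup>m\<close> is increasing for large \<open>x\<close>, and \<open>T(r,f)\<close> tends to infinity, so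
  \<open>T(r,f) \<le> ln \<sigma> + 1\<close> lets one replace \<open>ln ln \<sigma>\<close> by \<open>ln T(r,f)\<close> (\<open>sequence_to_all_radii\<close>).
\<close>

section \<open>Means of logarithms over a circle\<close>

lemma sin_ge_Jordan:
  fixes x :: real
  assumes "0 \<le> x" "x \<le> pi / 2"
  shows "2 / pi * x \<le> sin x"
proof -
  have conc: "concave_on {0..pi/2} sin"
    by (rule f''_le0_imp_concave[where f' = cos and f'' = "\<lambda>x. - sin x"])
       (auto intro!: derivative_eq_intros sin_ge_zero)
  define u where "u = 2 / pi * x"
  have u: "0 \<le> u" "u \<le> 1" using assms by (auto simp: u_def field_simps)
  have "(1 - u) * sin 0 + u * sin (pi/2) \<le> sin ((1 - u) *\<^sub>R 0 + u *\<^sub>R (pi/2))"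
    using concave_onD[OF conc u, of 0 "pi/2"] by simp
  thus ?thesis by (simp add: u_def)
qed

text \<open>
  Rotating a function on the circle does not change its mean.
\<close>
lemma has_integral_period_shift:
  fixes F :: "real \<Rightarrow> real"
  assumes per: "\<And>t. F (t + p) = F t" and a: "0 \<le> a" "a \<le> p"
    and F: "(F has_integral I) {0..p}"
  shows "((\<lambda>t. F (t + a)) has_integral I) {0..p}"
proof -
  have i1: "F integrable_on {0..a}" "F integrable_on {a..p}"
    using F a by (auto intro: integrable_on_subinterval[OF has_integral_integrable[OF F]])
  have "(F has_integral (integral {0..a} F + integral {a..p} F)) {0..p}"
    by (rule has_integral_combine[OF a]) (use i1 in \<open>auto simp: integrable_integral\<close>)
  with F have I: "I = integral {0..a} F + integral {a..p} F"
    using has_integral_unique by blast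
  have "((\<lambda>t. F (t + p)) has_integral integral {0..a} F) {0..a}"
    using i1(1) by (simp add: per integrable_integral)
  hence "(F has_integral integral {0..a} F) {p..p+a}"
    using has_integral_shift_real_ivl_iff[of F "integral {0..a} F" p "p + a" p] by (simp add: algebra_simps)
  moreover have "(F has_integral integral {a..p} F) {a..p}"
    using i1(2) by (simp add: integrable_integral)
  ultimately have "(F has_integral (integral {a..p} F + integral {0..a} F)) {a..p+a}"
    using a by (intro has_integral_combine[of a p "p+a"]) auto
  hence "((\<lambda>t. F (t + a)) has_integral I) {a - a..p+a - a}"
    unfolding I using has_integral_shift_real_ivl_iff[of F "integral {0..a} F + integral {a..p} F" a "p + a" a]
    by (simp add: algebra_simps)
  thus ?thesis by simp
qed

lemma circle_mean_value:
  fixes h :: "complex \<Rightarrow> complex"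
  assumes "h holomorphic_on ball 0 R" "0 < r" "r < R"
  shows "((\<lambda>t. h (of_real r * cis t)) has_integral (2 * pi * h 0)) {0..2*pi}"
proof -
  have "continuous_on (cball 0 r) h" "h holomorphic_on ball 0 r"
    using assms by (auto intro!: holomorphic_on_imp_continuous_on[OF holomorphic_on_subset[OF assms(1)]]
       holomorphic_on_subset[OF assms(1)])
  hence "((\<lambda>u. h u/(u-0)) has_contour_integral (2 * of_real pi * \<i> * h 0)) (circlepath 0 r)"
    using \<open>0 < r\<close> by (intro Cauchy_integral_circlepath) auto
  hence "((\<lambda>t. h (0 + r * cis t) / (0 + r * cis t - 0) * r * \<i> * cis t) has_integral (2 * of_real pi * \<i> * h 0)) {0..2*pi}"
    unfolding circlepath_def by (subst (asm) has_contour_integral_part_circlepath_iff) auto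
  hence "((\<lambda>t. \<i> * h (r * cis t)) has_integral (2 * of_real pi * \<i> * h 0)) {0..2*pi}"
    using \<open>0 < r\<close> by (auto simp: field_simps elim!: has_integral_eq[rotated])
  hence "((\<lambda>t. (-\<i>) * (\<i> * h (r * cis t))) has_integral ((-\<i>) * (2 * of_real pi * \<i> * h 0))) {0..2*pi}"
    by (rule has_integral_mult_right)
  moreover have eq: "(-\<i>) * (2 * of_real pi * \<i> * h 0) = 2 * pi * h 0" by (simp add: complex_eq_iff)
  ultimately show ?thesis unfolding eq by simp
qed

text \<open>
  A zero-free holomorphic function on a disk has a holomorphic logarithm, so \<open>ln |h|\<close> is
  the real part of a holomorphic function and has the mean value property.
\<close>
lemma circle_mean_ln_nonvanishing:
  assumes "h holomorphic_on ball 0 R" "0 < r" "r < R" "\<And>z. z \<in> ball 0 R \<Longrightarrow> h z \<noteq> 0"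
  shows "((\<lambda>t. ln (cmod (h (of_real r * cis t)))) has_integral (2 * pi * ln (cmod (h 0)))) {0..2*pi}"
proof -
  obtain g where g: "g holomorphic_on ball 0 R" "\<And>z. z \<in> ball 0 R \<Longrightarrow> h z = exp (g z)"
    using holomorphic_logarithm_exists[of "ball 0 R" h 0] assms by (metis convex_ball centre_in_ball open_ball dual_order.strict_trans)
  have eq: "ln (cmod (h z)) = Re (g z)" if "z \<in> ball 0 R" for z
    using g(2)[OF that] by simp
  have "((\<lambda>t. g (of_real r * cis t)) has_integral (2 * pi * g 0)) {0..2*pi}"
    using circle_mean_value g assms by blast
  hence "((\<lambda>t. Re (g (of_real r * cis t))) has_integral Re (2 * pi * g 0)) {0..2*pi}"
    by (rule has_integral_Re)
  thus ?thesis using assms by (simp add: eq norm_mult)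
qed

lemma norm_one_minus_cis: "cmod (1 - cis t) = 2 * \<bar>sin (t / 2)\<bar>"
proof -
  have "(cmod (1 - cis t))\<^sup>2 = (1 - cos t)\<^sup>2 + (sin t)\<^sup>2" by (simp add: cmod_power2)
  also have "\<dots> = 2 - 2 * cos t" using sin_cos_squared_add[of t] by (simp add: power2_eq_square algebra_simps)
  also have "\<dots> = (2 * \<bar>sin (t/2)\<bar>)\<^sup>2"
    using cos_double_sin[of "t/2"] by (simp add: power_mult_distrib)
  finally show ?thesis by (rule power2_eq_imp_eq) auto
qed

lemma abs_ln_le_inverse_sqrt:
  fixes x y :: real
  assumes "0 < y" "y \<le> x" "x \<le> 2"
  shows "\<bar>ln x\<bar> \<le> 1 + 2 * y powr (-1/2)"
proof -
  have "- ln x \<le> - ln y" using assms by simp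
  also have "- ln y = 2 * ln (y powr (-1/2))" using assms by (simp add: ln_powr)
  also have "\<dots> \<le> 2 * y powr (-1/2)" using ln_le_minus_one[of "y powr (-1/2)"] assms by simp
  finally have "- ln x \<le> 2 * y powr (-1/2)" .
  moreover have "ln x \<le> x - 1" using assms by (intro ln_le_minus_one) auto
  moreover have "0 \<le> 2 * y powr (-1/2)" by simp
  ultimately show ?thesis using assms(3) by linarith
qed

text \<open>
  The case of a zero on the circle itself. The means of \<open>ln |1 - \<rho> e\<^sup>i\<^sup>t|\<close> vanish for
  \<open>\<rho> < 1\<close>, and \<open>|1 - e\<^sup>i\<^sup>t| \<le> 2 |1 - \<rho> e\<^sup>i\<^sup>t|\<close> provides a dominating function with inverse square root
  singularities at the two end points, so that one can let \<open>\<rho>\<close> tend to 1.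
\<close>
lemma circle_mean_ln_one_minus_cis:
  "((\<lambda>t. ln (cmod (1 - cis t))) has_integral 0) {0..2*pi}"
proof -
  define f where "f = (\<lambda>k t. ln (cmod (1 - of_real (1 - 1 / (real k + 2)) * cis t)))"
  define h where "h = (\<lambda>t::real. 1 + 2 * (t / pi) powr (-1/2) + 2 * ((2*pi - t) / pi) powr (-1/2))"
  \<comment> \<open>The radii \<open>1 - 1 / (k + 2)\<close> lie in \<open>[1/2, 1)\<close> and tend to 1.\<close>
  have f0: "(f k has_integral 0) {0..2*pi}" for k
  proof -
    define \<rho> where "\<rho> = 1 - 1 / (real k + 2)"
    have \<rho>: "0 < \<rho>" "\<rho> < 1" by (auto simp: \<rho>_def field_simps)
    have "((\<lambda>t. ln (cmod ((\<lambda>z. 1 - z) (of_real \<rho> * cis t)))) has_integral (2 * pi * ln (cmod (1 - 0)))) {0..2*pi}"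
      by (rule circle_mean_ln_nonvanishing[of _ 1]) (use \<rho> in \<open>auto intro!: holomorphic_intros\<close>)
    thus ?thesis by (simp add: f_def \<rho>_def)
  qed
  have hint: "h integrable_on {0..2*pi}"
  proof -
    have i: "(\<lambda>t. t powr (-1/2)) integrable_on {0..2*pi}"
      by (intro integrable_on_powr_from_0) auto
    hence "(\<lambda>t. (-t) powr (-1/2)) integrable_on {-(2*pi)..-0}"
      by (rule iffD2[OF Henstock_Kurzweil_Integration.integrable_reflect_real[where f="\<lambda>t. t powr (-1/2)" and a=0 and b="2*pi"]])
    hence j: "(\<lambda>t. (2*pi - t) powr (-1/2)) integrable_on {0..2*pi}"
      using integrable_shift_real_ivl_iff[where f="\<lambda>t. (-t) powr (-1/2)" and a="-(2*pi)" and b=0 and c="-2*pi"]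
      by simp
    have "(\<lambda>t. 1 + (2 * pi powr (1/2)) * t powr (-1/2) + (2 * pi powr (1/2)) * (2*pi - t) powr (-1/2)) integrable_on {0..2*pi}"
      by (intro integrable_add integrable_const_ivl integrable_on_mult_right i j)
    thus ?thesis unfolding h_def
      by (rule integrable_eq) (auto simp: powr_divide powr_minus field_simps)
  qed
  have bound: "norm (f k t) \<le> h t" if t: "t \<in> {0<..<2*pi}" for k t
  proof -
    define \<rho> where "\<rho> = 1 - 1 / (real k + 2)"
    have \<rho>: "0 < \<rho>" "\<rho> < 1" by (auto simp: \<rho>_def field_simps)
    define y where "y = min (t / pi) ((2*pi - t) / pi)"
    have y: "0 < y" using t by (auto simp: y_def)
    have "y \<le> sin (t/2)"
    proof (cases "t \<le> pi")
      case True
      thus ?thesis using sin_ge_Jordan[of "t/2"] t by (auto simp: y_def min_def field_simps)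
    next
      case False
      have "sin (t/2) = sin (pi - t/2)" by simp
      moreover have "2 / pi * (pi - t/2) \<le> sin (pi - t/2)"
        using False t by (intro sin_ge_Jordan) auto
      ultimately show ?thesis using False by (auto simp: y_def min_def field_simps)
    qed
    hence "2 * y \<le> cmod (1 - cis t)" by (simp add: norm_one_minus_cis)
    also have "\<dots> \<le> cmod (1 - of_real \<rho> * cis t) + cmod ((of_real \<rho> - 1) * cis t)"
      by (rule order_trans[OF _ norm_triangle_ineq]) (simp add: algebra_simps)
    also have "cmod ((of_real \<rho> - 1) * cis t) = cmod (of_real (\<rho> - 1))"
      by (simp add: norm_mult)
    also have "\<dots> = 1 - \<rho>" unfolding norm_of_real using \<rho> by simp
    also have "1 - \<rho> \<le> cmod (1 - of_real \<rho> * cis t)"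
      using norm_triangle_ineq2[of 1 "of_real \<rho> * cis t"] \<rho> by (simp add: norm_mult)
    finally have "y \<le> cmod (1 - of_real \<rho> * cis t)" by simp
    moreover have "cmod (1 - of_real \<rho> * cis t) \<le> 2"
      using norm_triangle_ineq4[of 1 "of_real \<rho> * cis t"] \<rho> by (simp add: norm_mult)
    ultimately have "\<bar>f k t\<bar> \<le> 1 + 2 * y powr (-1/2)"
      unfolding f_def \<rho>_def[symmetric] using y by (intro abs_ln_le_inverse_sqrt) auto
    also have "\<dots> \<le> h t"
    proof (cases "t / pi \<le> (2*pi - t) / pi")
      case True
      hence "y = t / pi" by (simp add: y_def)
      thus ?thesis unfolding h_def by simp
    next
      case False
      hence "y = (2*pi - t) / pi" by (simp add: y_def)
      thus ?thesis unfolding h_def by simp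
    qed
    finally show ?thesis by simp
  qed
  have lim: "(\<lambda>k. f k t) \<longlonglongrightarrow> ln (cmod (1 - cis t))" if t: "t \<in> {0<..<2*pi}" for t
  proof -
    have "sin (t/2) > 0" using t by (intro sin_gt_zero) auto
    hence ne: "cmod (1 - cis t) \<noteq> 0" by (simp only: norm_one_minus_cis)
    have "(\<lambda>k. 1 - 1 / (real k + 2)) \<longlonglongrightarrow> 1" by real_asymp
    hence "(\<lambda>k. of_real (1 - 1 / (real k + 2)) :: complex) \<longlonglongrightarrow> of_real 1"
      by (rule tendsto_of_real)
    hence "(\<lambda>k. cmod (1 - of_real (1 - 1 / (real k + 2)) * cis t)) \<longlonglongrightarrow> cmod (1 - of_real 1 * cis t)"
      by (intro tendsto_norm tendsto_diff tendsto_mult tendsto_const)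
    thus ?thesis unfolding f_def using ne by (intro tendsto_ln) auto
  qed
  have fi: "f k integrable_on {0<..<2*pi}" "integral {0<..<2*pi} (f k) = 0" for k
    using f0[of k, unfolded has_integral_Icc_iff_Ioo] by (auto simp: has_integral_iff)
  have hi: "h integrable_on {0<..<2*pi}"
    using hint by (simp add: integrable_on_Icc_iff_Ioo)
  note D = dominated_convergence[OF fi(1) hi bound lim]
  have "integral {0<..<2*pi} (\<lambda>t. ln (cmod (1 - cis t))) = 0"
    using D(2) by (simp add: fi LIMSEQ_const_iff)
  thus ?thesis unfolding has_integral_Icc_iff_Ioo using D(1) by (simp add: has_integral_iff)
qed

lemma finite_zeros_cball:
  assumes "g holomorphic_on UNIV" "g w \<noteq> (0::complex)"
  shows "finite {z \<in> cball 0 t. g z = 0}"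
proof (rule ccontr)
  assume inf: "infinite {z \<in> cball 0 t. g z = 0}"
  have "{z \<in> cball 0 t. g z = 0} \<subseteq> cball 0 t" by blast
  then obtain z where z: "z islimpt {z \<in> cball 0 t. g z = 0}"
    using Heine_Borel_imp_Bolzano_Weierstrass[OF compact_cball inf] by blast
  have "g w = 0"
    by (rule analytic_continuation[OF assms(1), of "{z \<in> cball 0 t. g z = 0}" z]) (use z in auto)
  with assms show False by simp
qed

lemma negligible_zeros_on_circle:
  assumes "g holomorphic_on UNIV" "g w \<noteq> (0::complex)" "0 < r"
  shows "negligible {t \<in> {0..2*pi}. g (of_real r * cis t) = 0}"
proof (rule negligible_finite)
  have "inj_on cis {0..<2*pi}"
  proof (rule inj_onI)
    fix s t :: real assume that: "s \<in> {0..<2*pi}" "t \<in> {0..<2*pi}" "cis s = cis t"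
    have "Arg2pi (1 * exp (\<i> * s)) = s" "Arg2pi (1 * exp (\<i> * t)) = t"
      using that by (auto intro!: Arg2pi_unique[of 1])
    thus "s = t" using that(3) unfolding cis_conv_exp by metis
  qed
  hence "inj_on (\<lambda>t. of_real r * cis t) {0..<2*pi}" using \<open>0 < r\<close> by (auto simp: inj_on_def)
  hence "finite ((\<lambda>t. of_real r * cis t) -` {z \<in> cball 0 r. g z = 0} \<inter> {0..<2*pi})"
    by (intro finite_vimage_IntI finite_zeros_cball[OF assms(1,2)])
  hence "finite (insert (2*pi) ((\<lambda>t. of_real r * cis t) -` {z \<in> cball 0 r. g z = 0} \<inter> {0..<2*pi}))"
    by simp
  thus "finite {t \<in> {0..2*pi}. g (of_real r * cis t) = 0}"
    by (rule finite_subset[rotated]) (use \<open>0 < r\<close> in \<open>auto simp: norm_mult\<close>)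
qed

text \<open>
  A zero \<open>w\<close> anywhere in the closed disk contributes \<open>ln r\<close> to the mean, because
  \<open>|r e\<^sup>i\<^sup>t - w| = r |1 - u e\<^sup>i\<^sup>t|\<close> with \<open>u = cnj w / r\<close> and \<open>|u| \<le> 1\<close>.
\<close>
lemma circle_mean_ln_dist:
  assumes "0 < r" "cmod w \<le> r"
  shows "((\<lambda>t. ln (cmod (of_real r * cis t - w))) has_integral (2 * pi * ln r)) {0..2*pi}"
proof -
  define u where "u = cnj w / r"
  have eq: "cmod (of_real r * cis t - w) = r * cmod (1 - u * cis t)" for t
  proof -
    have "r * (1 - u * cis t) = cnj (of_real r * cis t - w) * cis t"
      using assms by (simp add: u_def algebra_simps cis_cnj cis_mult)
    hence "cmod (r * (1 - u * cis t)) = cmod (of_real r * cis t - w)"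
      by (metis complex_mod_cnj norm_cis mult.right_neutral norm_mult)
    thus ?thesis using assms by (simp add: norm_mult)
  qed
  have u0: "((\<lambda>t. ln (cmod (1 - u * cis t))) has_integral 0) {0..2*pi}"
  proof (cases "cmod w < r")
    case True
    show ?thesis
    proof (cases "w = 0")
      case False
      have "((\<lambda>t. ln (cmod ((\<lambda>z. 1 - u * z) (of_real 1 * cis t)))) has_integral (2 * pi * ln (cmod (1 - u * 0)))) {0..2*pi}"
      proof (rule circle_mean_ln_nonvanishing[of _ "r / cmod w"])
        fix z :: complex assume "z \<in> ball 0 (r / cmod w)"
        hence "cmod (u * z) < 1" using False assms by (auto simp: u_def norm_mult norm_divide field_simps)
        thus "1 - u * z \<noteq> 0" by auto
      qed (use True False in \<open>auto intro!: holomorphic_intros simp: field_simps\<close>)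
      thus ?thesis by simp
    qed (simp add: u_def)
  next
    case False
    hence u1: "cmod u = 1" using assms by (simp add: u_def norm_divide)
    define a where "a = Arg2pi u"
    have u: "u = cis a" using Arg2pi_eq[of u] u1 by (simp add: a_def cis_conv_exp)
    have a: "0 \<le> a" "a \<le> 2*pi" using Arg2pi[of u] by (auto simp: a_def)
    have "((\<lambda>t. ln (cmod (1 - cis (t + a)))) has_integral 0) {0..2*pi}"
      by (rule has_integral_period_shift[OF _ a circle_mean_ln_one_minus_cis])
         (simp add: add.assoc[symmetric] add.commute flip: cis_mult)
    thus ?thesis by (simp add: u cis_mult add.commute)
  qed
  have int: "((\<lambda>t. ln r + ln (cmod (1 - u * cis t))) has_integral (2 * pi * ln r + 0)) {0..2*pi}"
    using has_integral_const_real[of "ln r" 0 "2*pi"] by (intro has_integral_add u0) simp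
  have neg: "negligible {t \<in> {0..2*pi}. of_real r * cis t - w = 0}"
    by (rule negligible_zeros_on_circle[of "\<lambda>z. z - w" "w + 1" r]) (use assms in \<open>auto intro!: holomorphic_intros\<close>)
  have eq': "ln (cmod (of_real r * cis t - w)) = ln r + ln (cmod (1 - u * cis t))"
    if "t \<in> {0..2*pi} - {t \<in> {0..2*pi}. of_real r * cis t - w = 0}" for t
  proof -
    have "0 < r * cmod (1 - u * cis t)" unfolding eq[symmetric] using that by simp
    hence "0 < cmod (1 - u * cis t)" using assms(1) zero_less_mult_pos by blast
    thus ?thesis unfolding eq using assms(1) by (intro ln_mult_pos)
  qed
  show ?thesis using has_integral_spike[OF neg eq' int] by simp
qed

section \<open>Jensen's formula\<close>

lemma eventually_nonzero_entire:
  assumes "g holomorphic_on UNIV" "g w \<noteq> (0::complex)"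
  shows "eventually (\<lambda>u. g u \<noteq> 0) (at z)"
  using non_zero_neighbour_alt[of g UNIV z w] assms by auto

lemma zorder_entire_nonneg:
  assumes "g holomorphic_on UNIV" "g w \<noteq> (0::complex)"
  shows "zorder g z \<ge> 0" "g z \<noteq> 0 \<Longrightarrow> zorder g z = 0"
proof -
  have ana: "g analytic_on {z}" using assms(1) by (auto simp: analytic_on_open intro: analytic_on_subset[of _ UNIV])
  have "\<exists>\<^sub>F w in at z. g w \<noteq> 0"
    using eventually_frequently[OF _ eventually_nonzero_entire[OF assms]] by simp
  thus "zorder g z \<ge> 0" using ana by (intro zorder_ge_0)
  show "zorder g z = 0" if "g z \<noteq> 0"
    by (rule zorder_eq_0I[OF ana that])
qed

lemma zorder_linear_factor:
  "zorder (\<lambda>z. z - a) b = (if b = a then 1 else 0)"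
proof (cases "a = b")
  case True
  have "zorder (\<lambda>z. z - b) b = 1"
    by (rule zorder_eqI[of UNIV b "\<lambda>_. 1"]) auto
  with True show ?thesis by simp
next
  case False
  thus ?thesis by (auto intro!: zorder_eq_0I analytic_intros)
qed

lemma zorder_mult_linear:
  assumes h: "h holomorphic_on UNIV" "h w \<noteq> (0::complex)"
  shows "zorder (\<lambda>z. (z - a) * h z) b = (if b = a then 1 else 0) + zorder h b"
proof -
  have "eventually (\<lambda>z. (z - a) * h z \<noteq> 0) (at b)"
  proof -
    have "eventually (\<lambda>z. z \<noteq> a) (at b)"
      by (rule eventually_neq_at_within)
    with eventually_nonzero_entire[OF h, of b] show ?thesis by eventually_elim auto
  qed
  hence "zorder (\<lambda>z. (z - a) * h z) b = zorder (\<lambda>z. z - a) b + zorder h b"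
    using h(1) by (intro zorder_times_analytic analytic_intros) (auto simp: analytic_on_open intro: analytic_on_subset[of _ UNIV])
  thus ?thesis by (simp add: zorder_linear_factor)
qed

text \<open>
  Since \<open>zorder\<close> vanishes at points that are not zeros, the sum may run over any finite
  set containing the zeros; this allows comparing the zeros of two functions term by term.
\<close>
lemma zero_count_altdef:
  assumes g: "g holomorphic_on UNIV" "g w \<noteq> (0::complex)"
    and "finite S" "{z \<in> cball 0 t. g z = 0} \<subseteq> S"
  shows "zero_count t g = (\<Sum>z\<in>S. if cmod z \<le> t then zorder g z else 0)"
proof -
  have "zero_count t g = (\<Sum>z\<in>{z \<in> cball 0 t. g z = 0}. if cmod z \<le> t then zorder g z else 0)"
    unfolding zero_count_def by (intro sum.cong) auto
  also have "\<dots> = (\<Sum>z\<in>S. if cmod z \<le> t then zorder g z else 0)"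
    using assms zorder_entire_nonneg(2)[OF g] by (intro sum.mono_neutral_left) auto
  finally show ?thesis .
qed

lemma zero_count_nonneg:
  assumes g: "g holomorphic_on UNIV" "g w \<noteq> (0::complex)"
  shows "0 \<le> zero_count t g"
  unfolding zero_count_def by (intro sum_nonneg zorder_entire_nonneg[OF g])

lemma zero_count_mono:
  assumes g: "g holomorphic_on UNIV" "g w \<noteq> (0::complex)" and "s \<le> t"
  shows "zero_count s g \<le> zero_count t g"
  unfolding zero_count_def using assms finite_zeros_cball[OF g] zorder_entire_nonneg[OF g]
  by (intro sum_mono2) auto

lemma zero_count_mult_linear:
  assumes h: "h holomorphic_on UNIV" "h w \<noteq> (0::complex)"
  shows "zero_count t (\<lambda>z. (z - a) * h z) = (if cmod a \<le> t then 1 else 0) + zero_count t h"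
proof -
  have g: "(\<lambda>z. (z - a) * h z) holomorphic_on UNIV" using h by (intro holomorphic_intros)
  have "eventually (\<lambda>z. z \<noteq> a \<and> h z \<noteq> 0) (at a)"
    using eventually_nonzero_entire[OF h, of a] eventually_neq_at_within[of a a] by eventually_elim simp
  then obtain v where "v \<noteq> a \<and> h v \<noteq> 0"
    using eventually_happens'[OF at_neq_bot] by blast
  hence v: "(v - a) * h v \<noteq> 0" by simp
  define S where "S = insert a {z \<in> cball 0 t. h z = 0}"
  have S: "finite S" using finite_zeros_cball[OF h] by (simp add: S_def)
  have "zero_count t (\<lambda>z. (z - a) * h z) = (\<Sum>z\<in>S. if cmod z \<le> t then zorder (\<lambda>z. (z - a) * h z) z else 0)"
    by (rule zero_count_altdef[where g="\<lambda>z. (z - a) * h z", OF g v S]) (auto simp: S_def)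
  also have "\<dots> = (\<Sum>z\<in>S. (if z = a then (if cmod z \<le> t then 1 else 0) else 0) + (if cmod z \<le> t then zorder h z else 0))"
    by (intro sum.cong refl) (simp add: zorder_mult_linear[OF h])
  also have "\<dots> = (if cmod a \<le> t then 1 else 0) + (\<Sum>z\<in>S. if cmod z \<le> t then zorder h z else 0)"
    using S by (simp add: sum.distrib S_def)
  also have "(\<Sum>z\<in>S. if cmod z \<le> t then zorder h z else 0) = zero_count t h"
    by (rule zero_count_altdef[OF h S, symmetric]) (auto simp: S_def)
  finally show ?thesis .
qed

lemma entire_factor_zero:
  assumes g: "g holomorphic_on UNIV" and "g a = (0::complex)"
  obtains h where "h holomorphic_on UNIV" "\<And>z. g z = (z - a) * h z"
proof
  show "(\<lambda>z. if z = a then deriv g a else (g z - g a)/(z-a)) holomorphic_on UNIV"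
    using g by (rule pole_lemma_open) auto
  show "g z = (z - a) * (if z = a then deriv g a else (g z - g a)/(z-a))" for z
    using assms by auto
qed

definition jensen_kernel :: "(complex \<Rightarrow> complex) \<Rightarrow> real \<Rightarrow> real" where
  "jensen_kernel g t = of_int (zero_count t g - zero_count 0 g) / t"

text \<open>
  The contribution of a single zero of modulus \<open>c\<close> to the integral in the definition of
  \<open>nevanlinna_N\<close>.
\<close>
lemma has_integral_inverse_tail:
  fixes c r :: real
  assumes "0 < c" "0 < r"
  shows "((\<lambda>t. (if c \<le> t then 1 else 0) / t) has_integral (if c \<le> r then ln (r / c) else 0)) {0..r}"
proof (cases "c \<le> r")
  case True
  have "((\<lambda>t. 1 / t) has_integral (ln r - ln c)) {c..r}"
  proof (rule fundamental_theorem_of_calculus[where f="ln :: real \<Rightarrow> real", OF True])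
    fix x assume "x \<in> {c..r}"
    hence "(ln has_real_derivative 1 / x) (at x within {c..r})"
      using assms by (intro DERIV_subset[OF DERIV_ln_divide]) auto
    thus "(ln has_vector_derivative 1 / x) (at x within {c..r})"
      by (simp add: has_real_derivative_iff_has_vector_derivative)
  qed
  hence "((\<lambda>t. if t \<in> {c..r} then 1 / t else 0) has_integral (ln r - ln c)) {0..r}"
    using assms by (subst has_integral_restrict) auto
  hence "((\<lambda>t. (if c \<le> t then 1 else 0) / t) has_integral (ln r - ln c)) {0..r}"
    by (rule has_integral_eq[rotated]) auto
  thus ?thesis using True assms by (simp add: ln_div)
next
  case False
  have "((\<lambda>t. (if c \<le> t then 1 else 0) / t) has_integral 0) {0..r}"
    by (rule has_integral_eq[OF _ has_integral_0]) (use False in auto)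
  with False show ?thesis by simp
qed

text \<open>
  Induction on the number of zeros in the closed disk: dividing out one factor \<open>z - z0\<close>
  changes the circle mean by \<open>ln r\<close>, the value \<open>ln |g 0|\<close> by \<open>ln |z0|\<close>, and the integral of the kernel
  by \<open>ln (r / |z0|)\<close>. The integrability of the kernel is part of the claim, since the
  integral is 0 by convention for functions that are not integrable.
\<close>
lemma jensen_formula_nonzero:
  assumes g: "g holomorphic_on UNIV" "g 0 \<noteq> (0::complex)" and r: "0 < r"
  shows "jensen_kernel g integrable_on {0..r}"
    and "((\<lambda>t. ln (cmod (g (of_real r * cis t)))) has_integral
           (2 * pi * (ln (cmod (g 0)) + nevanlinna_N r g))) {0..2*pi}"
proof -
  have zc0: "zero_count 0 g = 0" if "g 0 \<noteq> 0" for g :: "complex \<Rightarrow> complex"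
  proof -
    have e: "{z \<in> cball 0 0. g z = 0} = {}" using that by auto
    show ?thesis unfolding zero_count_def e by simp
  qed
  have "\<exists>I. (jensen_kernel g has_integral I) {0..r} \<and>
      ((\<lambda>t. ln (cmod (g (of_real r * cis t)))) has_integral
           (2 * pi * (ln (cmod (g 0)) + I))) {0..2*pi}"
    using g
  proof (induction "nat (zero_count r g)" arbitrary: g)
    case 0
    have zc: "zero_count t g = 0" if "t \<le> r" for t
      using zero_count_mono[OF 0(2,3) that] zero_count_nonneg[OF 0(2,3), of r] zero_count_nonneg[OF 0(2,3), of t] 0(1) by linarith
    have nz: "g z \<noteq> 0" if "z \<in> cball 0 r" for z
    proof
      assume "g z = 0"
      then obtain h where h: "h holomorphic_on UNIV" "\<And>z'. g z' = (z' - z) * h z'"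
        using entire_factor_zero[OF 0(2)] by metis
      have "h 0 \<noteq> 0" using h(2)[of 0] 0(3) by auto
      have "zero_count r g = 1 + zero_count r h"
        using zero_count_mult_linear[OF h(1) \<open>h 0 \<noteq> 0\<close>, of r z] that unfolding h(2)[abs_def, symmetric] by simp
      thus False using zc[of r] zero_count_nonneg[OF h(1) \<open>h 0 \<noteq> 0\<close>, of r] by simp
    qed
    have "\<exists>R>r. \<forall>z\<in>ball 0 R. g z \<noteq> 0"
    proof -
      have fin: "finite (cmod ` {z \<in> cball 0 (r+1). g z = 0})"
        using finite_zeros_cball[OF 0(2,3)] by simp
      define R where "R = Min (insert (r+1) (cmod ` {z \<in> cball 0 (r+1). g z = 0}))"
      have "R > r" unfolding R_def using fin nz by (subst Min_gr_iff) (auto simp: not_le[symmetric])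
      moreover have "g z \<noteq> 0" if "z \<in> ball 0 R" for z
      proof
        assume "g z = 0"
        moreover have "R \<le> r + 1" unfolding R_def using fin by (intro Min_le) auto
        ultimately have "cmod z \<in> cmod ` {z \<in> cball 0 (r+1). g z = 0}" using that by (intro imageI) simp
        hence "R \<le> cmod z" unfolding R_def using fin by (intro Min_le) auto
        with that show False by simp
      qed
      ultimately show ?thesis by blast
    qed
    then obtain R where R: "R > r" "\<And>z. z \<in> ball 0 R \<Longrightarrow> g z \<noteq> 0" by blast
    have "((\<lambda>t. ln (cmod (g (of_real r * cis t)))) has_integral (2 * pi * ln (cmod (g 0)))) {0..2*pi}"
      by (rule circle_mean_ln_nonvanishing[of g R]) (use 0 R r in \<open>auto intro: holomorphic_on_subset\<close>)
    moreover have "(jensen_kernel g has_integral 0) {0..r}"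
      by (rule has_integral_eq[of _ "\<lambda>_. 0"]) (use r in \<open>auto simp: jensen_kernel_def zc\<close>)
    ultimately show ?case by (intro exI[of _ 0]) simp
  next
    case (Suc n)
    have "\<exists>z\<in>cball 0 r. g z = 0"
    proof (rule ccontr)
      assume "\<not> (\<exists>z\<in>cball 0 r. g z = 0)"
      hence e: "{z \<in> cball 0 r. g z = 0} = {}" by blast
      have "zero_count r g = 0" unfolding zero_count_def e by simp
      with Suc(2) show False by simp
    qed
    then obtain z where z: "cmod z \<le> r" "g z = 0" by auto
    then obtain h where h: "h holomorphic_on UNIV" "\<And>z'. g z' = (z' - z) * h z'"
      using entire_factor_zero[OF Suc(3)] by metis
    have geq: "g = (\<lambda>z'. (z' - z) * h z')" by (rule ext) (rule h(2))
    have h0: "h 0 \<noteq> 0" and z0: "z \<noteq> 0" using h(2)[of 0] Suc(4) z by auto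
    have zc: "zero_count t g = (if cmod z \<le> t then 1 else 0) + zero_count t h" for t
      unfolding geq by (rule zero_count_mult_linear[OF h(1) h0])
    have "n = nat (zero_count r h)" using Suc(2) zc[of r] z zero_count_nonneg[OF h(1) h0, of r] by simp
    from Suc(1)[OF this h(1) h0] obtain I where
      I: "(jensen_kernel h has_integral I) {0..r}"
      "((\<lambda>t. ln (cmod (h (of_real r * cis t)))) has_integral
           (2 * pi * (ln (cmod (h 0)) + I))) {0..2*pi}" by blast
    have k: "jensen_kernel g t = (if cmod z \<le> t then 1 else 0) / t + jensen_kernel h t" for t
      unfolding jensen_kernel_def using z0 by (simp add: zc add_divide_distrib diff_divide_distrib)
    have "(jensen_kernel g has_integral (ln (r / cmod z) + I)) {0..r}"
      unfolding k using has_integral_add[OF has_integral_inverse_tail[of "cmod z" r] I(1)] z z0 r by simp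
    moreover have "((\<lambda>t. ln (cmod (g (of_real r * cis t)))) has_integral
           (2 * pi * (ln (cmod (g 0)) + (ln (r / cmod z) + I)))) {0..2*pi}"
    proof -
      have int: "((\<lambda>t. ln (cmod (of_real r * cis t - z)) + ln (cmod (h (of_real r * cis t)))) has_integral
           (2 * pi * ln r + 2 * pi * (ln (cmod (h 0)) + I))) {0..2*pi}"
        by (intro has_integral_add I circle_mean_ln_dist r z)
      have eq: "ln (cmod (g (of_real r * cis t))) =
          ln (cmod (of_real r * cis t - z)) + ln (cmod (h (of_real r * cis t)))"
        if "t \<in> {0..2*pi} - {t \<in> {0..2*pi}. g (of_real r * cis t) = 0}" for t
      proof -
        have "cmod (of_real r * cis t - z) > 0" "cmod (h (of_real r * cis t)) > 0"
          using that by (auto simp: h(2))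
        thus ?thesis by (simp add: h(2) norm_mult ln_mult_pos)
      qed
      have "((\<lambda>t. ln (cmod (g (of_real r * cis t)))) has_integral
           (2 * pi * ln r + 2 * pi * (ln (cmod (h 0)) + I))) {0..2*pi}"
        by (rule has_integral_spike[OF negligible_zeros_on_circle[OF Suc(3,4) r] eq int])
      thus ?thesis using z0 r h0 by (simp add: h(2) norm_mult ln_mult ln_div algebra_simps)
    qed
    ultimately show ?case by blast
  qed
  then obtain I where I: "(jensen_kernel g has_integral I) {0..r}"
    "((\<lambda>t. ln (cmod (g (of_real r * cis t)))) has_integral
           (2 * pi * (ln (cmod (g 0)) + I))) {0..2*pi}" by blast
  show "jensen_kernel g integrable_on {0..r}" using I by blast
  have "nevanlinna_N r g = I"
    using I(1) zc0[of g] g unfolding nevanlinna_N_def jensen_kernel_def by (simp add: integral_unique)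
  with I(2) show "((\<lambda>t. ln (cmod (g (of_real r * cis t)))) has_integral
           (2 * pi * (ln (cmod (g 0)) + nevanlinna_N r g))) {0..2*pi}" by simp
qed

lemma zero_count_mult_power:
  assumes h: "h holomorphic_on UNIV" "h 0 \<noteq> (0::complex)" and "0 \<le> t"
  shows "zero_count t (\<lambda>z. z ^ k * h z) = int k + zero_count t h"
proof (induction k)
  case (Suc k)
  have hol: "(\<lambda>z. z ^ k * h z) holomorphic_on UNIV" using h by (intro holomorphic_intros)
  have "eventually (\<lambda>z. z \<noteq> 0 \<and> h z \<noteq> 0) (at 0)"
    using eventually_nonzero_entire[OF h, of 0] eventually_neq_at_within[of 0 0] by eventually_elim simp
  then obtain v where "v \<noteq> 0 \<and> h v \<noteq> 0"
    using eventually_happens'[OF at_neq_bot] by blast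
  hence v: "v ^ k * h v \<noteq> 0" by simp
  show ?case using zero_count_mult_linear[where h="\<lambda>z. z ^ k * h z", OF hol v, of t 0] Suc assms by (simp add: mult.assoc)
qed simp

text \<open>
  A zero of order \<open>k\<close> at the origin adds \<open>k ln r\<close> to both sides.
\<close>
lemma jensen_formula:
  assumes h: "h holomorphic_on UNIV" "h 0 \<noteq> (0::complex)" and r: "0 < r"
    and g: "\<And>z. g z = z ^ k * h z"
  shows "jensen_kernel g integrable_on {0..r}"
    and "((\<lambda>t. ln (cmod (g (of_real r * cis t)))) has_integral
           (2 * pi * (ln (cmod (h 0)) + nevanlinna_N r g))) {0..2*pi}"
proof -
  have zc: "zero_count t g = int k + zero_count t h" if "0 \<le> t" for t
    using zero_count_mult_power[OF h that, of k] unfolding g[abs_def, symmetric] by simp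
  have ker: "jensen_kernel g t = jensen_kernel h t" if "t \<in> {0..r}" for t
    using that by (simp add: jensen_kernel_def zc)
  show "jensen_kernel g integrable_on {0..r}"
    by (rule integrable_eq[OF jensen_formula_nonzero(1)[OF h r]]) (use ker in auto)
  have e: "{z \<in> cball 0 0. h z = 0} = {}" using h by auto
  have "zero_count 0 h = 0" unfolding zero_count_def e by simp
  moreover have "integral {0..r} (jensen_kernel g) = integral {0..r} (jensen_kernel h)"
    by (rule integral_cong) (use ker in auto)
  ultimately have N: "nevanlinna_N r g = nevanlinna_N r h + k * ln r"
    unfolding nevanlinna_N_def jensen_kernel_def[symmetric] by (simp add: zc)
  have int: "((\<lambda>t. k * ln r + ln (cmod (h (of_real r * cis t)))) has_integral
           (2 * pi * (k * ln r) + 2 * pi * (ln (cmod (h 0)) + nevanlinna_N r h))) {0..2*pi}"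
    using has_integral_const_real[of "k * ln r" 0 "2*pi"]
    by (intro has_integral_add jensen_formula_nonzero h r) simp
  have eq: "ln (cmod (g (of_real r * cis t))) = k * ln r + ln (cmod (h (of_real r * cis t)))"
    if "t \<in> {0..2*pi} - {t \<in> {0..2*pi}. h (of_real r * cis t) = 0}" for t
  proof -
    have "cmod (h (of_real r * cis t)) > 0" using that by auto
    thus ?thesis using r by (simp add: g norm_mult norm_power ln_mult_pos ln_realpow)
  qed
  have "((\<lambda>t. ln (cmod (g (of_real r * cis t)))) has_integral
           (2 * pi * (k * ln r) + 2 * pi * (ln (cmod (h 0)) + nevanlinna_N r h))) {0..2*pi}"
    by (rule has_integral_spike[OF negligible_zeros_on_circle[OF h r] eq int])
  thus "((\<lambda>t. ln (cmod (g (of_real r * cis t)))) has_integral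
           (2 * pi * (ln (cmod (h 0)) + nevanlinna_N r g))) {0..2*pi}"
    by (simp add: N algebra_simps)
qed

lemma nevanlinna_N_mono:
  assumes g: "g holomorphic_on UNIV" "g w \<noteq> (0::complex)"
    and int: "\<And>r. 0 < r \<Longrightarrow> jensen_kernel g integrable_on {0..r}"
    and "0 < r" "r \<le> r'"
  shows "nevanlinna_N r g \<le> nevanlinna_N r' g"
proof -
  have "integral {0..r} (jensen_kernel g) \<le> integral {0..r'} (jensen_kernel g)"
    using assms zero_count_mono[OF g, of 0]
    by (intro integral_subset_le int) (auto simp: jensen_kernel_def intro!: divide_nonneg_nonneg)
  moreover have "of_int (zero_count 0 g) * ln r \<le> of_int (zero_count 0 g) * ln r'"
    using assms zero_count_nonneg[OF g, of 0] by (intro mult_left_mono) auto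
  ultimately show ?thesis unfolding nevanlinna_N_def jensen_kernel_def[symmetric] by simp
qed

section \<open>Decay of the Bessel function of order zero\<close>

text \<open>
  The normalised integral representation of the Bessel function \<open>J\<^sub>0\<close>, which is the
  Fourier transform of the uniform distribution on the unit circle.
\<close>
definition bessel_J0 :: "real \<Rightarrow> real" where
  "bessel_J0 s = integral {0..2*pi} (\<lambda>x. cos (s * cos x)) / (2 * pi)"

lemma bessel_J0_quarter: "bessel_J0 s = 2 / pi * integral {0..pi/2} (\<lambda>x. cos (s * cos x))"
proof -
  let ?F = "\<lambda>x. cos (s * cos x)"
  have int: "?F integrable_on {a..b}" for a b
    by (intro integrable_continuous_real continuous_intros)
  have "integral {pi - pi..2*pi - pi} (\<lambda>x. ?F (x + pi)) = integral {pi..2*pi} ?F"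
    by (rule integral_shift_real_ivl)
  hence shift: "integral {pi..2*pi} ?F = integral {0..pi} ?F" by simp
  have "integral {pi/2..pi} ?F = integral {-pi..-(pi/2)} (\<lambda>x. ?F (-x))"
    by (rule Henstock_Kurzweil_Integration.integral_reflect_real[symmetric])
  also have "\<dots> = integral {-pi - (-pi)..-(pi/2) - (-pi)} (\<lambda>x. ?F (-(x + (-pi))))"
    by (rule integral_shift_real_ivl[symmetric])
  also have "\<dots> = integral {0..pi/2} ?F" by simp
  finally have refl: "integral {pi/2..pi} ?F = integral {0..pi/2} ?F" .
  have A: "integral {0..2*pi} ?F = integral {0..pi} ?F + integral {pi..2*pi} ?F"
    by (rule Henstock_Kurzweil_Integration.integral_combine[symmetric]) (auto intro!: int)
  have B: "integral {0..pi} ?F = integral {0..pi/2} ?F + integral {pi/2..pi} ?F"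
    by (rule Henstock_Kurzweil_Integration.integral_combine[symmetric]) (auto intro!: int)
  show ?thesis by (simp add: bessel_J0_def A shift B refl)
qed

text \<open>
  Integration by parts. Away from 0 the phase \<open>s cos x\<close> has no critical point, and
  \<open>-sin (s cos x) / (s sin x)\<close> is an antiderivative of the integrand up to an error whose modulus has
  the explicit antiderivative \<open>-1 / (s sin x)\<close>.
\<close>
lemma oscillatory_integral_bound:
  assumes "0 < s" "0 < \<eta>" "\<eta> \<le> pi / 2"
  shows "\<bar>integral {\<eta>..pi/2} (\<lambda>x. cos (s * cos x))\<bar> \<le> 2 / (s * sin \<eta>)"
proof -
  let ?F = "\<lambda>x. cos (s * cos x)"
  let ?H = "\<lambda>x. - (sin (s * cos x) / (s * sin x))"
  let ?E = "\<lambda>x. sin (s * cos x) * cos x / (s * (sin x)\<^sup>2)"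
  let ?B = "\<lambda>x. cos x / (s * (sin x)\<^sup>2)"
  have pos: "sin x > 0" if "x \<in> {\<eta>..pi/2}" for x
    using that assms by (intro sin_gt_zero) (auto intro: less_le_trans le_less_trans[of _ "pi/2"])
  have "((\<lambda>x. ?F x + ?E x) has_integral (?H (pi/2) - ?H \<eta>)) {\<eta>..pi/2}"
  proof (rule fundamental_theorem_of_calculus[where f="?H", OF assms(3)])
    fix x assume x: "x \<in> {\<eta>..pi/2}"
    have "(?H has_real_derivative (?F x + ?E x)) (at x within {\<eta>..pi/2})"
      using pos[OF x] assms
      by (auto intro!: derivative_eq_intros simp: field_simps power2_eq_square)
    thus "(?H has_vector_derivative (?F x + ?E x)) (at x within {\<eta>..pi/2})"
      by (simp add: has_real_derivative_iff_has_vector_derivative)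
  qed
  hence 1: "integral {\<eta>..pi/2} (\<lambda>x. ?F x + ?E x) = sin (s * cos \<eta>) / (s * sin \<eta>)"
    by (simp add: integral_unique)
  have "(?B has_integral (- (1 / (s * sin (pi/2))) - (- (1 / (s * sin \<eta>))))) {\<eta>..pi/2}"
  proof (rule fundamental_theorem_of_calculus[where f="\<lambda>x. - (1 / (s * sin x))", OF assms(3)])
    fix x assume x: "x \<in> {\<eta>..pi/2}"
    have "((\<lambda>x. - (1 / (s * sin x))) has_real_derivative (?B x)) (at x within {\<eta>..pi/2})"
      using pos[OF x] assms
      by (auto intro!: derivative_eq_intros simp: field_simps power2_eq_square)
    thus "((\<lambda>x. - (1 / (s * sin x))) has_vector_derivative (?B x)) (at x within {\<eta>..pi/2})"
      by (simp add: has_real_derivative_iff_has_vector_derivative)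
  qed
  hence B: "?B integrable_on {\<eta>..pi/2}" "integral {\<eta>..pi/2} ?B = 1 / (s * sin \<eta>) - 1 / s"
    by (auto simp: has_integral_iff)
  have Fi: "?F integrable_on {\<eta>..pi/2}"
    by (intro integrable_continuous_real continuous_intros)
  have Ei: "?E integrable_on {\<eta>..pi/2}"
    by (intro integrable_continuous_real continuous_intros) (use pos assms in force)
  have E: "\<bar>integral {\<eta>..pi/2} ?E\<bar> \<le> 1 / (s * sin \<eta>) - 1 / s"
  proof -
    have "norm (integral {\<eta>..pi/2} ?E) \<le> integral {\<eta>..pi/2} ?B"
    proof (rule integral_norm_bound_integral[OF Ei B(1)])
      fix x assume x: "x \<in> {\<eta>..pi/2}"
      have c: "cos x \<ge> 0" using x assms by (intro cos_ge_zero) auto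
      have "norm (?E x) = \<bar>sin (s * cos x)\<bar> * (cos x / (s * (sin x)\<^sup>2))"
        using c assms by (simp add: abs_mult)
      also have "\<dots> \<le> 1 * (cos x / (s * (sin x)\<^sup>2))"
        using c assms by (intro mult_right_mono) auto
      finally show "norm (?E x) \<le> ?B x" by simp
    qed
    thus ?thesis unfolding B(2) by simp
  qed
  have "\<bar>sin (s * cos \<eta>) / (s * sin \<eta>)\<bar> \<le> 1 / (s * sin \<eta>)"
    using pos[of \<eta>] assms by (simp add: abs_mult divide_right_mono)
  moreover have "integral {\<eta>..pi/2} ?F = sin (s * cos \<eta>) / (s * sin \<eta>) - integral {\<eta>..pi/2} ?E"
    using 1 integral_add[OF Fi Ei] by simp
  moreover have "2 / (s * sin \<eta>) = 1 / (s * sin \<eta>) + 1 / (s * sin \<eta>)" by simp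
  moreover have "1 / s > 0" using assms by simp
  ultimately show ?thesis using E by linarith
qed

text \<open>
  The piece of length \<open>1 / sqrt s\<close> next to the critical point is estimated trivially, the
  rest by the previous bound.
\<close>
lemma bessel_J0_decay:
  assumes "1 \<le> s"
  shows "\<bar>bessel_J0 s\<bar> \<le> 3 / sqrt s"
proof -
  let ?F = "\<lambda>x. cos (s * cos x)"
  \<comment> \<open>This cut-off balances the trivial bound \<open>\<eta>\<close> against \<open>pi / (s \<eta>)\<close>.\<close>
  define \<eta> where "\<eta> = 1 / sqrt s"
  have s: "sqrt s \<ge> 1" using assms by simp
  have "\<eta> \<le> 1" using s by (simp add: \<eta>_def)
  hence "\<eta> \<le> pi/2" using pi_gt3 by linarith
  moreover have "0 < \<eta>" using assms by (simp add: \<eta>_def)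
  ultimately have \<eta>: "0 < \<eta>" "\<eta> \<le> pi/2" by auto
  have int: "?F integrable_on {a..b}" for a b
    by (intro integrable_continuous_real continuous_intros)
  have "norm (integral {0..\<eta>} ?F) \<le> integral {0..\<eta>} (\<lambda>_. 1::real)"
    by (rule integral_norm_bound_integral[OF int]) auto
  hence 1: "\<bar>integral {0..\<eta>} ?F\<bar> \<le> \<eta>" using \<eta> by simp
  have "0 < sin \<eta>" using \<eta> pi_gt_zero by (intro sin_gt_zero) (auto simp del: pi_gt_zero)
  have "\<bar>integral {\<eta>..pi/2} ?F\<bar> \<le> 2 / (s * sin \<eta>)"
    using assms \<eta> by (intro oscillatory_integral_bound) auto
  also have "\<dots> \<le> 2 / (s * (2 / pi * \<eta>))"
    using assms \<eta> sin_ge_Jordan[of \<eta>] \<open>0 < sin \<eta>\<close> by (intro divide_left_mono mult_left_mono mult_pos_pos) auto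
  also have "\<dots> = pi / sqrt s"
    using assms real_sqrt_mult_self[of s] by (simp add: \<eta>_def field_simps)
  finally have 2: "\<bar>integral {\<eta>..pi/2} ?F\<bar> \<le> pi / sqrt s" .
  have "integral {0..pi/2} ?F = integral {0..\<eta>} ?F + integral {\<eta>..pi/2} ?F"
    by (rule Henstock_Kurzweil_Integration.integral_combine[symmetric]) (use \<eta> in \<open>auto intro!: int\<close>)
  with 1 2 have "\<bar>integral {0..pi/2} ?F\<bar> \<le> (1 + pi) / sqrt s"
    by (simp add: \<eta>_def add_divide_distrib)
  hence "\<bar>bessel_J0 s\<bar> \<le> 2 / pi * ((1 + pi) / sqrt s)"
    by (simp only: bessel_J0_quarter abs_mult) (intro mult_mono, auto)
  also have "\<dots> = (2 * (1 + pi) / pi) / sqrt s" by simp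
  also have "\<dots> \<le> 3 / sqrt s"
    using pi_gt3 assms by (intro divide_right_mono) (auto simp: field_simps)
  finally show ?thesis .
qed

text \<open>
  The doubling formula for the cosine together with \<open>(mean cos)\<^sup>2 \<le> mean (cos\<^sup>2)\<close>.
\<close>
lemma bessel_J0_double: "2 * (bessel_J0 s)\<^sup>2 - 1 \<le> bessel_J0 (2 * s)"
proof -
  let ?F = "\<lambda>x. cos (s * cos x)"
  define J where "J = bessel_J0 s"
  have int: "?F integrable_on {a..b}" for a b
    by (intro integrable_continuous_real continuous_intros)
  have IJ: "integral {0..2*pi} ?F = 2 * pi * J" by (simp add: J_def bessel_J0_def)
  have "0 \<le> integral {0..2*pi} (\<lambda>x. 2 * (?F x - J)\<^sup>2)"
    by (intro Henstock_Kurzweil_Integration.integral_nonneg integrable_continuous_real continuous_intros) auto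
  also have "(\<lambda>x. 2 * (?F x - J)\<^sup>2) = (\<lambda>x. cos ((2 * s) * cos x) + (1 + 2 * J\<^sup>2) - (4 * J) * ?F x)"
    using cos_double_cos[of "s * cos x" for x]
    by (intro ext) (simp add: power2_eq_square algebra_simps)
  also have "integral {0..2*pi} \<dots> = integral {0..2*pi} (\<lambda>x. cos ((2 * s) * cos x)) + integral {0..2*pi} (\<lambda>x. 1 + 2 * J\<^sup>2)
     - integral {0..2*pi} (\<lambda>x. (4 * J) * ?F x)"
    by (subst Henstock_Kurzweil_Integration.integral_diff Henstock_Kurzweil_Integration.integral_add;
        (intro integrable_continuous_real continuous_intros)?)+ simp
  also have "\<dots> = 2 * pi * bessel_J0 (2 * s) + 2 * pi * (1 + 2 * J\<^sup>2) - (4 * J) * (2 * pi * J)"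
    by (simp only: integral_mult_right IJ) (simp add: bessel_J0_def)
  also have "\<dots> = 2 * pi * (bessel_J0 (2 * s) - (2 * J\<^sup>2 - 1))"
    by (simp add: algebra_simps power2_eq_square)
  finally show ?thesis using pi_gt_zero by (auto simp: J_def zero_le_mult_iff simp del: pi_gt_zero)
qed

text \<open>
  Doubling carries the decay at large arguments down to small ones: if \<open>1 - J\<^sub>0\<^sup>2\<close> is
  at least \<open>c (2 s)\<^sup>2\<close> at \<open>2 s\<close>, then it is at least \<open>c s\<^sup>2\<close> at \<open>s\<close>. The range from 18 to 36 starts the
  induction, as \<open>J\<^sub>0\<^sup>2 \<le> 9 / s \<le> 1/2\<close> there, and 2592 is twice the square of 36.
\<close>
lemma bessel_J0_small:
  assumes "18 \<le> 2 ^ n * s" "s \<le> 36" 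
  shows "(bessel_J0 s)\<^sup>2 \<le> 1 - s\<^sup>2 / 2592"
  using assms
proof (induction n arbitrary: s)
  have large: "(bessel_J0 s)\<^sup>2 \<le> 1 - s\<^sup>2 / 2592" if "18 \<le> s" "s \<le> 36" for s
  proof -
    have "(bessel_J0 s)\<^sup>2 \<le> (3 / sqrt s)\<^sup>2"
      using bessel_J0_decay[of s] that by (subst abs_le_square_iff[symmetric]) auto
    also have "\<dots> = 9 / s" using that by (simp add: power_divide)
    also have "\<dots> \<le> 1 / 2" using that by (simp add: field_simps)
    also have "\<dots> \<le> 1 - s\<^sup>2 / 2592" using power_mono[of s 36 2] that by simp
    finally show ?thesis .
  qed
  {
    case 0 thus ?case using large by simp
  next
    case (Suc n)
    show ?case
    proof (cases "18 \<le> s")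
      case True thus ?thesis using large Suc by simp
    next
      case False
      have "(bessel_J0 (2 * s))\<^sup>2 \<le> 1 - (2 * s)\<^sup>2 / 2592"
        using Suc.prems False by (intro Suc.IH) auto
      moreover have "1 - (bessel_J0 (2 * s))\<^sup>2 \<le> 2 * (1 - bessel_J0 (2 * s))"
        using zero_le_power2[of "1 - bessel_J0 (2 * s)"] by (simp add: power2_eq_square algebra_simps)
      ultimately show ?thesis using bessel_J0_double[of s] by (simp add: power2_eq_square)
    qed
  }
qed

text \<open>
  One algebraic inequality combining quadratic behaviour at 0 with decay at infinity,
  in a form that can be multiplied over many factors.
\<close>
lemma bessel_J0_bound:
  assumes "0 \<le> s"
  shows "(bessel_J0 s) ^ 4 * (1 + s\<^sup>2 / 1296) \<le> 1"
proof (cases "18 \<le> s")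
  case True
  have "\<bar>bessel_J0 s\<bar> ^ 4 \<le> (3 / sqrt s) ^ 4"
    using bessel_J0_decay[of s] True by (intro power_mono) auto
  also have "(3 / sqrt s) ^ 4 = 81 / s\<^sup>2"
    using True real_sqrt_pow2[of s] by (simp add: power_divide power4_eq_xxxx power2_eq_square)
  finally have "(bessel_J0 s) ^ 4 * (1 + s\<^sup>2 / 1296) \<le> 81 / s\<^sup>2 * (1 + s\<^sup>2 / 1296)"
    by (intro mult_right_mono) auto
  also have "\<dots> = 81 / s\<^sup>2 + 1 / 16" using True by (simp add: field_simps)
  also have "\<dots> \<le> 1" using power_mono[of 18 s 2] True by (simp add: field_simps)
  finally show ?thesis .
next
  case False
  show ?thesis
  proof (cases "s = 0")
    case True
    thus ?thesis by (simp add: bessel_J0_def)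
  next
    case s0: False
    obtain n where "18 / s < 2 ^ n" using real_arch_pow[of 2 "18/s"] by auto
    hence "18 \<le> 2 ^ n * s" using assms s0 by (simp add: field_simps)
    hence J: "(bessel_J0 s)\<^sup>2 \<le> 1 - s\<^sup>2 / 2592" using False by (intro bessel_J0_small) auto
    define y where "y = s\<^sup>2 / 2592"
    have y: "0 \<le> y" "y \<le> 1" using power_mono[of s 18 2] assms False by (auto simp: y_def)
    have "(bessel_J0 s) ^ 4 = ((bessel_J0 s)\<^sup>2)\<^sup>2" by simp
    also have "\<dots> \<le> (1 - y)\<^sup>2" using J y by (intro power_mono) (auto simp: y_def)
    finally have "(bessel_J0 s) ^ 4 * (1 + s\<^sup>2 / 1296) \<le> (1 - y)\<^sup>2 * (1 + 2 * y)"
      using y by (intro mult_mono) (auto simp: y_def)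
    also have "\<dots> = 1 - y\<^sup>2 * (3 - 2 * y)" by (simp add: power2_eq_square algebra_simps)
    also have "\<dots> \<le> 1" using y by simp
    finally show ?thesis .
  qed
qed

text \<open>
  A product of \<open>1 + x\<^sub>j\<close> dominates the second elementary symmetric polynomial.
\<close>
lemma prod_one_plus_ge_e2:
  fixes x :: "'i \<Rightarrow> real"
  assumes "finite A" "\<And>j. j \<in> A \<Longrightarrow> 0 \<le> x j"
  shows "((sum x A)\<^sup>2 - (\<Sum>j\<in>A. (x j)\<^sup>2)) / 2 \<le> (\<Prod>j\<in>A. 1 + x j)"
proof -
  have "1 + sum x A \<le> (\<Prod>j\<in>A. 1 + x j) \<and> ((sum x A)\<^sup>2 - (\<Sum>j\<in>A. (x j)\<^sup>2)) / 2 \<le> (\<Prod>j\<in>A. 1 + x j)"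
    using assms
  proof (induction A rule: finite_induct)
    case (insert a A)
    define P where "P = (\<Prod>j\<in>A. 1 + x j)"
    have IH: "1 + sum x A \<le> P" "((sum x A)\<^sup>2 - (\<Sum>j\<in>A. (x j)\<^sup>2)) / 2 \<le> P" "0 \<le> x a"
      "0 \<le> sum x A"
      using insert by (auto simp: P_def intro!: sum_nonneg)
    have "sum x A * x a \<le> P * x a" using IH by (intro mult_right_mono) auto
    moreover have "1 * x a \<le> P * x a" using IH by (intro mult_right_mono) auto
    ultimately show ?case using insert(1,2) IH
      by (simp add: P_def[symmetric] algebra_simps power2_eq_square)
  qed auto
  thus ?thesis by blast
qed

text \<open>
  The fourth power of the product is at most \<open>1 / \<Prod>(1 + c b\<^sub>j\<^sup>2)\<close> with \<open>c\<close> proportional to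
  \<open>s\<^sup>2\<close>. When no \<open>b\<^sub>j\<^sup>2\<close> exceeds 1/2 and their sum is at least 3/4, the second
  symmetric polynomial of the \<open>b\<^sub>j\<^sup>2\<close> is at least 3/32, so the denominator is at least a multiple of
  \<open>s\<^sup>4\<close>.
\<close>
lemma bessel_prod_bound:
  fixes b :: "nat \<Rightarrow> real"
  assumes "0 < s" "\<And>j. 0 \<le> b j" "\<And>j. (b j)\<^sup>2 \<le> 1/2" "3/4 \<le> (\<Sum>j<n. (b j)\<^sup>2)"
  shows "(\<Prod>j<n. \<bar>bessel_J0 (b j * s)\<bar>) \<le> 72 / s"
proof -
  define P where "P = (\<Prod>j<n. \<bar>bessel_J0 (b j * s)\<bar>)"
  define c where "c = s\<^sup>2 / 1296"
  define Q where "Q = (\<Prod>j<n. 1 + c * (b j)\<^sup>2)"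
  define \<Sigma> where "\<Sigma> = (\<Sum>j<n. (b j)\<^sup>2)"
  have P0: "0 \<le> P" by (simp add: P_def prod_nonneg)
  have c0: "0 < c" using assms by (simp add: c_def)
  have "P ^ 4 * Q = (\<Prod>j<n. \<bar>bessel_J0 (b j * s)\<bar> ^ 4 * (1 + c * (b j)\<^sup>2))"
    by (simp add: P_def Q_def prod.distrib prod_power_distrib)
  also have "\<dots> \<le> 1"
  proof (rule prod_le_1, intro conjI)
    fix j
    show "\<bar>bessel_J0 (b j * s)\<bar> ^ 4 * (1 + c * (b j)\<^sup>2) \<le> 1"
      using bessel_J0_bound[of "b j * s"] assms by (simp add: c_def power_mult_distrib mult.commute)
    show "0 \<le> \<bar>bessel_J0 (b j * s)\<bar> ^ 4 * (1 + c * (b j)\<^sup>2)" using c0 by simp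
  qed
  finally have PQ: "P ^ 4 * Q \<le> 1" .
  have "((\<Sum>j<n. c * (b j)\<^sup>2)\<^sup>2 - (\<Sum>j<n. (c * (b j)\<^sup>2)\<^sup>2)) / 2 \<le> Q"
    unfolding Q_def using c0 by (intro prod_one_plus_ge_e2) auto
  moreover have "(\<Sum>j<n. c * (b j)\<^sup>2) = c * \<Sigma>" by (simp add: \<Sigma>_def sum_distrib_left)
  moreover have "(\<Sum>j<n. (c * (b j)\<^sup>2)\<^sup>2) \<le> c\<^sup>2 * (\<Sigma> / 2)"
  proof -
    have "(\<Sum>j<n. (c * (b j)\<^sup>2)\<^sup>2) = c\<^sup>2 * (\<Sum>j<n. (b j)\<^sup>2 * (b j)\<^sup>2)"
      by (simp add: sum_distrib_left power_mult_distrib power2_eq_square algebra_simps)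
    also have "\<dots> \<le> c\<^sup>2 * (\<Sum>j<n. (b j)\<^sup>2 * (1/2))"
      using assms by (intro mult_left_mono sum_mono) auto
    finally show ?thesis by (simp add: \<Sigma>_def sum_divide_distrib)
  qed
  ultimately have "((c * \<Sigma>)\<^sup>2 - c\<^sup>2 * (\<Sigma> / 2)) / 2 \<le> Q" by simp
  moreover have "((c * \<Sigma>)\<^sup>2 - c\<^sup>2 * (\<Sigma> / 2)) / 2 = c\<^sup>2 * (\<Sigma> * (\<Sigma> - 1/2) / 2)"
    by (simp add: power2_eq_square algebra_simps)
  moreover have "c\<^sup>2 * (3/4 * (3/4 - 1/2) / 2) \<le> c\<^sup>2 * (\<Sigma> * (\<Sigma> - 1/2) / 2)"
    using assms(4) by (intro mult_left_mono divide_right_mono mult_mono) (auto simp: \<Sigma>_def)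
  ultimately have "c\<^sup>2 * (3/32) \<le> Q" by simp
  hence "P ^ 4 * (c\<^sup>2 * (3/32)) \<le> 1" using PQ P0
    by (intro order_trans[OF mult_left_mono PQ]) auto
  hence "P ^ 4 \<le> (72 / s) ^ 4"
    using assms(1) by (simp add: c_def field_simps power2_eq_square power4_eq_xxxx)
  thus ?thesis unfolding P_def[symmetric] using assms(1) P0 power_mono_iff[of P "72 / s" 4] by simp
qed

section \<open>From Fourier decay to small ball estimates\<close>

lemma cis_borel_measurable [measurable]: "cis \<in> borel_measurable borel"
  by (intro borel_measurable_continuous_onI continuous_intros)

text \<open>
  The standard Gaussian measure on the plane, used as an averaging kernel on the Fourier
  side.
\<close>
definition plane_normal :: "(real \<times> real) measure" where
  "plane_normal = std_normal_distribution \<Otimes>\<^sub>M std_normal_distribution"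

definition plane_point :: "real \<times> real \<Rightarrow> complex" where
  "plane_point p = of_real (fst p) + \<i> * of_real (snd p)"

lemma inner_plane_point: "z \<bullet> plane_point p = Re z * fst p + Im z * snd p"
  by (simp add: inner_complex_def plane_point_def)

lemma sets_plane_normal [measurable_cong, simp]: "sets plane_normal = sets (borel \<Otimes>\<^sub>M borel)"
  unfolding plane_normal_def by (intro sets_pair_measure_cong) auto

lemma space_plane_normal [simp]: "space plane_normal = UNIV"
  unfolding plane_normal_def by (simp add: space_pair_measure)

lemma plane_point_measurable [measurable]: "plane_point \<in> borel_measurable (borel \<Otimes>\<^sub>M borel)"
  unfolding plane_point_def by measurable

lemma pair_prob_space_normal: "pair_prob_space std_normal_distribution std_normal_distribution"
proof -
  interpret real_distribution std_normal_distribution by (rule real_dist_normal_dist)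
  show ?thesis by unfold_locales
qed

lemma prob_space_plane_normal: "prob_space plane_normal"
proof -
  interpret pair_prob_space std_normal_distribution std_normal_distribution by (rule pair_prob_space_normal)
  show ?thesis unfolding plane_normal_def by unfold_locales
qed

lemma plane_normal_fourier:
  "(CLINT p|plane_normal. iexp (z \<bullet> plane_point p)) = of_real (exp (- (cmod z)\<^sup>2 / 2))"
proof -
  interpret P: pair_prob_space std_normal_distribution std_normal_distribution by (rule pair_prob_space_normal)
  have int: "integrable (std_normal_distribution \<Otimes>\<^sub>M std_normal_distribution) (\<lambda>p. iexp (z \<bullet> plane_point p))"
    by (rule P.P.integrable_const_bound[of _ 1]) (auto simp: inner_plane_point)
  have "(CLINT p|plane_normal. iexp (z \<bullet> plane_point p)) =
      (CLINT x|std_normal_distribution. CLINT y|std_normal_distribution. iexp (z \<bullet> plane_point (x, y)))"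
    unfolding plane_normal_def by (rule P.integral_fst'[OF int, symmetric])
  also have "\<dots> = (CLINT x|std_normal_distribution. CLINT y|std_normal_distribution.
        iexp (Re z * x) * iexp (Im z * y))"
    by (simp add: inner_plane_point exp_add distrib_left)
  also have "\<dots> = char std_normal_distribution (Re z) * char std_normal_distribution (Im z)"
    unfolding char_def by simp
  also have "\<dots> = of_real (exp (- (Re z)\<^sup>2 / 2) * exp (- (Im z)\<^sup>2 / 2))"
    by (simp add: char_std_normal_distribution)
  also have "exp (- (Re z)\<^sup>2 / 2) * exp (- (Im z)\<^sup>2 / 2) = exp (- (cmod z)\<^sup>2 / 2)"
    by (simp add: cmod_power2 add_divide_distrib flip: exp_add)
  finally show ?thesis .
qed

lemma std_normal_density_le_1: "std_normal_density x \<le> 1"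
proof -
  have "1 \<le> sqrt (2 * pi)" using pi_gt3 by simp
  hence "1 / sqrt (2 * pi) * exp (- x\<^sup>2 / 2) \<le> 1 * 1"
    by (intro mult_mono) (auto simp: divide_le_eq_1)
  thus ?thesis by (simp add: std_normal_density_def)
qed

lemma integrable_normal_negative_power:
  assumes "0 < s" "s < 1"
  shows "integrable std_normal_distribution (\<lambda>x. \<bar>x\<bar> powr (-s))"
proof -
  have i: "(\<lambda>x. x powr (-s)) integrable_on {0..1}"
    using assms by (intro integrable_on_powr_from_0) auto
  hence i1: "(\<lambda>x. \<bar>x\<bar> powr (-s)) integrable_on {0..1}"
    by (rule integrable_eq) auto
  have "(\<lambda>x. (\<lambda>x. \<bar>x\<bar> powr (-s)) (-x)) integrable_on {-1..-0}"
    by (rule iffD2[OF Henstock_Kurzweil_Integration.integrable_reflect_real i1])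
  hence i2: "(\<lambda>x. \<bar>x\<bar> powr (-s)) integrable_on {-1..0}" by simp
  have "(\<lambda>x. \<bar>x\<bar> powr (-s)) integrable_on {-1..1}"
    by (rule Henstock_Kurzweil_Integration.integrable_combine[OF _ _ i2 i1]) auto
  hence "(\<lambda>x. \<bar>x\<bar> powr (-s)) absolutely_integrable_on {-1..1}"
    by (intro nonnegative_absolutely_integrable_1) auto
  hence "set_integrable lborel {-1..1} (\<lambda>x. \<bar>x\<bar> powr (-s))"
    unfolding set_integrable_def by (subst (asm) integrable_completion) auto
  hence "integrable lborel (\<lambda>x. indicator {-1..1} x * \<bar>x\<bar> powr (-s) + std_normal_density x)"
    unfolding set_integrable_def by (intro Bochner_Integration.integrable_add) (auto intro!: integrable_normal_density)
  hence "integrable lborel (\<lambda>x. std_normal_density x * \<bar>x\<bar> powr (-s))"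
  proof (rule Bochner_Integration.integrable_bound)
    show "AE x in lborel. norm (std_normal_density x * \<bar>x\<bar> powr (-s))
        \<le> norm (indicator {-1..1} x * \<bar>x\<bar> powr (-s) + std_normal_density x)"
    proof (intro AE_I2)
      fix x :: real
      show "norm (std_normal_density x * \<bar>x\<bar> powr (-s))
        \<le> norm (indicator {-1..1} x * \<bar>x\<bar> powr (-s) + std_normal_density x)"
      proof (cases "x \<in> {-1..1}")
        case True
        have "std_normal_density x * \<bar>x\<bar> powr (-s) \<le> 1 * \<bar>x\<bar> powr (-s)"
          using std_normal_density_le_1[of x] by (intro mult_right_mono) auto
        with True show ?thesis by (simp add: add_increasing2)
      next
        case False
        hence "1 \<le> \<bar>x\<bar>" by auto
        hence "\<bar>x\<bar> powr (-s) \<le> 1" using assms by (simp add: powr_minus ge_one_powr_ge_zero inverse_le_1_iff)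
        hence "std_normal_density x * \<bar>x\<bar> powr (-s) \<le> std_normal_density x * 1"
          by (intro mult_left_mono) auto
        with False show ?thesis by simp
      qed
    qed
  qed measurable
  thus ?thesis by (subst integrable_density) (auto simp: normal_density_nonneg)
qed

lemma AE_plane_normal_nonzero: "AE p in plane_normal. fst p \<noteq> 0 \<and> snd p \<noteq> 0"
proof -
  interpret P: pair_prob_space std_normal_distribution std_normal_distribution by (rule pair_prob_space_normal)
  have "AE x in lborel. x \<noteq> (0::real)" by (rule AE_lborel_singleton)
  hence a: "AE x in std_normal_distribution. x \<noteq> (0::real)"
    by (subst AE_density) auto
  have b: "AE x in std_normal_distribution. AE y in std_normal_distribution. fst (x, y) \<noteq> 0 \<and> snd (x, y) \<noteq> 0"
    using a by eventually_elim (use a in auto)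
  show ?thesis unfolding plane_normal_def
    by (rule P.AE_pair_measure[OF _ b]) measurable
qed

text \<open>
  Since \<open>|z|\<^sup>2 \<ge> |Re z| |Im z|\<close>, the negative power is dominated by a product of
  functions of one variable, each with a singularity of exponent \<open>q/2 < 1\<close>.
\<close>
lemma integrable_plane_normal_negative_power:
  assumes "0 < q" "q < 2"
  shows "integrable plane_normal (\<lambda>p. cmod (plane_point p) powr (-q))"
proof -
  interpret P: pair_prob_space std_normal_distribution std_normal_distribution by (rule pair_prob_space_normal)
  have i: "integrable std_normal_distribution (\<lambda>x. \<bar>x\<bar> powr (-(q/2)))"
    using assms by (intro integrable_normal_negative_power) auto
  have i2: "integrable plane_normal (\<lambda>p. \<bar>fst p\<bar> powr (-(q/2)) * \<bar>snd p\<bar> powr (-(q/2)))"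
    unfolding plane_normal_def
    by (rule P.Fubini_integrable) (auto intro!: i integrable_mult_right integrable_mult_left simp: abs_mult)
  show ?thesis
  proof (rule Bochner_Integration.integrable_bound[OF i2])
    show "AE p in plane_normal. norm (cmod (plane_point p) powr - q)
        \<le> norm (\<bar>fst p\<bar> powr - (q / 2) * \<bar>snd p\<bar> powr - (q / 2))"
      using AE_plane_normal_nonzero
    proof eventually_elim
      case (elim p)
      have pos: "0 < \<bar>fst p\<bar> * \<bar>snd p\<bar>" using elim by simp
      have "(cmod (plane_point p))\<^sup>2 = (fst p)\<^sup>2 + (snd p)\<^sup>2"
        by (simp add: cmod_power2 plane_point_def)
      also have "\<dots> \<ge> \<bar>fst p\<bar> * \<bar>snd p\<bar>"
        using sum_squares_bound[of "\<bar>fst p\<bar>" "\<bar>snd p\<bar>"] pos by simp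
      finally have ge: "\<bar>fst p\<bar> * \<bar>snd p\<bar> \<le> (cmod (plane_point p))\<^sup>2" .
      have "cmod (plane_point p) powr (-q) = ((cmod (plane_point p))\<^sup>2) powr (-(q/2))"
        using powr_powr[of "cmod (plane_point p)" 2 "-(q/2)"] by simp
      also have "\<dots> \<le> (\<bar>fst p\<bar> * \<bar>snd p\<bar>) powr (-(q/2))"
        using assms pos ge by (intro powr_mono2') auto
      finally show ?case by (simp add: powr_mult)
    qed
  qed simp
qed

definition normal_negative_moment :: "real \<Rightarrow> real" where
  "normal_negative_moment q = (LINT p|plane_normal. cmod (plane_point p) powr (-q))"

lemma normal_negative_moment_nonneg: "0 \<le> normal_negative_moment q"
  unfolding normal_negative_moment_def by simp

text \<open>
  The Gaussian weight is its own Fourier transform, so by Fubini its expectation at \<open>S / t\<close>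
  is the average of the Fourier transform of \<open>S\<close> at \<open>G / t\<close> over a Gaussian vector \<open>G\<close>. The condition
  \<open>q < 2\<close> makes the negative power integrable in the plane.
\<close>
lemma (in prob_space) gaussian_weight_bound:
  assumes S [measurable]: "S \<in> borel_measurable M" and "0 < q" "q < 2" "0 < t" "0 \<le> C"
    and decay: "\<And>u. u \<noteq> 0 \<Longrightarrow> cmod (CLINT \<omega>|M. iexp (u \<bullet> S \<omega>)) \<le> C * cmod u powr (-q)"
  shows "(LINT \<omega>|M. exp (- (cmod (S \<omega>))\<^sup>2 / (2 * t\<^sup>2))) \<le> C * normal_negative_moment q * t powr q"
proof -
  interpret N: prob_space plane_normal by (rule prob_space_plane_normal)
  interpret P: pair_prob_space M plane_normal by unfold_locales
  let ?f = "\<lambda>\<omega> p. iexp ((plane_point p /\<^sub>R t) \<bullet> S \<omega>)"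
  have int: "integrable (M \<Otimes>\<^sub>M plane_normal) (case_prod ?f)"
    by (rule P.P.integrable_const_bound[of _ 1]) (auto simp: split_def)
  have "of_real (LINT \<omega>|M. exp (- (cmod (S \<omega>))\<^sup>2 / (2 * t\<^sup>2))) =
      (CLINT \<omega>|M. of_real (exp (- (cmod (S \<omega>))\<^sup>2 / (2 * t\<^sup>2))))"
    by (simp only: integral_complex_of_real)
  also have "\<dots> = (CLINT \<omega>|M. CLINT p|plane_normal. ?f \<omega> p)"
  proof (intro Bochner_Integration.integral_cong refl)
    fix \<omega>
    have "(CLINT p|plane_normal. ?f \<omega> p) = (CLINT p|plane_normal. iexp ((S \<omega> /\<^sub>R t) \<bullet> plane_point p))"
      by (simp add: inner_commute)
    also have "\<dots> = of_real (exp (- (cmod (S \<omega> /\<^sub>R t))\<^sup>2 / 2))" by (rule plane_normal_fourier)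
    also have "- (cmod (S \<omega> /\<^sub>R t))\<^sup>2 / 2 = - (cmod (S \<omega>))\<^sup>2 / (2 * t\<^sup>2)"
      using assms by (simp add: power_divide field_simps)
    finally show "of_real (exp (- (cmod (S \<omega>))\<^sup>2 / (2 * t\<^sup>2))) = (CLINT p|plane_normal. ?f \<omega> p)" by simp
  qed
  also have "\<dots> = (CLINT p|plane_normal. CLINT \<omega>|M. ?f \<omega> p)"
    by (rule P.Fubini_integral[OF int, symmetric])
  finally have eq: "complex_of_real (LINT \<omega>|M. exp (- (cmod (S \<omega>))\<^sup>2 / (2 * t\<^sup>2))) =
     (CLINT p|plane_normal. CLINT \<omega>|M. ?f \<omega> p)" .
  have im: "integrable plane_normal (\<lambda>p. C * t powr q * cmod (plane_point p) powr (-q))"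
    using assms by (intro integrable_mult_right integrable_plane_normal_negative_power)
  have "(LINT \<omega>|M. exp (- (cmod (S \<omega>))\<^sup>2 / (2 * t\<^sup>2))) \<le>
      cmod (complex_of_real (LINT \<omega>|M. exp (- (cmod (S \<omega>))\<^sup>2 / (2 * t\<^sup>2))))" by simp
  also have "\<dots> = cmod (CLINT p|plane_normal. CLINT \<omega>|M. ?f \<omega> p)" by (simp only: eq)
  also have "\<dots> \<le> (LINT p|plane_normal. cmod (CLINT \<omega>|M. ?f \<omega> p))"
    by (rule integral_norm_bound)
  also have "\<dots> \<le> (LINT p|plane_normal. C * t powr q * cmod (plane_point p) powr (-q))"
  proof (rule integral_mono_AE)
    show "integrable plane_normal (\<lambda>p. cmod (CLINT \<omega>|M. ?f \<omega> p))"
      by (rule integrable_norm[OF P.integrable_snd[OF int]])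
    show "integrable plane_normal (\<lambda>p. C * t powr q * cmod (plane_point p) powr (-q))" by (rule im)
    show "AE p in plane_normal. cmod (CLINT \<omega>|M. ?f \<omega> p) \<le> C * t powr q * cmod (plane_point p) powr (-q)"
      using AE_plane_normal_nonzero
    proof eventually_elim
      case (elim p)
      hence ne: "plane_point p /\<^sub>R t \<noteq> 0" using assms by (auto simp: plane_point_def complex_eq_iff)
      have "cmod (CLINT \<omega>|M. ?f \<omega> p) \<le> C * cmod (plane_point p /\<^sub>R t) powr (-q)"
        by (rule decay[OF ne])
      also have "cmod (plane_point p /\<^sub>R t) powr (-q) = t powr q * cmod (plane_point p) powr (-q)"
        using assms by (simp add: powr_mult powr_divide powr_minus field_simps)
      finally show ?case by (simp add: mult.assoc)
    qed
  qed
  also have "\<dots> = C * normal_negative_moment q * t powr q" by (simp add: normal_negative_moment_def)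
  finally show ?thesis .
qed

text \<open>
  Passage from the partial sums of a random series to its sum.
\<close>
lemma (in prob_space) expectation_limit_le:
  fixes h :: "complex \<Rightarrow> real"
  assumes Sn [measurable]: "\<And>n. Sn n \<in> borel_measurable M" and S [measurable]: "S \<in> borel_measurable M"
    and lim: "AE \<omega> in M. (\<lambda>n. Sn n \<omega>) \<longlonglongrightarrow> S \<omega>"
    and h: "continuous_on UNIV h" "\<And>z. 0 \<le> h z" "\<And>z. h z \<le> 1"
    and le: "eventually (\<lambda>n. (LINT \<omega>|M. h (Sn n \<omega>)) \<le> B) sequentially"
  shows "(LINT \<omega>|M. h (S \<omega>)) \<le> B"
proof -
  have [measurable]: "h \<in> borel_measurable borel" using h(1) by (rule borel_measurable_continuous_onI)
  have "(\<lambda>n. LINT \<omega>|M. h (Sn n \<omega>)) \<longlonglongrightarrow> (LINT \<omega>|M. h (S \<omega>))"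
  proof (rule integral_dominated_convergence[where w="\<lambda>_. 1"])
    show "AE \<omega> in M. (\<lambda>n. h (Sn n \<omega>)) \<longlonglongrightarrow> h (S \<omega>)"
      using lim by eventually_elim (use h(1) in \<open>auto simp: continuous_on_eq_continuous_at intro: isCont_tendsto_compose\<close>)
  qed (use h(2,3) in \<open>auto intro: integrable_const\<close>)
  thus ?thesis using le by (intro tendsto_upperbound) auto
qed

text \<open>
  On the event \<open>|S| \<le> t\<close> the Gaussian weight at \<open>S / t\<close> is at least 1/2.
\<close>
lemma (in prob_space) small_ball_of_fourier_decay:
  assumes Sn [measurable]: "\<And>n. Sn n \<in> borel_measurable M" and S [measurable]: "S \<in> borel_measurable M"
    and lim: "AE \<omega> in M. (\<lambda>n. Sn n \<omega>) \<longlonglongrightarrow> S \<omega>"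
    and q: "0 < q" "q < 2" and t: "0 < t" and C: "0 \<le> C"
    and decay: "eventually (\<lambda>n. \<forall>u. u \<noteq> 0 \<longrightarrow> cmod (CLINT \<omega>|M. iexp (u \<bullet> Sn n \<omega>)) \<le> C * cmod u powr (-q)) sequentially"
  shows "prob {\<omega> \<in> space M. cmod (S \<omega>) \<le> t} \<le> 2 * C * normal_negative_moment q * t powr q"
proof -
  let ?h = "\<lambda>z. exp (- (cmod z)\<^sup>2 / (2 * t\<^sup>2))"
  have E: "(LINT \<omega>|M. ?h (S \<omega>)) \<le> C * normal_negative_moment q * t powr q"
  proof (rule expectation_limit_le[OF Sn S lim])
    show "eventually (\<lambda>n. (LINT \<omega>|M. ?h (Sn n \<omega>)) \<le> C * normal_negative_moment q * t powr q) sequentially"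
      using decay by eventually_elim (use gaussian_weight_bound[OF Sn q t C] in blast)
    show "continuous_on UNIV ?h" using t by (intro continuous_intros) auto
  qed auto
  have "prob {\<omega> \<in> space M. cmod (S \<omega>) \<le> t} = (LINT \<omega>|M. indicator {\<omega> \<in> space M. cmod (S \<omega>) \<le> t} \<omega>)"
    by (subst Bochner_Integration.integral_indicator) (rule arg_cong[where f=prob], auto)
  also have "\<dots> \<le> (LINT \<omega>|M. 2 * ?h (S \<omega>))"
  proof (rule integral_mono)
    show "integrable M (\<lambda>\<omega>. indicator {\<omega> \<in> space M. cmod (S \<omega>) \<le> t} \<omega> :: real)"
      by (rule integrable_const_bound[of _ 1]) (auto simp: indicator_def)
    show "integrable M (\<lambda>\<omega>. 2 * ?h (S \<omega>))"
      by (rule integrable_const_bound[of _ 2]) auto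
    fix \<omega> assume "\<omega> \<in> space M"
    show "indicator {\<omega> \<in> space M. cmod (S \<omega>) \<le> t} \<omega> \<le> 2 * ?h (S \<omega>)"
    proof (cases "cmod (S \<omega>) \<le> t")
      case True
      have "(cmod (S \<omega>))\<^sup>2 \<le> t\<^sup>2" using True by (intro power_mono) auto
      hence "- (1/2) \<le> - (cmod (S \<omega>))\<^sup>2 / (2 * t\<^sup>2)" using t by (simp add: field_simps)
      hence "1 + - (1/2) \<le> ?h (S \<omega>)" using exp_ge_add_one_self[of "- (cmod (S \<omega>))\<^sup>2 / (2 * t\<^sup>2)"] by linarith
      thus ?thesis using True by (auto simp: indicator_def)
    qed (auto simp: indicator_def)
  qed
  also have "\<dots> \<le> 2 * (C * normal_negative_moment q * t powr q)" using E by simp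
  finally show ?thesis by simp
qed

text \<open>
  A linear combination of independent variables factorises on the Fourier side.
\<close>
lemma (in prob_space) fourier_sum_indep:
  fixes X :: "nat \<Rightarrow> 'a \<Rightarrow> complex"
  assumes ind: "indep_vars (\<lambda>_. borel) X UNIV"
  shows "(CLINT \<omega>|M. iexp (u \<bullet> (\<Sum>j<n. b j * X j \<omega>))) = (\<Prod>j<n. CLINT \<omega>|M. iexp ((cnj (b j) * u) \<bullet> X j \<omega>))"
proof -
  have rv [measurable]: "X j \<in> borel_measurable M" for j
    using ind by (auto simp: indep_vars_def)
  have eq: "u \<bullet> (\<Sum>j<n. b j * X j \<omega>) = (\<Sum>j<n. (cnj (b j) * u) \<bullet> X j \<omega>)" for \<omega>
    by (simp add: inner_sum_right) (simp add: inner_complex_def algebra_simps)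
  have "(CLINT \<omega>|M. iexp (u \<bullet> (\<Sum>j<n. b j * X j \<omega>))) = (CLINT \<omega>|M. \<Prod>j<n. iexp ((cnj (b j) * u) \<bullet> X j \<omega>))"
    by (simp only: eq of_real_sum sum_distrib_left exp_sum[OF finite_lessThan])
  also have "\<dots> = (\<Prod>j<n. CLINT \<omega>|M. iexp ((cnj (b j) * u) \<bullet> X j \<omega>))"
  proof (rule indep_vars_lebesgue_integral)
    show "indep_vars (\<lambda>_. borel) (\<lambda>j \<omega>. iexp ((cnj (b j) * u) \<bullet> X j \<omega>)) {..<n}"
      by (rule indep_vars_compose2[OF indep_vars_subset[OF ind]]) auto
    show "integrable M (\<lambda>\<omega>. iexp ((cnj (b j) * u) \<bullet> X j \<omega>))" for j
      by (rule integrable_const_bound[of _ 1]) auto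
  qed auto
  finally show ?thesis .
qed

section \<open>Complex Gaussian variables\<close>

lemma lborel_complex_conv_pair:
  "(lborel :: complex measure) = distr (lborel \<Otimes>\<^sub>M lborel) borel plane_point"
proof (rule lborel_eqI)
  fix l u :: complex
  assume le: "\<And>b. b \<in> Basis \<Longrightarrow> l \<bullet> b \<le> u \<bullet> b"
  have le': "Re l \<le> Re u" "Im l \<le> Im u" using le[of 1] le[of \<i>] by (auto simp: Basis_complex_def)
  have eq: "plane_point -` box l u \<inter> space (lborel \<Otimes>\<^sub>M lborel) = {Re l<..<Re u} \<times> {Im l<..<Im u}"
    by (auto simp: plane_point_def in_box_complex_iff space_pair_measure)
  have "emeasure (distr (lborel \<Otimes>\<^sub>M lborel) borel plane_point) (box l u) =
      emeasure (lborel \<Otimes>\<^sub>M lborel) ({Re l<..<Re u} \<times> {Im l<..<Im u})"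
    by (subst emeasure_distr) (auto simp: eq)
  also have "\<dots> = emeasure lborel {Re l<..<Re u} * emeasure lborel {Im l<..<Im u}"
    by (rule lborel.emeasure_pair_measure_Times) auto
  also have "\<dots> = ennreal ((Re u - Re l) * (Im u - Im l))"
    using le' by (simp add: ennreal_mult)
  also have "(Re u - Re l) * (Im u - Im l) = (\<Prod>b\<in>Basis. (u - l) \<bullet> b)"
    by (simp add: Basis_complex_def)
  finally show "emeasure (distr (lborel \<Otimes>\<^sub>M lborel) borel plane_point) (box l u) = (\<Prod>b\<in>Basis. (u - l) \<bullet> b)" .
qed simp

text \<open>
  A standard complex Gaussian is a standard normal vector of the plane divided by
  \<open>sqrt 2\<close>; this transfers its moments and its Fourier transform from the product measure.
\<close>
lemma gaussian_distr:
  assumes D: "distributed M lborel X (\<lambda>z. ennreal (exp (- (cmod z)\<^sup>2) / pi))"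
  shows "distr M borel X = distr plane_normal borel (\<lambda>p. plane_point p /\<^sub>R sqrt 2)"
proof (rule measure_eqI)
  show "sets (distr M borel X) = sets (distr plane_normal borel (\<lambda>p. plane_point p /\<^sub>R sqrt 2))" by simp
  fix A assume A: "A \<in> sets (distr M borel X)"
  hence A' [measurable]: "A \<in> sets borel" by simp
  let ?f = "\<lambda>z. ennreal (exp (- (cmod z)\<^sup>2) / pi) * indicator A z"
  let ?n = std_normal_density
  let ?I = "\<lambda>x. \<integral>\<^sup>+y. ennreal (1 / sqrt 2) * ?f (plane_point (x / sqrt 2, y / sqrt 2)) \<partial>lborel"
  let ?J = "\<lambda>x. \<integral>\<^sup>+y. ennreal (?n y) * indicator A (plane_point (x, y) /\<^sub>R sqrt 2) \<partial>lborel"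
  have "distr M lborel X = distr M borel X" by (intro distr_cong) auto
  hence "emeasure (distr M borel X) A = emeasure (density lborel (\<lambda>z. ennreal (exp (- (cmod z)\<^sup>2) / pi))) A"
    using distributed_distr_eq_density[OF D] by simp
  also have "\<dots> = (\<integral>\<^sup>+z. ?f z \<partial>lborel)" by (subst emeasure_density) auto
  also have "\<dots> = (\<integral>\<^sup>+p. ?f (plane_point p) \<partial>(lborel \<Otimes>\<^sub>M lborel))"
    by (subst lborel_complex_conv_pair, subst nn_integral_distr) auto
  also have "\<dots> = (\<integral>\<^sup>+x. \<integral>\<^sup>+y. ?f (plane_point (x, y)) \<partial>lborel \<partial>lborel)"
    by (rule lborel.nn_integral_fst[symmetric]) measurable
  also have "\<dots> = (\<integral>\<^sup>+x. ennreal (1 / sqrt 2) * ?I x \<partial>lborel)"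
  proof -
    have "(\<integral>\<^sup>+y. ?f (plane_point (x, y)) \<partial>lborel) = (\<integral>\<^sup>+y. ennreal (1 / sqrt 2) * ?f (plane_point (x, y / sqrt 2)) \<partial>lborel)" for x
      by (subst nn_integral_real_affine[of _ "1 / sqrt 2" 0]) (auto simp: nn_integral_cmult)
    hence "(\<integral>\<^sup>+x. \<integral>\<^sup>+y. ?f (plane_point (x, y)) \<partial>lborel \<partial>lborel) =
       (\<integral>\<^sup>+x. \<integral>\<^sup>+y. ennreal (1 / sqrt 2) * ?f (plane_point (x, y / sqrt 2)) \<partial>lborel \<partial>lborel)" by simp
    also have "\<dots> = ennreal (1 / sqrt 2) * (\<integral>\<^sup>+x. ?I x \<partial>lborel)"
      by (subst nn_integral_real_affine[of _ "1 / sqrt 2" 0]) auto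
    also have "\<dots> = (\<integral>\<^sup>+x. ennreal (1 / sqrt 2) * ?I x \<partial>lborel)"
      by (subst nn_integral_cmult) auto
    finally show ?thesis .
  qed
  also have "\<dots> = (\<integral>\<^sup>+x. ennreal (?n x) * ?J x \<partial>lborel)"
  proof (intro nn_integral_cong)
    fix x :: real
    have "ennreal (1 / sqrt 2) * ?I x
       = (\<integral>\<^sup>+y. ennreal (1 / sqrt 2) * (ennreal (1 / sqrt 2) * ?f (plane_point (x / sqrt 2, y / sqrt 2))) \<partial>lborel)"
      by (subst nn_integral_cmult) auto
    also have "\<dots> = (\<integral>\<^sup>+y. ennreal (?n x) * (ennreal (?n y) * indicator A (plane_point (x, y) /\<^sub>R sqrt 2)) \<partial>lborel)"
    proof (intro nn_integral_cong)
      fix y :: real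
      have p: "plane_point (x / sqrt 2, y / sqrt 2) = plane_point (x, y) /\<^sub>R sqrt 2"
        by (simp add: plane_point_def complex_eq_iff field_simps)
      have c: "(cmod (plane_point (x, y) /\<^sub>R sqrt 2))\<^sup>2 = x\<^sup>2 / 2 + y\<^sup>2 / 2"
        unfolding cmod_power2 by (simp add: plane_point_def power_divide field_simps)
      have s: "sqrt (2 * pi) * sqrt (2 * pi) = 2 * pi" by simp
      have e: "1 / sqrt 2 * (1 / sqrt 2 * (exp (- (x\<^sup>2/2 + y\<^sup>2/2)) / pi)) = ?n x * ?n y"
      proof -
        have "exp (- (x\<^sup>2/2 + y\<^sup>2/2)) = exp (- x\<^sup>2/2) * exp (- y\<^sup>2/2)" by (simp flip: exp_add)
        thus ?thesis unfolding std_normal_density_def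
          by (simp add: field_simps real_sqrt_mult power2_eq_square)
      qed
      have "ennreal (1 / sqrt 2) * (ennreal (1 / sqrt 2) * ennreal (exp (- (x\<^sup>2/2 + y\<^sup>2/2)) / pi)) = ennreal (?n x) * ennreal (?n y)"
      proof -
        have gen: "ennreal c1 * (ennreal c2 * ennreal c3) = ennreal (c1 * (c2 * c3))"
          if "0 \<le> c1" "0 \<le> c2" "0 \<le> c3" for c1 c2 c3
          using that by (simp add: ennreal_mult)
        show ?thesis by (subst gen) (auto simp only: e ennreal_mult[OF normal_density_nonneg normal_density_nonneg], auto)
      qed
      thus "ennreal (1 / sqrt 2) * (ennreal (1 / sqrt 2) * ?f (plane_point (x / sqrt 2, y / sqrt 2)))
        = ennreal (?n x) * (ennreal (?n y) * indicator A (plane_point (x, y) /\<^sub>R sqrt 2))"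
        unfolding p c by (simp add: mult.assoc[symmetric])
    qed
    also have "\<dots> = ennreal (?n x) * ?J x"
      by (subst nn_integral_cmult) auto
    finally show "ennreal (1 / sqrt 2) * ?I x
       = ennreal (?n x) * ?J x" .
  qed
  also have "\<dots> = (\<integral>\<^sup>+x. \<integral>\<^sup>+y. indicator A (plane_point (x, y) /\<^sub>R sqrt 2) \<partial>std_normal_distribution \<partial>std_normal_distribution)"
  proof -
    interpret R: real_distribution std_normal_distribution by (rule real_dist_normal_dist)
    have "(\<lambda>x. \<integral>\<^sup>+y. indicator A (plane_point (x, y) /\<^sub>R sqrt 2) \<partial>std_normal_distribution) \<in> borel_measurable borel"
      by (rule R.borel_measurable_nn_integral) measurable
    thus ?thesis
      by (subst nn_integral_density) (auto simp: nn_integral_density)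
  qed
  also have "\<dots> = (\<integral>\<^sup>+p. indicator A (plane_point p /\<^sub>R sqrt 2) \<partial>plane_normal)"
  proof -
    interpret R: real_distribution std_normal_distribution by (rule real_dist_normal_dist)
    show ?thesis unfolding plane_normal_def by (rule R.nn_integral_fst) measurable
  qed
  also have "\<dots> = (\<integral>\<^sup>+z. indicator A z \<partial>distr plane_normal borel (\<lambda>p. plane_point p /\<^sub>R sqrt 2))"
    by (subst nn_integral_distr) auto
  also have "\<dots> = emeasure (distr plane_normal borel (\<lambda>p. plane_point p /\<^sub>R sqrt 2)) A"
    by (rule nn_integral_indicator) simp
  finally show "emeasure (distr M borel X) A = emeasure (distr plane_normal borel (\<lambda>p. plane_point p /\<^sub>R sqrt 2)) A" .
qed

lemma gaussian_fourier:
  assumes D: "distributed M lborel X (\<lambda>z. ennreal (exp (- (cmod z)\<^sup>2) / pi))"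
  shows "(CLINT \<omega>|M. iexp (u \<bullet> X \<omega>)) = of_real (exp (- (cmod u)\<^sup>2 / 4))"
proof -
  have X [measurable]: "X \<in> borel_measurable M" using distributed_measurable[OF D] by simp
  have "(CLINT \<omega>|M. iexp (u \<bullet> X \<omega>)) = (CLINT z|distr M borel X. iexp (u \<bullet> z))"
    by (subst integral_distr) auto
  also have "\<dots> = (CLINT p|plane_normal. iexp (u \<bullet> (plane_point p /\<^sub>R sqrt 2)))"
    unfolding gaussian_distr[OF D] by (subst integral_distr) auto
  also have "\<dots> = (CLINT p|plane_normal. iexp ((u /\<^sub>R sqrt 2) \<bullet> plane_point p))" by simp
  also have "\<dots> = of_real (exp (- (cmod (u /\<^sub>R sqrt 2))\<^sup>2 / 2))" by (rule plane_normal_fourier)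
  also have "- (cmod (u /\<^sub>R sqrt 2))\<^sup>2 / 2 = - (cmod u)\<^sup>2 / 4"
    by (simp add: power_divide power_mult_distrib field_simps)
  finally show ?thesis .
qed

lemma gaussian_AE_nonzero:
  assumes D: "distributed M lborel X (\<lambda>z. ennreal (exp (- (cmod z)\<^sup>2) / pi))"
  shows "AE \<omega> in M. X \<omega> \<noteq> 0"
proof -
  have X [measurable]: "X \<in> borel_measurable M" using distributed_measurable[OF D] by simp
  have "AE p in plane_normal. plane_point p /\<^sub>R sqrt 2 \<noteq> 0"
    using AE_plane_normal_nonzero by eventually_elim (auto simp: plane_point_def complex_eq_iff)
  hence "AE z in distr M borel X. z \<noteq> 0"
    unfolding gaussian_distr[OF D] by (subst AE_distr_iff) auto
  thus ?thesis by (subst (asm) AE_distr_iff) auto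
qed

lemma gaussian_first_moment:
  assumes D: "distributed M lborel X (\<lambda>z. ennreal (exp (- (cmod z)\<^sup>2) / pi))"
  shows "(\<integral>\<^sup>+\<omega>. ennreal (cmod (X \<omega>)) \<partial>M) \<le> (\<integral>\<^sup>+p. ennreal (cmod (plane_point p)) \<partial>plane_normal)"
    "(\<integral>\<^sup>+p. ennreal (cmod (plane_point p)) \<partial>plane_normal) < \<infinity>"
proof -
  have X [measurable]: "X \<in> borel_measurable M" using distributed_measurable[OF D] by simp
  have "(\<integral>\<^sup>+\<omega>. ennreal (cmod (X \<omega>)) \<partial>M) = (\<integral>\<^sup>+z. ennreal (cmod z) \<partial>distr M borel X)"
    by (subst nn_integral_distr) auto
  also have "\<dots> = (\<integral>\<^sup>+p. ennreal (cmod (plane_point p /\<^sub>R sqrt 2)) \<partial>plane_normal)"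
    unfolding gaussian_distr[OF D] by (subst nn_integral_distr) auto
  also have "\<dots> \<le> (\<integral>\<^sup>+p. ennreal (cmod (plane_point p)) \<partial>plane_normal)"
  proof (intro nn_integral_mono ennreal_leI)
    fix p
    have "cmod (plane_point p) * 1 \<le> cmod (plane_point p) * sqrt 2" by (intro mult_left_mono) auto
    thus "cmod (plane_point p /\<^sub>R sqrt 2) \<le> cmod (plane_point p)" by (simp add: field_simps)
  qed
  finally show "(\<integral>\<^sup>+\<omega>. ennreal (cmod (X \<omega>)) \<partial>M) \<le> (\<integral>\<^sup>+p. ennreal (cmod (plane_point p)) \<partial>plane_normal)" .
next
  interpret P: pair_prob_space std_normal_distribution std_normal_distribution by (rule pair_prob_space_normal)
  have i: "integrable std_normal_distribution (\<lambda>x. x)"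
    using integrable_std_normal_distribution_moment[of 1] by simp
  have c: "integrable std_normal_distribution (\<lambda>x. 1::real)" by simp
  have "integrable plane_normal (\<lambda>p. fst p * 1)" "integrable plane_normal (\<lambda>p. 1 * snd p)"
    unfolding plane_normal_def
    by (rule P.Fubini_integrable; use i c in \<open>auto intro!: integrable_mult_right integrable_mult_left integrable_abs simp: abs_mult\<close>)+
  hence i1: "integrable plane_normal fst" and i2: "integrable plane_normal snd" by simp_all
  have "integrable plane_normal (\<lambda>p. of_real (fst p) + \<i> * of_real (snd p))"
    by (intro Bochner_Integration.integrable_add integrable_mult_right integrable_of_real i1 i2)
  hence "integrable plane_normal plane_point" by (simp add: plane_point_def[abs_def])
  thus "(\<integral>\<^sup>+p. ennreal (cmod (plane_point p)) \<partial>plane_normal) < \<infinity>"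
    by (simp add: integrable_iff_bounded)
qed

section \<open>Steinhaus variables\<close>

lemma has_integral_periodic_affine:
  fixes F :: "real \<Rightarrow> real"
  assumes per: "\<And>t. F (t + 2*pi) = F t" and \<beta>: "0 \<le> \<beta>" "\<beta> \<le> 2*pi"
    and F: "(F has_integral I) {0..2*pi}"
  shows "((\<lambda>x. F (2*pi*x - \<beta>)) has_integral (I / (2*pi))) {0..1}"
proof -
  have "((\<lambda>t. F (t + (2*pi - \<beta>))) has_integral I) {0..2*pi}"
    by (rule has_integral_period_shift[OF per _ _ F]) (use \<beta> in auto)
  moreover have "F (t + (2*pi - \<beta>)) = F (t - \<beta>)" for t
    using per[of "t - \<beta>"] by (simp add: algebra_simps)
  ultimately have "((\<lambda>t. F (t - \<beta>)) has_integral I) (cbox 0 (2*pi))" by simp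
  from has_integral_affinity'[OF this, of "2*pi" 0]
  have "((\<lambda>x. F (2*pi*x - \<beta>)) has_integral (I /\<^sub>R (2*pi))) (cbox 0 1)" by simp
  moreover have e: "I /\<^sub>R (2*pi) = I / (2*pi)" by (simp add: field_simps)
  ultimately show ?thesis unfolding box_real e by (simp only:)
qed

lemma sine_mean_zero: "((\<lambda>x. sin (s * cos x)) has_integral 0) {0..2*pi}"
proof -
  let ?F = "\<lambda>x. sin (s * cos x)"
  have int: "?F integrable_on {a..b}" for a b
    by (intro integrable_continuous_real continuous_intros)
  have "integral {pi - pi..2*pi - pi} (\<lambda>x. ?F (x + pi)) = integral {pi..2*pi} ?F"
    by (rule integral_shift_real_ivl)
  hence shift: "integral {pi..2*pi} ?F = - integral {0..pi} ?F" by simp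
  have "integral {0..2*pi} ?F = integral {0..pi} ?F + integral {pi..2*pi} ?F"
    by (rule Henstock_Kurzweil_Integration.integral_combine[symmetric]) (auto intro!: int)
  with shift int[of 0 "2*pi"] show ?thesis by (simp add: has_integral_iff)
qed

text \<open>
  Rotation invariance reduces the frequency \<open>u\<close> to its modulus, and the sine part vanishes
  by the symmetry \<open>x \<mapsto> x + pi\<close>.
\<close>
lemma circle_fourier:
  "((\<lambda>x. iexp (u \<bullet> cis (2*pi*x))) has_integral of_real (bessel_J0 (cmod u))) {0..1}"
proof -
  define \<beta> where "\<beta> = Arg2pi u"
  have \<beta>: "0 \<le> \<beta>" "\<beta> \<le> 2*pi" using Arg2pi[of u] by (auto simp: \<beta>_def)
  have u: "u = of_real (cmod u) * cis \<beta>" using Arg2pi_eq[of u] by (simp add: \<beta>_def cis_conv_exp)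
  have inner: "u \<bullet> cis t = cmod u * cos (t - \<beta>)" for t
  proof -
    have "u \<bullet> cis t = (of_real (cmod u) * cis \<beta>) \<bullet> cis t" using u by simp
    also have "\<dots> = cmod u * cos (t - \<beta>)" by (simp add: inner_complex_def cos_diff algebra_simps)
    finally show ?thesis .
  qed
  have "((\<lambda>x. cos (cmod u * cos x)) has_integral (2 * pi * bessel_J0 (cmod u))) {0..2*pi}"
    using integrable_integral[of "\<lambda>x. cos (cmod u * cos x)" "{0..2*pi}"]
    by (simp add: bessel_J0_def integrable_continuous_real continuous_intros)
  from has_integral_periodic_affine[OF _ \<beta> this]
  have 1: "((\<lambda>x. cos (cmod u * cos (2*pi*x - \<beta>))) has_integral bessel_J0 (cmod u)) {0..1}" by simp
  from has_integral_periodic_affine[OF _ \<beta> sine_mean_zero[of "cmod u"]]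
  have 2: "((\<lambda>x. sin (cmod u * cos (2*pi*x - \<beta>))) has_integral 0) {0..1}" by simp
  have int: "((\<lambda>x. of_real (cos (cmod u * cos (2*pi*x - \<beta>))) + \<i> * of_real (sin (cmod u * cos (2*pi*x - \<beta>))))
      has_integral (of_real (bessel_J0 (cmod u)) + \<i> * of_real 0)) {0..1}"
    by (intro has_integral_add has_integral_mult_right has_integral_of_real 1 2)
  have e: "iexp (u \<bullet> cis (2*pi*x)) = of_real (cos (cmod u * cos (2*pi*x - \<beta>))) + \<i> * of_real (sin (cmod u * cos (2*pi*x - \<beta>)))" for x
    unfolding inner cis_conv_exp[symmetric] by (simp add: complex_eq_iff)
  show ?thesis using int unfolding e of_real_0 mult_zero_right add_0_right .
qed

lemma steinhaus_fourier:
  fixes \<theta> :: "'a \<Rightarrow> real"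
  assumes D: "distributed M lborel \<theta> (indicator {0..1})"
  shows "(CLINT \<omega>|M. iexp (u \<bullet> cis (2*pi*\<theta> \<omega>))) = of_real (bessel_J0 (cmod u))"
proof -
  have [measurable]: "\<theta> \<in> borel_measurable M" using distributed_measurable[OF D] by simp
  have "distr M borel \<theta> = distr M lborel \<theta>" by (intro distr_cong) auto
  also have "\<dots> = density lborel (indicator {0..1})" by (rule distributed_distr_eq_density[OF D])
  finally have d: "distr M borel \<theta> = density lborel (\<lambda>x. ennreal (indicator {0..1} x))"
    by (simp add: ennreal_indicator)
  have "(CLINT \<omega>|M. iexp (u \<bullet> cis (2*pi*\<theta> \<omega>))) = (CLINT x|distr M borel \<theta>. iexp (u \<bullet> cis (2*pi*x)))"
    by (subst integral_distr) auto
  also have "\<dots> = (CLINT x:{0..1}|lborel. iexp (u \<bullet> cis (2*pi*x)))"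
    unfolding d set_lebesgue_integral_def by (subst integral_density) auto
  also have "\<dots> = integral {0..1} (\<lambda>x. iexp (u \<bullet> cis (2*pi*x)))"
    by (intro set_borel_integral_eq_integral borel_integrable_atLeastAtMost' continuous_intros)
  also have "\<dots> = of_real (bessel_J0 (cmod u))" using circle_fourier by (rule integral_unique)
  finally show ?thesis .
qed

lemma abs_sin_small_imp:
  assumes "\<bar>sin y\<bar> \<le> s" "\<bar>y\<bar> \<le> 2 * pi"
  shows "\<exists>k\<in>{-2..2::int}. \<bar>y - of_int k * pi\<bar> \<le> pi * s / 2"
proof
  define k where "k = round (y / pi)"
  have r: "\<bar>of_int k - y / pi\<bar> \<le> 1 / 2" unfolding k_def by (rule of_int_round_abs_le)
  have y: "\<bar>y / pi\<bar> \<le> 2" using assms by (simp add: abs_divide divide_le_eq)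
  have "\<bar>real_of_int k\<bar> \<le> 5 / 2" using r y by linarith
  thus "k \<in> {-2..2}" by (auto simp: abs_le_iff) 
  have d: "\<bar>y - of_int k * pi\<bar> \<le> pi / 2"
  proof -
    have "\<bar>y - of_int k * pi\<bar> = pi * \<bar>of_int k - y / pi\<bar>"
      by (simp add: abs_mult_pos' field_simps abs_minus_commute flip: abs_mult_pos)
    also have "\<dots> \<le> pi * (1 / 2)" using r by (intro mult_left_mono) auto
    finally show ?thesis by simp
  qed
  have "\<bar>sin (y - of_int k * pi)\<bar> = \<bar>sin y\<bar>"
    by (simp add: sin_diff abs_mult mult.commute[of _ pi])
  moreover have "2 / pi * \<bar>z\<bar> \<le> \<bar>sin z\<bar>" if "\<bar>z\<bar> \<le> pi / 2" for z
  proof (cases "0 \<le> z")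
    case True
    thus ?thesis using sin_ge_Jordan[of z] that by simp
  next
    case False
    hence "2 / pi * (- z) \<le> sin (- z)" using that by (intro sin_ge_Jordan) auto
    thus ?thesis using False by simp
  qed
  from this[OF d] have "2 / pi * \<bar>y - of_int k * pi\<bar> \<le> \<bar>sin (y - of_int k * pi)\<bar>" .
  ultimately have "2 / pi * \<bar>y - of_int k * pi\<bar> \<le> s" using assms by linarith
  thus "\<bar>y - of_int k * pi\<bar> \<le> pi * s / 2" by (simp add: field_simps)
qed

text \<open>
  Put \<open>v = -w / b = |v| e\<^sup>i\<^sup>\<beta>\<close>; the distance of \<open>e\<^sup>i\<^sup>x\<close> from the line
  through 0 and \<open>v\<close> is \<open>|sin (x - \<beta>)|\<close>, so that \<open>|b e\<^sup>i\<^sup>x + w| \<ge> |b| |sin (x - \<beta>)|\<close>. Hence \<open>\<theta>\<close> lies in one of five intervals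
  around the solutions of \<open>sin (2 pi \<theta> - \<beta>) = 0\<close>.
\<close>
lemma steinhaus_translate_small_ball:
  fixes \<theta> :: "'a \<Rightarrow> real"
  assumes M: "prob_space M" and D: "distributed M lborel \<theta> (indicator {0..1})" and b: "b \<noteq> 0" and \<tau>: "0 < \<tau>"
  shows "measure M {\<omega> \<in> space M. cmod (b * cis (2*pi*\<theta> \<omega>) + w) \<le> \<tau>} \<le> 5 / 2 * \<tau> / cmod b"
proof -
  interpret prob_space M by (rule M)
  have [measurable]: "\<theta> \<in> borel_measurable M" using distributed_measurable[OF D] by simp
  define v where "v = - w / b"
  define \<beta> where "\<beta> = Arg2pi v"
  have \<beta>: "0 \<le> \<beta>" "\<beta> \<le> 2*pi" using Arg2pi[of v] by (auto simp: \<beta>_def)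
  have v: "v = of_real (cmod v) * cis \<beta>" using Arg2pi_eq[of v] by (simp add: \<beta>_def cis_conv_exp)
  define I where "I = (\<lambda>k::int. {(\<beta> + of_int k * pi) / (2*pi) - \<tau> / (4 * cmod b) .. (\<beta> + of_int k * pi) / (2*pi) + \<tau> / (4 * cmod b)})"
  have sub: "x \<in> (\<Union>k\<in>{-2..2}. I k)"
    if "cmod (b * cis (2*pi*x) + w) \<le> \<tau>" "x \<in> {0..1}" for x
  proof -
    define y where "y = 2*pi*x - \<beta>"
    have "b * cis (2*pi*x) + w = b * cis \<beta> * (cis y - of_real (cmod v))"
    proof -
      have "b * cis \<beta> * (cis y - of_real (cmod v)) = b * (cis (2*pi*x) - of_real (cmod v) * cis \<beta>)"
        by (simp add: algebra_simps cis_mult y_def)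
      also have "\<dots> = b * cis (2*pi*x) - b * v" using v by (simp add: algebra_simps)
      also have "b * v = - w" using b by (simp add: v_def)
      finally show ?thesis by simp
    qed
    hence "cmod (b * cis (2*pi*x) + w) = cmod b * cmod (cis y - of_real (cmod v))"
      by (simp add: norm_mult)
    moreover have "\<bar>sin y\<bar> \<le> cmod (cis y - of_real (cmod v))"
      using abs_Im_le_cmod[of "cis y - of_real (cmod v)"] by simp
    ultimately have "cmod b * \<bar>sin y\<bar> \<le> \<tau>"
      using that(1) mult_left_mono[of "\<bar>sin y\<bar>" _ "cmod b"] by fastforce
    hence "\<bar>sin y\<bar> \<le> \<tau> / cmod b" using b by (simp add: field_simps)
    moreover have "\<bar>y\<bar> \<le> 2*pi"
    proof -
      have "0 \<le> 2*pi*x" "2*pi*x \<le> 2*pi*1"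
        using that(2) by (auto intro!: mult_left_mono)
      thus ?thesis using \<beta> unfolding y_def abs_le_iff by linarith
    qed
    ultimately obtain k where k: "k \<in> {-2..2::int}" "\<bar>y - of_int k * pi\<bar> \<le> pi * (\<tau> / cmod b) / 2"
      using abs_sin_small_imp by blast
    have "\<bar>x - (\<beta> + of_int k * pi) / (2*pi)\<bar> = \<bar>y - of_int k * pi\<bar> / (2*pi)"
    proof -
      have "x - (\<beta> + of_int k * pi) / (2*pi) = (y - of_int k * pi) / (2*pi)"
        by (simp add: y_def field_simps)
      thus ?thesis by (simp add: abs_divide)
    qed
    also have "\<dots> \<le> (pi * (\<tau> / cmod b) / 2) / (2*pi)" using k by (intro divide_right_mono) auto
    also have "\<dots> = \<tau> / (4 * cmod b)" using b by (simp add: field_simps)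
    finally have "x \<in> I k" by (simp add: I_def abs_le_iff)
    thus ?thesis using k(1) by blast
  qed
  have "emeasure M {\<omega> \<in> space M. cmod (b * cis (2*pi*\<theta> \<omega>) + w) \<le> \<tau>} \<le> emeasure lborel (\<Union>k\<in>{-2..2}. I k)"
  proof -
    let ?A = "{x. cmod (b * cis (2*pi*x) + w) \<le> \<tau>}"
    have A [measurable]: "?A \<in> sets borel" by measurable
    have "emeasure M {\<omega> \<in> space M. cmod (b * cis (2*pi*\<theta> \<omega>) + w) \<le> \<tau>} = emeasure M (\<theta> -` ?A \<inter> space M)"
      by (rule arg_cong[where f="emeasure M"]) auto
    also have "\<dots> = (\<integral>\<^sup>+x. indicator {0..1} x * indicator ?A x \<partial>lborel)"
      by (rule distributed_emeasure[OF D]) simp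
    also have "\<dots> \<le> (\<integral>\<^sup>+x. indicator (\<Union>k\<in>{-2..2}. I k) x \<partial>lborel)"
    proof (intro nn_integral_mono)
      fix x :: real
      show "(indicator {0..1} x * indicator ?A x :: ennreal) \<le> indicator (\<Union>k\<in>{-2..2}. I k) x"
        using sub[of x] by (auto simp: indicator_def)
    qed
    also have "\<dots> = emeasure lborel (\<Union>k\<in>{-2..2}. I k)"
      by (intro nn_integral_indicator) (auto simp: I_def)
    finally show ?thesis .
  qed
  also have "\<dots> \<le> (\<Sum>k\<in>{-2..2}. emeasure lborel (I k))"
    by (intro emeasure_subadditive_finite) (auto simp: I_def)
  also have "\<dots> = (\<Sum>k\<in>{-2..2::int}. ennreal (\<tau> / (2 * cmod b)))"
    using \<tau> b by (intro sum.cong refl) (simp add: I_def field_simps)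
  also have "\<dots> = ennreal (5 / 2 * \<tau> / cmod b)"
    using \<tau> b by (subst sum_ennreal) (auto simp: field_simps)
  finally show ?thesis
    using \<tau> b by (simp add: emeasure_eq_measure)
qed

text \<open>
  Condition on all variables but \<open>X m\<close>: a small ball estimate for one term that is
  uniform in translations passes to the whole sum.
\<close>
lemma (in prob_space) small_ball_condition_on_one_term:
  fixes X :: "nat \<Rightarrow> 'a \<Rightarrow> complex"
  assumes ind: "indep_vars (\<lambda>_. borel) X UNIV" and m: "m < n"
    and B: "\<And>w. prob {\<omega> \<in> space M. cmod (b m * X m \<omega> + w) \<le> \<tau>} \<le> B"
  shows "prob {\<omega> \<in> space M. cmod (\<Sum>j<n. b j * X j \<omega>) \<le> \<tau>} \<le> B"
proof -
  have rv [measurable]: "X j \<in> borel_measurable M" for j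
    using ind by (auto simp: indep_vars_def)
  have B0: "0 \<le> B" using B[of 0] measure_nonneg order_trans by blast
  define J where "J = {..<n} - {m}"
  define W where "W = (\<lambda>\<omega>. \<Sum>j\<in>J. b j * X j \<omega>)"
  have [measurable]: "W \<in> borel_measurable M" by (simp add: W_def)
  have iv: "indep_var borel (X m) borel W"
  proof -
    have "indep_var
      borel ((\<lambda>f. f m) \<circ> (\<lambda>\<omega>. restrict (\<lambda>i. X i \<omega>) {m}))
      borel ((\<lambda>f. \<Sum>i\<in>J. b i * f i) \<circ> (\<lambda>\<omega>. restrict (\<lambda>i. X i \<omega>) J))"
      by (intro indep_var_compose[OF indep_var_restrict[OF ind]]) (auto simp: J_def)
    also have "((\<lambda>f. f m) \<circ> (\<lambda>\<omega>. restrict (\<lambda>i. X i \<omega>) {m})) = X m" by auto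
    also have "((\<lambda>f. \<Sum>i\<in>J. b i * f i) \<circ> (\<lambda>\<omega>. restrict (\<lambda>i. X i \<omega>) J)) = W"
      by (auto simp: W_def)
    finally show ?thesis .
  qed
  let ?A = "{p::complex\<times>complex. cmod (b m * fst p + snd p) \<le> \<tau>}"
  have "{p \<in> space (borel \<Otimes>\<^sub>M borel). cmod (b m * fst p + snd p) \<le> \<tau>} \<in> sets (borel \<Otimes>\<^sub>M borel)"
    by measurable
  hence A [measurable]: "?A \<in> sets (borel \<Otimes>\<^sub>M borel)" by (simp add: space_pair_measure)
  interpret PX: prob_space "distr M borel (X m)" by (rule prob_space_distr) simp
  interpret PW: prob_space "distr M borel W" by (rule prob_space_distr) simp
  interpret P: pair_prob_space "distr M borel (X m)" "distr M borel W" by unfold_locales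
  have eq: "(\<Sum>j<n. b j * X j \<omega>) = b m * X m \<omega> + W \<omega>" for \<omega>
    using m by (simp add: W_def J_def sum.remove[of "{..<n}" m])
  have "emeasure M {\<omega> \<in> space M. cmod (\<Sum>j<n. b j * X j \<omega>) \<le> \<tau>} = emeasure M ((\<lambda>\<omega>. (X m \<omega>, W \<omega>)) -` ?A \<inter> space M)"
    by (rule arg_cong[where f="emeasure M"]) (auto simp: eq)
  also have "\<dots> = emeasure (distr M (borel \<Otimes>\<^sub>M borel) (\<lambda>\<omega>. (X m \<omega>, W \<omega>))) ?A"
    by (rule emeasure_distr[symmetric]) auto
  also have "distr M (borel \<Otimes>\<^sub>M borel) (\<lambda>\<omega>. (X m \<omega>, W \<omega>)) = distr M borel (X m) \<Otimes>\<^sub>M distr M borel W"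
    using iv unfolding indep_var_distribution_eq by simp
  also have "emeasure (distr M borel (X m) \<Otimes>\<^sub>M distr M borel W) ?A =
      (\<integral>\<^sup>+w. emeasure (distr M borel (X m)) ((\<lambda>x. (x, w)) -` ?A) \<partial>distr M borel W)"
    by (rule P.emeasure_pair_measure_alt2) simp
  also have "\<dots> \<le> (\<integral>\<^sup>+w. ennreal B \<partial>distr M borel W)"
  proof (intro nn_integral_mono)
    fix w
    have "emeasure (distr M borel (X m)) ((\<lambda>x. (x, w)) -` ?A) = emeasure M (X m -` ((\<lambda>x. (x, w)) -` ?A) \<inter> space M)"
      by (rule emeasure_distr) auto
    also have "X m -` ((\<lambda>x. (x, w)) -` ?A) \<inter> space M = {\<omega> \<in> space M. cmod (b m * X m \<omega> + w) \<le> \<tau>}" by auto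
    also have "emeasure M \<dots> \<le> ennreal B" using B[of w] B0 by (simp add: emeasure_eq_measure)
    finally show "emeasure (distr M borel (X m)) ((\<lambda>x. (x, w)) -` ?A) \<le> ennreal B" .
  qed
  also have "\<dots> = ennreal B" using PW.emeasure_space_1 by simp
  finally show ?thesis using B0 by (simp add: emeasure_eq_measure)
qed

text \<open>
  The indicator functions of the balls of radius \<open>t\<close> and \<open>2 t\<close> are separated by a continuous
  function, to which convergence applies.
\<close>
lemma (in prob_space) small_ball_limit:
  assumes Sn [measurable]: "\<And>n. Sn n \<in> borel_measurable M" and S [measurable]: "S \<in> borel_measurable M"
    and lim: "AE \<omega> in M. (\<lambda>n. Sn n \<omega>) \<longlonglongrightarrow> (S \<omega> :: complex)" and t: "0 < t"
    and B: "eventually (\<lambda>n. prob {\<omega> \<in> space M. cmod (Sn n \<omega>) \<le> 2 * t} \<le> B) sequentially"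
  shows "prob {\<omega> \<in> space M. cmod (S \<omega>) \<le> t} \<le> B"
proof -
  let ?h = "\<lambda>z. max 0 (min 1 (2 - cmod z / t))"
  have ind: "prob {\<omega> \<in> space M. cmod (R \<omega>) \<le> r} = (LINT \<omega>|M. indicator {\<omega> \<in> space M. cmod (R \<omega>) \<le> r} \<omega>)" for R r
    by (subst Bochner_Integration.integral_indicator) (rule arg_cong[where f=prob], auto)
  have int: "integrable M (\<lambda>\<omega>. ?h (R \<omega>))" "integrable M (\<lambda>\<omega>. indicator {\<omega> \<in> space M. cmod (R \<omega>) \<le> r} \<omega> :: real)"
    if [measurable]: "R \<in> borel_measurable M" for R r
    by (rule integrable_const_bound[of _ 1]; auto simp: indicator_def)+
  have pw1: "indicator {\<omega> \<in> space M. cmod (R \<omega>) \<le> t} \<omega> \<le> ?h (R \<omega>)" for R \<omega>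
  proof (cases "cmod (R \<omega>) \<le> t")
    case True
    hence "cmod (R \<omega>) / t \<le> 1" using t by simp
    thus ?thesis by (auto simp: indicator_def)
  qed (simp add: indicator_def)
  have pw2: "?h (R \<omega>) \<le> indicator {\<omega> \<in> space M. cmod (R \<omega>) \<le> 2 * t} \<omega>" if "\<omega> \<in> space M" for R \<omega>
  proof (cases "cmod (R \<omega>) \<le> 2 * t")
    case True
    thus ?thesis using that by (simp add: indicator_def)
  next
    case False
    hence "2 < cmod (R \<omega>) / t" using t by (simp add: less_divide_eq)
    thus ?thesis using that False by (simp add: indicator_def)
  qed
  have "(LINT \<omega>|M. ?h (S \<omega>)) \<le> B"
  proof (rule expectation_limit_le[OF Sn S lim])
    show "eventually (\<lambda>n. (LINT \<omega>|M. ?h (Sn n \<omega>)) \<le> B) sequentially"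
      using B
    proof eventually_elim
      case (elim n)
      have "(LINT \<omega>|M. ?h (Sn n \<omega>)) \<le> (LINT \<omega>|M. indicator {\<omega> \<in> space M. cmod (Sn n \<omega>) \<le> 2 * t} \<omega>)"
        by (intro integral_mono int Sn pw2)
      with elim show ?case unfolding ind by linarith
    qed
    show "continuous_on UNIV ?h" using t by (intro continuous_intros) auto
  qed auto
  moreover have "prob {\<omega> \<in> space M. cmod (S \<omega>) \<le> t} \<le> (LINT \<omega>|M. ?h (S \<omega>))"
    unfolding ind by (intro integral_mono int S pw1)
  ultimately show ?thesis by linarith
qed

section \<open>Uniform bounds for negative moments\<close>

text \<open>
  Decompose dyadically according to the size of \<open>|S|\<close>; the resulting geometric series
  converges because \<open>p < q\<close>.
\<close>
lemma (in prob_space) negative_moment_of_small_ball: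
  assumes S [measurable]: "(S :: 'a \<Rightarrow> complex) \<in> borel_measurable M" and pq: "0 < p" "p < q" and K: "0 \<le> K"
    and ball: "\<And>t. 0 < t \<Longrightarrow> prob {\<omega> \<in> space M. cmod (S \<omega>) \<le> t} \<le> K * t powr q"
  shows "(\<integral>\<^sup>+\<omega>. ennreal (cmod (S \<omega>) powr (-p)) \<partial>M) \<le> ennreal (1 + K * 2 powr p / (1 - 2 powr (p - q)))"
proof -
  define A where "A = (\<lambda>k::nat. {\<omega> \<in> space M. cmod (S \<omega>) \<le> 2 powr (- real k)})"
  have [measurable]: "A k \<in> sets M" for k unfolding A_def by measurable
  define c where "c = (\<lambda>k::nat. (2::real) powr ((real k + 1) * p))"
  define \<rho> where "\<rho> = (2::real) powr (p - q)"
  have \<rho>: "0 < \<rho>" "\<rho> < 1" using pq by (auto simp: \<rho>_def powr_less_one)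
  have pw: "ennreal (cmod (S \<omega>) powr (-p)) \<le> 1 + (\<Sum>k. ennreal (c k) * indicator (A k) \<omega>)" if "\<omega> \<in> space M" for \<omega>
  proof -
    consider "S \<omega> = 0" | "1 \<le> cmod (S \<omega>)" | "0 < cmod (S \<omega>)" "cmod (S \<omega>) < 1" by fastforce
    thus ?thesis
    proof cases
      case 2
      hence "cmod (S \<omega>) powr (-p) \<le> 1" using pq by (simp add: powr_minus inverse_le_1_iff ge_one_powr_ge_zero)
      hence "ennreal (cmod (S \<omega>) powr (-p)) \<le> 1" by simp
      thus ?thesis by (simp add: add_increasing2)
    next
      case 3
      define y where "y = - log 2 (cmod (S \<omega>))"
      define k where "k = nat \<lfloor>y\<rfloor>"
      have y: "0 < y" using 3 by (simp add: y_def)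
      have k: "real k \<le> y" "y < real k + 1" using y by (auto simp: k_def)
      have Sy: "cmod (S \<omega>) = 2 powr (-y)" using 3 by (simp add: y_def)
      have "\<omega> \<in> A k" using k that by (simp add: A_def Sy)
      have "cmod (S \<omega>) powr (-p) = 2 powr (y * p)" by (simp add: Sy powr_powr)
      also have "\<dots> \<le> c k" unfolding c_def using k pq by (intro powr_mono mult_right_mono) auto
      finally have "ennreal (cmod (S \<omega>) powr (-p)) \<le> ennreal (c k) * indicator (A k) \<omega>"
        using \<open>\<omega> \<in> A k\<close> by (simp add: ennreal_leI)
      also have "\<dots> \<le> (\<Sum>k. ennreal (c k) * indicator (A k) \<omega>)"
      proof -
        define g where "g = (\<lambda>k. ennreal (c k) * indicator (A k) \<omega>)"
        have "sum g {k} \<le> suminf g" by (rule sum_le_suminf) auto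
        hence "g k \<le> suminf g" by simp
        thus ?thesis unfolding g_def .
      qed
      finally show ?thesis by (rule order_trans) simp
    qed simp
  qed
  have "(\<integral>\<^sup>+\<omega>. ennreal (cmod (S \<omega>) powr (-p)) \<partial>M) \<le> (\<integral>\<^sup>+\<omega>. 1 + (\<Sum>k. ennreal (c k) * indicator (A k) \<omega>) \<partial>M)"
    by (intro nn_integral_mono pw)
  also have "\<dots> = 1 + (\<Sum>k. \<integral>\<^sup>+\<omega>. ennreal (c k) * indicator (A k) \<omega> \<partial>M)"
    by (subst nn_integral_add) (auto simp: nn_integral_suminf emeasure_space_1)
  also have "\<dots> = 1 + (\<Sum>k. ennreal (c k) * ennreal (prob (A k)))"
    by (simp add: nn_integral_cmult_indicator emeasure_eq_measure)
  also have "\<dots> \<le> 1 + (\<Sum>k. ennreal (K * 2 powr p * \<rho> ^ k))"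
  proof (intro add_left_mono suminf_le)
    fix k :: nat
    have "c k * prob (A k) \<le> c k * (K * (2 powr (- real k)) powr q)"
      unfolding A_def by (intro mult_left_mono ball) (auto simp: c_def)
    also have "\<dots> = K * 2 powr p * \<rho> ^ k"
      by (simp add: c_def \<rho>_def powr_powr powr_realpow[symmetric] powr_add[symmetric] algebra_simps)
    finally have le: "c k * prob (A k) \<le> K * 2 powr p * \<rho> ^ k" .
    have "ennreal (c k) * ennreal (prob (A k)) = ennreal (c k * prob (A k))"
      by (rule ennreal_mult[symmetric]) (auto simp: c_def)
    thus "ennreal (c k) * ennreal (prob (A k)) \<le> ennreal (K * 2 powr p * \<rho> ^ k)"
      using le by (simp add: ennreal_leI)
  qed auto
  also have "(\<Sum>k. ennreal (K * 2 powr p * \<rho> ^ k)) = ennreal (K * 2 powr p / (1 - \<rho>))"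
  proof (rule suminf_ennreal_eq)
    show "(\<lambda>k. K * 2 powr p * \<rho> ^ k) sums (K * 2 powr p / (1 - \<rho>))"
      using sums_mult[OF geometric_sums[of \<rho>], of "K * 2 powr p"] \<rho> by simp
  qed (use K \<rho> in auto)
  also have "1 + ennreal (K * 2 powr p / (1 - \<rho>)) = ennreal (1 + K * 2 powr p / (1 - \<rho>))"
    using K \<rho> by (subst ennreal_plus) auto
  finally show ?thesis by (simp add: \<rho>_def)
qed

text \<open>
  The bound \<open>K\<close> is uniform over all normalised coefficient sequences \<open>b\<close>: later \<open>b\<close> depends on the
  radius and on the angle.
\<close>
definition negative_moment_bound :: "'w measure \<Rightarrow> (nat \<Rightarrow> 'w \<Rightarrow> complex) \<Rightarrow> real \<Rightarrow> real \<Rightarrow> bool" where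
  "negative_moment_bound M X p K \<longleftrightarrow>
     (\<forall>b. (\<lambda>j. (cmod (b j))\<^sup>2) sums 1 \<longrightarrow> (AE \<omega> in M. summable (\<lambda>j. b j * X j \<omega>)) \<longrightarrow>
        (\<integral>\<^sup>+\<omega>. ennreal (cmod (\<Sum>j. b j * X j \<omega>) powr (-p)) \<partial>M) \<le> ennreal K)"

text \<open>
  The Fourier transform of a normalised sum is Gaussian, hence at most a multiple of any
  negative power of \<open>|u|\<close>; only \<open>q < 2\<close> is admissible in the small ball estimate, which gives all \<open>p < 2\<close>.
\<close>
lemma (in prob_space) gaussian_negative_moment:
  assumes X: "gaussian_seq M X" and p: "0 < p" "p < 2"
  shows "\<exists>K>0. negative_moment_bound M X p K"
proof -
  \<comment> \<open>Any exponent strictly between \<open>p\<close> and 2 would do.\<close>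
  define q where "q = (p + 2) / 2"
  have q: "p < q" "0 < q" "q < 2" using p by (auto simp: q_def)
  define K where "K = 1 + (2 * 8 * normal_negative_moment q) * 2 powr p / (1 - 2 powr (p - q))"
  have ind: "indep_vars (\<lambda>_. borel) X UNIV"
    and D: "\<And>j. distributed M lborel (X j) (\<lambda>z. ennreal (exp (- (cmod z)\<^sup>2) / pi))"
    using X by (auto simp: gaussian_seq_def)
  have rv [measurable]: "X j \<in> borel_measurable M" for j using ind by (auto simp: indep_vars_def)
  have "(\<integral>\<^sup>+\<omega>. ennreal (cmod (\<Sum>j. b j * X j \<omega>) powr (-p)) \<partial>M) \<le> ennreal K"
    if b: "(\<lambda>j. (cmod (b j))\<^sup>2) sums 1" and sm: "AE \<omega> in M. summable (\<lambda>j. b j * X j \<omega>)" for b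
    unfolding K_def
  proof (rule negative_moment_of_small_ball[OF _ p(1) q(1)])
    show "(\<lambda>\<omega>. \<Sum>j. b j * X j \<omega>) \<in> borel_measurable M" by measurable
    fix t :: real assume t: "0 < t"
    show "prob {\<omega> \<in> space M. cmod (\<Sum>j. b j * X j \<omega>) \<le> t} \<le> 2 * 8 * normal_negative_moment q * t powr q"
    proof (rule small_ball_of_fourier_decay[OF _ _ _ q(2,3) t])
      show "AE \<omega> in M. (\<lambda>n. \<Sum>j<n. b j * X j \<omega>) \<longlonglongrightarrow> (\<Sum>j. b j * X j \<omega>)"
        using sm by eventually_elim (rule summable_LIMSEQ)
      have "(\<lambda>n. \<Sum>j<n. (cmod (b j))\<^sup>2) \<longlonglongrightarrow> 1" using b by (simp add: sums_def)
      hence "eventually (\<lambda>n. 1/2 < (\<Sum>j<n. (cmod (b j))\<^sup>2)) sequentially"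
        by (rule order_tendstoD) simp
      thus "eventually (\<lambda>n. \<forall>u. u \<noteq> 0 \<longrightarrow> cmod (CLINT \<omega>|M. iexp (u \<bullet> (\<Sum>j<n. b j * X j \<omega>))) \<le> 8 * cmod u powr (-q)) sequentially"
      proof (eventually_elim, intro allI impI)
        fix n u assume n: "1/2 < (\<Sum>j<n. (cmod (b j))\<^sup>2)" and u: "(u::complex) \<noteq> 0"
        define x where "x = cmod u"
        have x: "0 < x" using u by (simp add: x_def)
        have "cmod (CLINT \<omega>|M. iexp (u \<bullet> (\<Sum>j<n. b j * X j \<omega>))) = (\<Prod>j<n. exp (- (cmod (b j))\<^sup>2 * x\<^sup>2 / 4))"
          unfolding fourier_sum_indep[OF ind] gaussian_fourier[OF D]
          by (simp add: prod_norm[symmetric] norm_mult power_mult_distrib x_def)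
        also have "\<dots> = exp (- (\<Sum>j<n. (cmod (b j))\<^sup>2) * x\<^sup>2 / 4)"
          by (simp add: exp_sum[symmetric] sum_distrib_right sum_negf sum_divide_distrib)
        also have "\<dots> \<le> exp (- (x\<^sup>2 / 8))"
        proof -
          have "1/2 * x\<^sup>2 \<le> (\<Sum>j<n. (cmod (b j))\<^sup>2) * x\<^sup>2" using n by (intro mult_right_mono) auto
          thus ?thesis by simp
        qed
        also have "\<dots> \<le> 8 * x powr (-q)"
        proof -
          have "x powr q \<le> 1 + x\<^sup>2"
          proof (cases "x \<le> 1")
            case True
            hence "x powr q \<le> 1" using x q by (simp add: powr_le1)
            thus ?thesis by (simp add: add_increasing2)
          next
            case False
            hence "x powr q \<le> x powr 2" using q by (intro powr_mono) auto
            thus ?thesis using x by (simp add: powr_numeral)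
          qed
          also have "\<dots> \<le> 8 * (1 + x\<^sup>2 / 8)" by simp
          also have "\<dots> \<le> 8 * exp (x\<^sup>2 / 8)" by (intro mult_left_mono exp_ge_add_one_self) auto
          finally have "x powr q * exp (- (x\<^sup>2 / 8)) \<le> 8 * exp (x\<^sup>2 / 8) * exp (- (x\<^sup>2 / 8))"
            by (intro mult_right_mono) auto
          also have "\<dots> = 8" by (simp add: exp_minus)
          finally show ?thesis using x by (simp add: powr_minus field_simps)
        qed
        finally show "cmod (CLINT \<omega>|M. iexp (u \<bullet> (\<Sum>j<n. b j * X j \<omega>))) \<le> 8 * cmod u powr (-q)" by (simp add: x_def)
      qed
    qed auto
  qed (simp add: normal_negative_moment_nonneg)
  hence "negative_moment_bound M X p K" unfolding negative_moment_bound_def by blast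
  moreover have "K > 0"
  proof -
    have "2 powr (p - q) < 1" using q by (simp add: powr_less_one)
    thus ?thesis unfolding K_def using normal_negative_moment_nonneg[of q] by (intro add_pos_nonneg divide_nonneg_nonneg) auto
  qed
  ultimately show ?thesis by blast
qed

text \<open>
  If one coefficient satisfies \<open>|b\<^sub>m|\<^sup>2 > 1/2\<close>, condition on the other variables;
  otherwise use the decay of the product of Bessel functions. Both give \<open>P(|S| \<le> t) \<le> C t\<close>.
\<close>
lemma (in prob_space) steinhaus_negative_moment:
  assumes ind\<theta>: "indep_vars (\<lambda>_. borel) \<theta> UNIV"
    and D: "\<And>j. distributed M lborel (\<theta> j) (indicator {0..1})"
    and X: "\<And>j \<omega>. X j \<omega> = cis (2*pi*\<theta> j \<omega>)"
    and p: "0 < p" "p < 1"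
  shows "\<exists>K>0. negative_moment_bound M X p K"
proof -
  define C where "C = 2 * 72 * normal_negative_moment 1 + 10"
  have C: "0 \<le> C" unfolding C_def using normal_negative_moment_nonneg[of 1] by simp
  define K where "K = 1 + C * 2 powr p / (1 - 2 powr (p - 1))"
  have X': "X = (\<lambda>j \<omega>. cis (2*pi*\<theta> j \<omega>))" using X by blast
  have ind: "indep_vars (\<lambda>_. borel) X UNIV"
    unfolding X' by (rule indep_vars_compose2[OF ind\<theta>]) measurable
  have rv [measurable]: "X j \<in> borel_measurable M" for j using ind by (auto simp: indep_vars_def)
  have "(\<integral>\<^sup>+\<omega>. ennreal (cmod (\<Sum>j. b j * X j \<omega>) powr (-p)) \<partial>M) \<le> ennreal K"
    if b: "(\<lambda>j. (cmod (b j))\<^sup>2) sums 1" and sm: "AE \<omega> in M. summable (\<lambda>j. b j * X j \<omega>)" for b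
    unfolding K_def
  proof (rule negative_moment_of_small_ball[OF _ p C])
    show S: "(\<lambda>\<omega>. \<Sum>j. b j * X j \<omega>) \<in> borel_measurable M" by measurable
    have lim: "AE \<omega> in M. (\<lambda>n. \<Sum>j<n. b j * X j \<omega>) \<longlonglongrightarrow> (\<Sum>j. b j * X j \<omega>)"
      using sm by eventually_elim (rule summable_LIMSEQ)
    have Sn: "(\<lambda>\<omega>. \<Sum>j<n. b j * X j \<omega>) \<in> borel_measurable M" for n by measurable
    fix t :: real assume t: "0 < t"
    have "prob {\<omega> \<in> space M. cmod (\<Sum>j. b j * X j \<omega>) \<le> t} \<le> C * t"
    proof (cases "\<exists>m. 1/2 < (cmod (b m))\<^sup>2")
      case True
      then obtain m where m: "1/2 < (cmod (b m))\<^sup>2" by blast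
      have bm: "1/2 \<le> cmod (b m)"
      proof (rule ccontr)
        assume "\<not> 1/2 \<le> cmod (b m)"
        hence "(cmod (b m))\<^sup>2 \<le> (1/2)\<^sup>2" by (intro power_mono) auto
        with m show False by (simp add: power2_eq_square)
      qed
      have "prob {\<omega> \<in> space M. cmod (\<Sum>j. b j * X j \<omega>) \<le> t} \<le> 10 * t"
      proof (rule small_ball_limit[OF Sn S lim t])
        show "eventually (\<lambda>n. prob {\<omega> \<in> space M. cmod (\<Sum>j<n. b j * X j \<omega>) \<le> 2 * t} \<le> 10 * t) sequentially"
          using eventually_gt_at_top[of m]
        proof eventually_elim
          case (elim n)
          show ?case
          proof (rule small_ball_condition_on_one_term[OF ind elim])
            fix w
            have "prob {\<omega> \<in> space M. cmod (b m * X m \<omega> + w) \<le> 2 * t} \<le> 5 / 2 * (2 * t) / cmod (b m)"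
              unfolding X' using bm t by (intro steinhaus_translate_small_ball[OF prob_space_axioms D]) auto
            also have "\<dots> \<le> 5 / 2 * (2 * t) / (1/2)" using bm t by (intro divide_left_mono) auto
            finally show "prob {\<omega> \<in> space M. cmod (b m * X m \<omega> + w) \<le> 2 * t} \<le> 10 * t" by simp
          qed
        qed
      qed
      also have "10 * t \<le> C * t" unfolding C_def using t normal_negative_moment_nonneg[of 1] by (intro mult_right_mono) auto
      finally show ?thesis .
    next
      case False
      have "prob {\<omega> \<in> space M. cmod (\<Sum>j. b j * X j \<omega>) \<le> t} \<le> 2 * 72 * normal_negative_moment 1 * t powr 1"
      proof (rule small_ball_of_fourier_decay[OF Sn S lim _ _ t])
        have "(\<lambda>n. \<Sum>j<n. (cmod (b j))\<^sup>2) \<longlonglongrightarrow> 1" using b by (simp add: sums_def)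
        hence "eventually (\<lambda>n. 3/4 < (\<Sum>j<n. (cmod (b j))\<^sup>2)) sequentially"
          by (rule order_tendstoD) simp
        thus "eventually (\<lambda>n. \<forall>u. u \<noteq> 0 \<longrightarrow> cmod (CLINT \<omega>|M. iexp (u \<bullet> (\<Sum>j<n. b j * X j \<omega>))) \<le> 72 * cmod u powr (-1)) sequentially"
        proof (eventually_elim, intro allI impI)
          fix n u assume n: "3/4 < (\<Sum>j<n. (cmod (b j))\<^sup>2)" and u: "(u::complex) \<noteq> 0"
          have "cmod (CLINT \<omega>|M. iexp (u \<bullet> (\<Sum>j<n. b j * X j \<omega>))) = (\<Prod>j<n. \<bar>bessel_J0 (cmod (b j) * cmod u)\<bar>)"
            unfolding fourier_sum_indep[OF ind] unfolding X' steinhaus_fourier[OF D]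
            by (simp add: prod_norm[symmetric] norm_mult)
          also have "\<dots> \<le> 72 / cmod u"
            using u n False by (intro bessel_prod_bound) (auto simp: not_less)
          finally show "cmod (CLINT \<omega>|M. iexp (u \<bullet> (\<Sum>j<n. b j * X j \<omega>))) \<le> 72 * cmod u powr (-1)"
            using u by (simp add: powr_minus divide_inverse)
        qed
      qed auto
      also have "\<dots> \<le> C * t" unfolding C_def using t by simp
      finally show ?thesis .
    qed
    thus "prob {\<omega> \<in> space M. cmod (\<Sum>j. b j * X j \<omega>) \<le> t} \<le> C * t powr 1" using t by simp
  qed
  hence "negative_moment_bound M X p K" unfolding negative_moment_bound_def by blast
  moreover have "K > 0"
  proof -
    have "2 powr (p - 1) < 1" using p by (simp add: powr_less_one)
    thus ?thesis unfolding K_def using C by (intro add_pos_nonneg divide_nonneg_nonneg) auto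
  qed
  ultimately show ?thesis by blast
qed

section \<open>Growth of the mean square norm and of the characteristic\<close>

lemma entire_coeffs_summable:
  fixes a :: "nat \<Rightarrow> complex"
  assumes "\<And>z. summable (\<lambda>j. a j * z ^ j)"
  shows "summable (\<lambda>j. cmod (a j) * r ^ j)"
proof -
  have "summable (\<lambda>j. norm (a j * of_real \<bar>r\<bar> ^ j))"
    by (rule powser_insidea[OF assms[of "of_real (\<bar>r\<bar> + 1)"]]) auto
  hence "summable (\<lambda>j. norm (cmod (a j) * r ^ j))"
    by (simp add: norm_mult norm_power abs_mult power_abs)
  thus ?thesis by (rule summable_norm_cancel)
qed

lemma sigma_summable:
  fixes a :: "nat \<Rightarrow> complex"
  assumes "\<And>z. summable (\<lambda>j. a j * z ^ j)"
  shows "summable (\<lambda>j. (cmod (a j))\<^sup>2 * r ^ (2 * j))"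
proof -
  have s: "summable (\<lambda>j. cmod (a j) * \<bar>r\<bar> ^ j)" by (rule entire_coeffs_summable[OF assms])
  have "Bseq (\<lambda>j. cmod (a j) * \<bar>r\<bar> ^ j)"
    using summable_LIMSEQ_zero[OF s] by (intro convergent_imp_Bseq) (auto simp: convergent_def)
  then obtain B where B: "\<And>j. norm (cmod (a j) * \<bar>r\<bar> ^ j) \<le> B" unfolding Bseq_def by blast
  show ?thesis
  proof (rule summable_comparison_test[OF _ summable_mult[OF s, of B]], intro exI allI impI)
    fix j
    have "norm ((cmod (a j))\<^sup>2 * r ^ (2 * j)) = (cmod (a j) * \<bar>r\<bar> ^ j) * (cmod (a j) * \<bar>r\<bar> ^ j)"
      by (simp add: abs_mult power_abs power_mult power2_eq_square power_mult_distrib mult_2 power_add)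
    also have "\<dots> \<le> B * (cmod (a j) * \<bar>r\<bar> ^ j)"
      using B[of j] by (intro mult_right_mono) (auto simp: abs_mult)
    finally show "norm ((cmod (a j))\<^sup>2 * r ^ (2 * j)) \<le> B * (cmod (a j) * \<bar>r\<bar> ^ j)" .
  qed
qed

lemma continuous_sigma_norm:
  assumes "\<And>z. summable (\<lambda>j. a j * z ^ j)"
  shows "continuous_on UNIV (\<lambda>r. sigma_norm r a)"
proof -
  have s: "summable (\<lambda>j. (cmod (a j))\<^sup>2 * y ^ j)" for y :: real
  proof -
    have "summable (\<lambda>j. (cmod (a j))\<^sup>2 * sqrt \<bar>y\<bar> ^ (2 * j))" by (rule sigma_summable[OF assms])
    hence "summable (\<lambda>j. norm ((cmod (a j))\<^sup>2 * y ^ j))" by (simp add: power_mult abs_mult power_abs)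
    thus ?thesis by (rule summable_norm_cancel)
  qed
  have "isCont (\<lambda>y. \<Sum>j. (cmod (a j))\<^sup>2 * y ^ j) y" for y :: real
    by (rule isCont_powser_converges_everywhere[OF s])
  hence "continuous_on UNIV (\<lambda>y::real. \<Sum>j. (cmod (a j))\<^sup>2 * y ^ j)"
    by (simp add: continuous_at_imp_continuous_on)
  moreover have "continuous_on UNIV (\<lambda>r::real. r\<^sup>2)" by (intro continuous_intros)
  ultimately have "continuous_on UNIV (\<lambda>r::real. \<Sum>j. (cmod (a j))\<^sup>2 * (r\<^sup>2) ^ j)"
    by (rule continuous_on_compose2) simp
  hence "continuous_on UNIV (\<lambda>r. sqrt (\<Sum>j. (cmod (a j))\<^sup>2 * (r\<^sup>2) ^ j))"
    by (rule continuous_on_real_sqrt)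
  thus ?thesis by (simp add: sigma_norm_def power_mult)
qed

lemma sigma_norm_power2:
  assumes "\<And>z. summable (\<lambda>j. a j * z ^ j)"
  shows "(sigma_norm r a)\<^sup>2 = (\<Sum>j. (cmod (a j))\<^sup>2 * r ^ (2 * j))"
  unfolding sigma_norm_def using sigma_summable[OF assms] by (intro real_sqrt_pow2 suminf_nonneg) auto

lemma sigma_norm_ge_term:
  assumes "\<And>z. summable (\<lambda>j. a j * z ^ j)" "0 \<le> r"
  shows "cmod (a k) * r ^ k \<le> sigma_norm r a"
proof (rule power2_le_imp_le)
  have "(cmod (a k))\<^sup>2 * r ^ (2 * k) = sum (\<lambda>j. (cmod (a j))\<^sup>2 * r ^ (2 * j)) {k}" by simp
  also have "\<dots> \<le> (\<Sum>j. (cmod (a j))\<^sup>2 * r ^ (2 * j))"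
    by (rule sum_le_suminf[OF sigma_summable[OF assms(1)]]) auto
  finally show "(cmod (a k) * r ^ k)\<^sup>2 \<le> (sigma_norm r a)\<^sup>2"
    by (simp add: sigma_norm_power2[OF assms(1)] power_mult_distrib power_even_eq)
  show "0 \<le> sigma_norm r a" unfolding sigma_norm_def
    using sigma_summable[OF assms(1)] by (intro real_sqrt_ge_zero suminf_nonneg) auto
qed

lemma sigma_norm_strict_mono:
  assumes "\<And>z. summable (\<lambda>j. a j * z ^ j)" "a k \<noteq> 0" "0 < k" "0 \<le> r" "r < r'"
  shows "sigma_norm r a < sigma_norm r' a"
proof -
  have "0 < (\<Sum>j. (cmod (a j))\<^sup>2 * r' ^ (2 * j) - (cmod (a j))\<^sup>2 * r ^ (2 * j))"
  proof (rule suminf_pos2)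
    show "0 \<le> (cmod (a j))\<^sup>2 * r' ^ (2 * j) - (cmod (a j))\<^sup>2 * r ^ (2 * j)" for j
      using assms mult_left_mono[OF power_mono[of r r' "2*j"], of "(cmod (a j))\<^sup>2"] by simp
    show "0 < (cmod (a k))\<^sup>2 * r' ^ (2 * k) - (cmod (a k))\<^sup>2 * r ^ (2 * k)"
      using assms mult_strict_left_mono[OF power_strict_mono[of r r' "2*k"], of "(cmod (a k))\<^sup>2"] by simp
  qed (intro summable_diff sigma_summable[OF assms(1)])
  hence "(\<Sum>j. (cmod (a j))\<^sup>2 * r ^ (2 * j)) < (\<Sum>j. (cmod (a j))\<^sup>2 * r' ^ (2 * j))"
    using suminf_diff[OF sigma_summable[OF assms(1)] sigma_summable[OF assms(1)], of r' r] by simp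
  thus ?thesis by (simp add: sigma_norm_def)
qed

lemma parseval_partial:
  fixes c :: "nat \<Rightarrow> complex"
  shows "((\<lambda>t. (cmod (\<Sum>j<n. c j * cis t ^ j))\<^sup>2) has_integral (2 * pi * (\<Sum>j<n. (cmod (c j))\<^sup>2))) {0..2*pi}"
proof (induction n)
  case (Suc n)
  let ?P = "\<lambda>t. \<Sum>j<n. c j * cis t ^ j"
  have cross: "((\<lambda>t. c n * cis t ^ n * cnj (?P t)) has_integral 0) {0..2*pi}"
  proof -
    \<comment> \<open>On the unit circle the cross term is a polynomial without constant term.\<close>
    define h where "h = (\<lambda>z. c n * (\<Sum>j<n. cnj (c j) * z ^ (n - j)))"
    have "((\<lambda>t. h (of_real 1 * cis t)) has_integral (2 * pi * h 0)) {0..2*pi}"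
      by (rule circle_mean_value[of _ 2]) (auto simp: h_def intro!: holomorphic_intros)
    moreover have "h 0 = 0" by (auto simp: h_def intro!: sum.neutral)
    moreover have "h (of_real 1 * cis t) = c n * cis t ^ n * cnj (?P t)" for t
    proof -
      have e: "cis t ^ (n - j) = cis t ^ n * cnj (cis t ^ j)" if "j < n" for j
      proof -
        have "cis t ^ j * cnj (cis t ^ j) = 1"
          by (simp add: power_mult_distrib[symmetric] cis_cnj cis_mult)
        moreover have "cis t ^ n = cis t ^ (n - j) * cis t ^ j" using that by (simp flip: power_add)
        ultimately show ?thesis by (simp add: mult.assoc)
      qed
      have "h (of_real 1 * cis t) = c n * (\<Sum>j<n. cnj (c j) * (cis t ^ n * cnj (cis t ^ j)))"
        unfolding h_def using e by simp
      thus ?thesis by (simp add: sum_distrib_left cnj_sum algebra_simps)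
    qed
    ultimately show ?thesis by simp
  qed
  have A: "((\<lambda>t. (cmod (?P t))\<^sup>2 + 2 * Re (c n * cis t ^ n * cnj (?P t)) + (cmod (c n))\<^sup>2) has_integral
      (2 * pi * (\<Sum>j<n. (cmod (c j))\<^sup>2) + 2 * Re 0 + 2 * pi * (cmod (c n))\<^sup>2)) {0..2*pi}"
    using has_integral_const_real[of "(cmod (c n))\<^sup>2" 0 "2*pi"]
    by (intro has_integral_add has_integral_mult_right has_integral_Re Suc.IH cross) simp
  have eq: "(cmod (\<Sum>j<Suc n. c j * cis t ^ j))\<^sup>2 =
      (cmod (?P t))\<^sup>2 + 2 * Re (c n * cis t ^ n * cnj (?P t)) + (cmod (c n))\<^sup>2" for t
  proof -
    have "(cmod (u + v))\<^sup>2 = (cmod u)\<^sup>2 + 2 * Re (v * cnj u) + (cmod v)\<^sup>2" for u v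
      unfolding cmod_power2 by (simp add: power2_eq_square algebra_simps)
    from this[of "?P t" "c n * cis t ^ n"] show ?thesis by (simp add: norm_mult norm_power)
  qed
  have val: "2 * pi * (\<Sum>j<n. (cmod (c j))\<^sup>2) + 2 * Re 0 + 2 * pi * (cmod (c n))\<^sup>2 = 2 * pi * (\<Sum>j<Suc n. (cmod (c j))\<^sup>2)"
    by (simp add: algebra_simps)
  show ?case using A unfolding eq val .
qed simp

text \<open>
  The series converges boundedly on the circle, so Parseval's identity for the partial sums
  passes to the limit.
\<close>
lemma parseval_circle:
  assumes f: "\<And>z. (\<lambda>j. a j * z ^ j) sums f z" and r: "0 \<le> r"
  shows "((\<lambda>t. (cmod (f (of_real r * cis t)))\<^sup>2) has_integral (2 * pi * (sigma_norm r a)\<^sup>2)) {0..2*pi}"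
proof -
  have sm: "\<And>z. summable (\<lambda>j. a j * z ^ j)" using f sums_summable by blast
  define c where "c = (\<lambda>j. a j * of_real r ^ j)"
  define P where "P = (\<lambda>n t. \<Sum>j<n. c j * cis t ^ j)"
  define B where "B = (\<Sum>j. cmod (a j) * r ^ j)"
  have P: "((\<lambda>t. (cmod (P n t))\<^sup>2) has_integral (2 * pi * (\<Sum>j<n. (cmod (c j))\<^sup>2))) {0..2*pi}" for n
    unfolding P_def by (rule parseval_partial)
  have lim: "(\<lambda>n. (cmod (P n t))\<^sup>2) \<longlonglongrightarrow> (cmod (f (of_real r * cis t)))\<^sup>2" for t
  proof -
    have "P n t = (\<Sum>j<n. a j * (of_real r * cis t) ^ j)" for n
      by (simp add: P_def c_def power_mult_distrib mult.assoc)
    hence "(\<lambda>n. P n t) \<longlonglongrightarrow> f (of_real r * cis t)" using f[of "of_real r * cis t"] by (simp add: sums_def)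
    thus ?thesis by (intro tendsto_intros)
  qed
  have bound: "norm ((cmod (P n t))\<^sup>2) \<le> B\<^sup>2" for n t
  proof -
    have "cmod (P n t) \<le> (\<Sum>j<n. cmod (a j) * r ^ j)"
      unfolding P_def c_def using r by (intro sum_norm_le) (simp add: norm_mult norm_power)
    also have "\<dots> \<le> B" unfolding B_def
      using r by (intro sum_le_suminf entire_coeffs_summable[OF sm]) auto
    finally show ?thesis by (simp add: power_mono)
  qed
  have D: "(\<lambda>t. (cmod (f (of_real r * cis t)))\<^sup>2) integrable_on {0..2*pi}"
    "(\<lambda>n. integral {0..2*pi} (\<lambda>t. (cmod (P n t))\<^sup>2)) \<longlonglongrightarrow> integral {0..2*pi} (\<lambda>t. (cmod (f (of_real r * cis t)))\<^sup>2)"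
    using dominated_convergence[of "\<lambda>n t. (cmod (P n t))\<^sup>2" "{0..2*pi}" "\<lambda>_. B\<^sup>2" "\<lambda>t. (cmod (f (of_real r * cis t)))\<^sup>2"]
      P bound lim by (auto simp: has_integral_iff)
  have "(\<lambda>n. integral {0..2*pi} (\<lambda>t. (cmod (P n t))\<^sup>2)) \<longlonglongrightarrow> 2 * pi * (sigma_norm r a)\<^sup>2"
  proof -
    have "(\<lambda>n. \<Sum>j<n. (cmod (a j))\<^sup>2 * r ^ (2 * j)) \<longlonglongrightarrow> (sigma_norm r a)\<^sup>2"
      unfolding sigma_norm_power2[OF sm] by (rule summable_LIMSEQ[OF sigma_summable[OF sm]])
    moreover have "(cmod (c j))\<^sup>2 = (cmod (a j))\<^sup>2 * r ^ (2 * j)" for j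
      using r by (simp add: c_def norm_mult norm_power power_mult_distrib power_mult mult.commute[of 2 j] flip: power_mult)
    ultimately have "(\<lambda>n. 2 * pi * (\<Sum>j<n. (cmod (c j))\<^sup>2)) \<longlonglongrightarrow> 2 * pi * (sigma_norm r a)\<^sup>2"
      by (intro tendsto_intros) simp
    moreover have "integral {0..2*pi} (\<lambda>t. (cmod (P n t))\<^sup>2) = 2 * pi * (\<Sum>j<n. (cmod (c j))\<^sup>2)" for n
      using P by (rule integral_unique)
    ultimately show ?thesis by (simp only:)
  qed
  from LIMSEQ_unique[OF D(2) this] D(1) show ?thesis unfolding has_integral_iff by blast
qed

lemma log_plus_eq: "0 \<le> x \<Longrightarrow> log_plus x = ln (max 1 x)"
  by (cases "x = 0") (auto simp: log_plus_def max_def)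

lemma log_plus_nonneg: "0 \<le> log_plus x" by (simp add: log_plus_def)

lemma log_plus_circle_integrable:
  assumes "f holomorphic_on UNIV"
  shows "(\<lambda>t. log_plus (cmod (f (of_real r * cis t)))) integrable_on {0..2*pi}"
proof -
  have "continuous_on UNIV f" using assms by (rule holomorphic_on_imp_continuous_on)
  hence c: "continuous_on {0..2*pi} (\<lambda>t. f (of_real r * cis t))"
    by (intro continuous_on_compose2[of UNIV f _ "\<lambda>t. of_real r * cis t"] continuous_intros) auto
  have "(\<lambda>t. ln (max 1 (cmod (f (of_real r * cis t))))) integrable_on {0..2*pi}"
    by (intro integrable_continuous_real continuous_on_ln continuous_on_max continuous_intros c) auto
  thus ?thesis by (simp add: log_plus_eq)
qed

text \<open>
  The tangent inequality \<open>ln y \<le> ln \<sigma> + y\<^sup>2 / (2 \<sigma>\<^sup>2)\<close>, integrated with Parseval's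
  identity, is Jensen's inequality for the logarithm up to an additive constant.
\<close>
lemma nevanlinna_T_le_ln_sigma:
  assumes f: "\<And>z. (\<lambda>j. a j * z ^ j) sums f z" and hol: "f holomorphic_on UNIV"
    and r: "0 \<le> r" and \<sigma>: "1 \<le> sigma_norm r a"
  shows "nevanlinna_T r f \<le> ln (sigma_norm r a) + 1"
proof -
  define \<sigma> where "\<sigma> = sigma_norm r a"
  let ?F = "\<lambda>t. cmod (f (of_real r * cis t))"
  have \<sigma>1: "1 \<le> \<sigma>" using \<sigma> by (simp add: \<sigma>_def)
  have rhs: "((\<lambda>t. (ln \<sigma> + 1/2) + (?F t)\<^sup>2 * (1 / (2 * \<sigma>\<^sup>2))) has_integral
      (2 * pi * (ln \<sigma> + 1/2) + 2 * pi * \<sigma>\<^sup>2 * (1 / (2 * \<sigma>\<^sup>2)))) {0..2*pi}"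
    using has_integral_const_real[of "ln \<sigma> + 1/2" 0 "2*pi"] parseval_circle[OF f r]
    by (intro has_integral_add has_integral_mult_left) (auto simp: \<sigma>_def)
  have pw: "log_plus x \<le> (ln \<sigma> + 1/2) + x\<^sup>2 * (1 / (2 * \<sigma>\<^sup>2))" if "0 \<le> x" for x
  proof -
    have *: "ln y \<le> ln \<sigma> + y\<^sup>2 / (2 * \<sigma>\<^sup>2)" if "0 < y" for y
    proof -
      have "ln ((y / \<sigma>)\<^sup>2) \<le> (y / \<sigma>)\<^sup>2 - 1" using that \<sigma>1 by (intro ln_le_minus_one) auto
      moreover have "ln ((y / \<sigma>)\<^sup>2) = 2 * (ln y - ln \<sigma>)" using that \<sigma>1 by (simp add: ln_realpow ln_div)
      ultimately have "2 * (ln y - ln \<sigma>) \<le> (y / \<sigma>)\<^sup>2" by linarith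
      thus ?thesis by (simp add: power_divide)
    qed
    show ?thesis
    proof (cases "x \<le> 1")
      case True
      have "log_plus x = 0" using True that by (simp add: log_plus_eq max_def)
      thus ?thesis using \<sigma>1 by (simp add: add_nonneg_nonneg)
    next
      case False
      have "log_plus x = ln x" using False that by (simp add: log_plus_eq max_def)
      thus ?thesis using *[of x] False by simp
    qed
  qed
  have "integral {0..2*pi} (\<lambda>t. log_plus (?F t)) \<le> 2 * pi * (ln \<sigma> + 1/2) + 2 * pi * \<sigma>\<^sup>2 * (1 / (2 * \<sigma>\<^sup>2))"
    by (rule has_integral_le[OF integrable_integral[OF log_plus_circle_integrable[OF hol]] rhs]) (rule pw, simp)
  also have "\<dots> = 2 * pi * (ln \<sigma> + 1)" using \<sigma>1 by (simp add: algebra_simps)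
  finally show ?thesis by (simp add: nevanlinna_T_def \<sigma>_def field_simps)
qed

lemma nevanlinna_N_nonneg:
  assumes g: "g holomorphic_on UNIV" "g 0 \<noteq> (0::complex)" and r: "0 < r"
  shows "0 \<le> nevanlinna_N r g"
proof -
  have e: "{z \<in> cball 0 0. g z = 0} = {}" using g by auto
  have "zero_count 0 g = 0" unfolding zero_count_def e by simp
  moreover have "0 \<le> integral {0..r} (jensen_kernel g)"
    using zero_count_mono[OF g, of 0]
    by (intro Henstock_Kurzweil_Integration.integral_nonneg jensen_formula_nonzero(1)[OF g r])
       (auto simp: jensen_kernel_def intro!: divide_nonneg_nonneg)
  ultimately show ?thesis unfolding nevanlinna_N_def jensen_kernel_def[symmetric] by simp
qed

text \<open>
  If \<open>f\<close> takes the value \<open>f z0\<close> different from \<open>f 0\<close>, then \<open>f - f z0\<close> has a zero outside the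
  origin, and Jensen's formula gives a mean of at least \<open>ln r - C\<close> for its logarithm. In
  particular the characteristic of a nonconstant entire function is unbounded.
\<close>
lemma nevanlinna_T_ge_ln:
  assumes hol: "f holomorphic_on UNIV" and nc: "f z0 \<noteq> f 0"
  shows "\<exists>C. \<forall>r. cmod z0 \<le> r \<longrightarrow> ln r - C \<le> nevanlinna_T r f"
proof -
  define w where "w = f z0"
  define g where "g = (\<lambda>z. f z - w)"
  have g: "g holomorphic_on UNIV" "g z0 = 0" "g 0 \<noteq> 0"
    using hol nc by (auto simp: g_def w_def intro!: holomorphic_intros)
  obtain h where h: "h holomorphic_on UNIV" "\<And>z. g z = (z - z0) * h z"
    using entire_factor_zero[OF g(1,2)] by metis
  have h0: "h 0 \<noteq> 0" and z0: "z0 \<noteq> 0" using h(2)[of 0] g nc by auto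
  define C where "C = log_plus (cmod w) + ln 2 - ln (cmod (h 0))"
  show ?thesis
  proof (intro exI allI impI)
    fix r assume r: "cmod z0 \<le> r"
    have r0: "0 < r" using r z0 by (meson less_le_trans zero_less_norm_iff)
    let ?F = "\<lambda>t. cmod (f (of_real r * cis t))"
    have int: "((\<lambda>t. ln (cmod (of_real r * cis t - z0)) + ln (cmod (h (of_real r * cis t)))) has_integral
        (2 * pi * ln r + 2 * pi * (ln (cmod (h 0)) + nevanlinna_N r h))) {0..2*pi}"
      by (intro has_integral_add circle_mean_ln_dist jensen_formula_nonzero r0 r h h0)
    have eq: "ln (cmod (g (of_real r * cis t))) = ln (cmod (of_real r * cis t - z0)) + ln (cmod (h (of_real r * cis t)))"
      if "t \<in> {0..2*pi} - {t \<in> {0..2*pi}. g (of_real r * cis t) = 0}" for t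
    proof -
      have "cmod (of_real r * cis t - z0) > 0" "cmod (h (of_real r * cis t)) > 0"
        using that by (auto simp: h(2))
      thus ?thesis by (simp add: h(2) norm_mult ln_mult_pos)
    qed
    have lhs: "((\<lambda>t. ln (cmod (g (of_real r * cis t)))) has_integral
        (2 * pi * ln r + 2 * pi * (ln (cmod (h 0)) + nevanlinna_N r h))) {0..2*pi}"
      by (rule has_integral_spike[OF negligible_zeros_on_circle[OF g(1,3) r0] eq int])
    have rhs: "((\<lambda>t. log_plus (?F t) + (log_plus (cmod w) + ln 2)) has_integral
        (integral {0..2*pi} (\<lambda>t. log_plus (?F t)) + 2 * pi * (log_plus (cmod w) + ln 2))) {0..2*pi}"
      using has_integral_const_real[of "log_plus (cmod w) + ln 2" 0 "2*pi"]
      by (intro has_integral_add integrable_integral log_plus_circle_integrable hol) simp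
    have pw: "ln (cmod (g z)) \<le> log_plus (cmod (f z)) + (log_plus (cmod w) + ln 2)" for z
    proof (cases "g z = 0")
      case True
      thus ?thesis by (simp add: log_plus_nonneg add_nonneg_nonneg)
    next
      case False
      define A where "A = max 1 (cmod (f z))"
      define B where "B = max 1 (cmod w)"
      have AB: "1 \<le> A" "1 \<le> B" by (auto simp: A_def B_def)
      have "cmod (g z) \<le> cmod (f z) + cmod w" unfolding g_def by (rule norm_triangle_ineq4)
      also have "\<dots> \<le> A + B" by (auto simp: A_def B_def)
      also have "\<dots> \<le> A * B * 2"
      proof -
        have "A * 1 \<le> A * B" "1 * B \<le> A * B" using AB by (auto intro!: mult_left_mono mult_right_mono)
        thus ?thesis by simp
      qed
      finally have "ln (cmod (g z)) \<le> ln (A * B * 2)" using False AB by (intro ln_mono) auto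
      also have "\<dots> = ln A + (ln B + ln 2)" using AB by (simp add: ln_mult_pos)
      finally show ?thesis by (simp add: log_plus_eq A_def B_def)
    qed
    have "2 * pi * ln r + 2 * pi * (ln (cmod (h 0)) + nevanlinna_N r h) \<le>
       integral {0..2*pi} (\<lambda>t. log_plus (?F t)) + 2 * pi * (log_plus (cmod w) + ln 2)"
      by (rule has_integral_le[OF lhs rhs]) (rule pw)
    moreover have "integral {0..2*pi} (\<lambda>t. log_plus (?F t)) = 2 * pi * nevanlinna_T r f"
      by (simp add: nevanlinna_T_def)
    ultimately have "2 * pi * (ln r + ln (cmod (h 0)) + nevanlinna_N r h) \<le> 2 * pi * (nevanlinna_T r f + log_plus (cmod w) + ln 2)"
      by (simp add: algebra_simps)
    hence "ln r + ln (cmod (h 0)) + nevanlinna_N r h \<le> nevanlinna_T r f + log_plus (cmod w) + ln 2"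
      by (rule mult_left_le_imp_le) simp
    thus "ln r - C \<le> nevanlinna_T r f"
      using nevanlinna_N_nonneg[OF h(1) h0 r0] by (simp add: C_def)
  qed
qed

text \<open>
  For large \<open>x\<close> the function \<open>x - c' (ln x)\<^sup>m\<close> is increasing, so \<open>T\<close> may be replaced by
  \<open>L + 1\<close>; the gap between \<open>c\<close> and \<open>c'\<close> absorbs all constants.
\<close>
lemma log_power_comparison:
  fixes c c' C :: real
  assumes c: "0 \<le> c" "c < c'" and m: "0 < m"
  shows "\<exists>x0. \<forall>L T. x0 \<le> L \<longrightarrow> x0 \<le> T \<longrightarrow> T \<le> L + 1 \<longrightarrow>
           T - c' * ln T ^ m \<le> L - 1 - C - c * ln L ^ m"
proof -
  have "((\<lambda>x::real. c' * (real m * ln x ^ (m - 1)) / x) \<longlongrightarrow> 0) at_top"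
    by real_asymp
  hence "eventually (\<lambda>x. c' * (real m * ln x ^ (m - 1)) / x < 1) at_top"
    by (rule order_tendstoD) simp
  then obtain x1 where x1: "\<And>x. x1 \<le> x \<Longrightarrow> c' * (real m * ln x ^ (m - 1)) / x < 1"
    unfolding eventually_at_top_linorder by blast
  define x2 where "x2 = max x1 1"
  define x0 where "x0 = max x2 (max (exp 1) (exp ((2 + \<bar>C\<bar>) / (c' - c))))"
  have mono: "x - c' * ln x ^ m \<le> y - c' * ln y ^ m" if "x2 \<le> x" "x \<le> y" for x y
  proof (rule DERIV_nonneg_imp_nondecreasing[OF that(2)])
    fix z assume z: "x \<le> z" "z \<le> y"
    have z': "1 \<le> z" "x1 \<le> z" using that z by (auto simp: x2_def)
    have "((\<lambda>x. x - c' * ln x ^ m) has_real_derivative 1 - c' * (real m * ln z ^ (m - 1)) / z) (at z)"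
      using z' by (auto intro!: derivative_eq_intros simp: field_simps)
    thus "\<exists>y. ((\<lambda>x. x - c' * ln x ^ m) has_real_derivative y) (at z) \<and> 0 \<le> y"
      using x1[OF z'(2)] by (intro exI[of _ "1 - c' * (real m * ln z ^ (m - 1)) / z"]) auto
  qed
  show ?thesis
  proof (intro exI allI impI)
    fix L T assume L: "x0 \<le> L" and T: "x0 \<le> T" "T \<le> L + 1"
    have L': "x2 \<le> L" "exp 1 \<le> L" "exp ((2 + \<bar>C\<bar>) / (c' - c)) \<le> L" using L by (auto simp: x0_def)
    have Lpos: "0 < L" using L'(2) by (meson exp_gt_zero less_le_trans)
    have L1: "1 \<le> L" using L'(2) exp_ge_add_one_self[of 1] by linarith
    have l1: "1 \<le> ln L" using L'(2) Lpos by (simp add: ln_ge_iff)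
    have l2: "(2 + \<bar>C\<bar>) / (c' - c) \<le> ln L" using L'(3) Lpos by (simp add: ln_ge_iff)
    have "ln L ^ 1 \<le> ln L ^ m" using l1 m by (intro power_increasing) auto
    hence "(2 + \<bar>C\<bar>) / (c' - c) \<le> ln L ^ m" using l2 by simp
    hence key: "2 + \<bar>C\<bar> \<le> (c' - c) * ln L ^ m" using c by (simp add: divide_le_eq mult.commute)
    have "T - c' * ln T ^ m \<le> (L + 1) - c' * ln (L + 1) ^ m"
      using T by (intro mono) (auto simp: x0_def)
    also have "\<dots> \<le> (L + 1) - c' * ln L ^ m"
      using c l1 L1 by (intro diff_left_mono mult_left_mono power_mono) auto
    finally show "T - c' * ln T ^ m \<le> L - 1 - C - c * ln L ^ m"
      using key abs_ge_self[of C] by (simp add: algebra_simps)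
  qed
qed

section \<open>Random entire functions and sequences of radii\<close>

text \<open>
  Integrate the pointwise bound: the term with the factor \<open>B\<close> has nonpositive mean. For a
  function \<open>u\<close> of \<open>|g|\<close> such a bound is a tangent line inequality at \<open>u = Q\<close>, and this argument replaces
  Jensen's inequality for means.
\<close>
lemma mean_lower_bound:
  fixes l u :: "real \<Rightarrow> real"
  assumes I: "(l has_integral I) {0..2*pi}"
    and u [measurable]: "u \<in> borel_measurable borel" and u0: "\<And>t. 0 \<le> u t"
    and nn: "(\<integral>\<^sup>+t\<in>{0..2*pi}. ennreal (u t) \<partial>lborel) \<le> ennreal (2*pi*Q)"
    and Q: "0 < Q" and B: "0 \<le> B"
    and neg: "negligible Z"
    and pw: "\<And>t. t \<in> {0..2*pi} - Z \<Longrightarrow> A - B * (u t / Q - 1) \<le> l t"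
  shows "2 * pi * A \<le> I"
proof -
  have fin: "(\<integral>\<^sup>+t. ennreal (u t * indicator {0..2*pi} t) \<partial>lborel) \<le> ennreal (2*pi*Q)"
    using nn by (simp add: nn_integral_set_ennreal)
  have int: "integrable lborel (\<lambda>t. u t * indicator {0..2*pi} t)"
    by (rule integrableI_nonneg) (use u0 fin in \<open>auto intro: le_less_trans\<close>)
  hence si: "set_integrable lborel {0..2*pi} u"
    by (simp add: set_integrable_def mult.commute)
  define J where "J = integral {0..2*pi} u"
  have J: "(u has_integral J) {0..2*pi}" unfolding J_def
    using set_borel_integral_eq_integral(1)[OF si] by (rule integrable_integral)
  have "J = (LINT t|lborel. u t * indicator {0..2*pi} t)"
    unfolding J_def set_borel_integral_eq_integral(2)[OF si, symmetric] set_lebesgue_integral_def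
    by (simp add: mult.commute)
  hence "ennreal J = (\<integral>\<^sup>+t. ennreal (u t * indicator {0..2*pi} t) \<partial>lborel)"
    using nn_integral_eq_integral[OF int] u0 by simp
  hence "ennreal J \<le> ennreal (2 * pi * Q)" using fin by (simp only:)
  hence JQ: "J \<le> 2 * pi * Q" using Q by (subst (asm) ennreal_le_iff) auto
  \<comment> \<open>Redefine \<open>l\<close> on the negligible set so that the lower bound holds everywhere.\<close>
  define l' where "l' = (\<lambda>t. if t \<in> Z then A + B - B / Q * u t else l t)"
  have l': "(l' has_integral I) {0..2*pi}"
    by (rule has_integral_spike[OF neg _ I]) (simp add: l'_def)
  have low: "((\<lambda>t. A + B - B / Q * u t) has_integral (2 * pi * (A + B) - B / Q * J)) {0..2*pi}"
    using has_integral_const_real[of "A + B" 0 "2*pi"]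
    by (intro has_integral_diff has_integral_mult_right J) simp
  have "2 * pi * (A + B) - B / Q * J \<le> I"
  proof (rule has_integral_le[OF low l'])
    fix t assume t: "t \<in> {0..2*pi}"
    show "A + B - B / Q * u t \<le> l' t"
      using pw[of t] t by (auto simp: l'_def algebra_simps)
  qed
  moreover have "B / Q * J \<le> B / Q * (2 * pi * Q)" using JQ B Q by (intro mult_left_mono) auto
  moreover have "B / Q * (2 * pi * Q) = 2 * pi * B" using Q by simp
  ultimately show ?thesis by (simp add: algebra_simps)
qed

text \<open>
  A Borel--Cantelli argument in terms of expectations: the sum of the \<open>Z n\<close> has finite
  expectation, hence is almost surely finite, hence its terms tend to 0.
\<close>
lemma AE_eventually_le_1:
  fixes Z :: "nat \<Rightarrow> 'a \<Rightarrow> ennreal"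
  assumes Z [measurable]: "\<And>n. Z n \<in> borel_measurable M"
    and E: "\<And>n. n1 \<le> n \<Longrightarrow> (\<integral>\<^sup>+\<omega>. Z n \<omega> \<partial>M) \<le> ennreal (e n)"
    and e: "summable e" "\<And>n. 0 \<le> e n"
  shows "AE \<omega> in M. \<exists>N. \<forall>n\<ge>N. Z n \<omega> \<le> 1"
proof -
  have "(\<integral>\<^sup>+\<omega>. (\<Sum>n. Z (n + n1) \<omega>) \<partial>M) = (\<Sum>n. \<integral>\<^sup>+\<omega>. Z (n + n1) \<omega> \<partial>M)"
    by (rule nn_integral_suminf) measurable
  also have "\<dots> \<le> (\<Sum>n. ennreal (e (n + n1)))" by (intro suminf_le E) auto
  also have "\<dots> = ennreal (\<Sum>n. e (n + n1))"
    using e by (intro suminf_ennreal2) (auto simp: summable_iff_shift)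
  also have "\<dots> < \<infinity>" by simp
  finally have "AE \<omega> in M. (\<Sum>n. Z (n + n1) \<omega>) \<noteq> \<infinity>"
    by (intro nn_integral_PInf_AE) auto
  thus ?thesis
  proof eventually_elim
    case (elim \<omega>)
    define z where "z = (\<lambda>n. enn2real (Z (n + n1) \<omega>))"
    have z: "ennreal (z n) = Z (n + n1) \<omega>" for n
    proof -
      define g where "g = (\<lambda>n. Z (n + n1) \<omega>)"
      have "sum g {n} \<le> suminf g" by (rule sum_le_suminf) auto
      hence "g n \<le> suminf g" by simp
      hence "g n < top" using elim unfolding g_def by (auto simp: less_top intro: le_less_trans)
      thus ?thesis by (simp add: z_def g_def)
    qed
    have "summable z"
      by (rule summable_suminf_not_top) (use elim z in \<open>auto simp: z_def\<close>)
    hence "z \<longlonglongrightarrow> 0" by (rule summable_LIMSEQ_zero)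
    hence "eventually (\<lambda>n. z n < 1) sequentially" by (rule order_tendstoD) simp
    then obtain N where N: "\<And>n. N \<le> n \<Longrightarrow> z n < 1" unfolding eventually_sequentially by blast
    show ?case
    proof (intro exI allI impI)
      fix n assume n: "N + n1 \<le> n"
      have "Z n \<omega> = ennreal (z (n - n1))" using n by (simp add: z)
      also have "\<dots> \<le> ennreal 1" using less_imp_le[OF N[of "n - n1"]] n by (intro ennreal_leI) auto
      finally show "Z n \<omega> \<le> 1" by simp
    qed
  qed
qed

text \<open>
  For each integer radius the expected sum of the moduli is finite.
\<close>
lemma (in prob_space) AE_random_series_summable:
  assumes X [measurable]: "\<And>j. X j \<in> borel_measurable M"
    and E: "\<And>j. (\<integral>\<^sup>+\<omega>. ennreal (cmod (X j \<omega>)) \<partial>M) \<le> ennreal B" and B: "0 \<le> B"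
    and a: "\<And>z. summable (\<lambda>j. a j * z ^ j)"
  shows "AE \<omega> in M. \<forall>z. summable (\<lambda>j. X j \<omega> * a j * z ^ j)"
proof -
  have "AE \<omega> in M. summable (\<lambda>j. cmod (X j \<omega>) * (cmod (a j) * real R ^ j))" for R :: nat
  proof -
    have s: "summable (\<lambda>j. B * (cmod (a j) * real R ^ j))"
      by (intro summable_mult entire_coeffs_summable a)
    have "(\<integral>\<^sup>+\<omega>. (\<Sum>j. ennreal (cmod (X j \<omega>) * (cmod (a j) * real R ^ j))) \<partial>M)
       = (\<Sum>j. \<integral>\<^sup>+\<omega>. ennreal (cmod (X j \<omega>) * (cmod (a j) * real R ^ j)) \<partial>M)"
      by (rule nn_integral_suminf) measurable
    also have "\<dots> \<le> (\<Sum>j. ennreal (B * (cmod (a j) * real R ^ j)))"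
    proof (intro suminf_le)
      fix j
      have "(\<integral>\<^sup>+\<omega>. ennreal (cmod (X j \<omega>) * (cmod (a j) * real R ^ j)) \<partial>M) =
          (\<integral>\<^sup>+\<omega>. ennreal (cmod (X j \<omega>)) * ennreal (cmod (a j) * real R ^ j) \<partial>M)"
        by (simp add: ennreal_mult)
      also have "\<dots> = (\<integral>\<^sup>+\<omega>. ennreal (cmod (X j \<omega>)) \<partial>M) * ennreal (cmod (a j) * real R ^ j)"
        by (rule nn_integral_multc) measurable
      also have "\<dots> \<le> ennreal B * ennreal (cmod (a j) * real R ^ j)"
        by (intro mult_right_mono E) auto
      also have "\<dots> = ennreal (B * (cmod (a j) * real R ^ j))" using B by (simp add: ennreal_mult)
      finally show "(\<integral>\<^sup>+\<omega>. ennreal (cmod (X j \<omega>) * (cmod (a j) * real R ^ j)) \<partial>M) \<le> ennreal (B * (cmod (a j) * real R ^ j))" .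
    qed auto
    also have "\<dots> = ennreal (\<Sum>j. B * (cmod (a j) * real R ^ j))"
      using s B by (intro suminf_ennreal2) auto
    also have "\<dots> < \<infinity>" by simp
    finally have "AE \<omega> in M. (\<Sum>j. ennreal (cmod (X j \<omega>) * (cmod (a j) * real R ^ j))) \<noteq> \<infinity>"
      by (intro nn_integral_PInf_AE) auto
    thus ?thesis
      by eventually_elim (rule summable_suminf_not_top, auto)
  qed
  hence "AE \<omega> in M. \<forall>R::nat. summable (\<lambda>j. cmod (X j \<omega>) * (cmod (a j) * real R ^ j))"
    by (simp add: AE_all_countable)
  thus ?thesis
  proof eventually_elim
    case (elim \<omega>)
    show ?case
    proof
      fix z :: complex
      obtain R :: nat where R: "cmod z \<le> real R" using real_arch_simple by blast
      show "summable (\<lambda>j. X j \<omega> * a j * z ^ j)"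
      proof (rule summable_comparison_test[OF _ elim[rule_format, of R]], intro exI allI impI)
        fix j
        show "norm (X j \<omega> * a j * z ^ j) \<le> cmod (X j \<omega>) * (cmod (a j) * real R ^ j)"
          using R by (auto simp: norm_mult norm_power mult.assoc intro!: mult_left_mono power_mono)
      qed
    qed
  qed
qed

lemma entire_of_everywhere_summable:
  assumes "\<And>z. summable (\<lambda>j. (c j :: complex) * z ^ j)"
  shows "(\<lambda>z. \<Sum>j. c j * z ^ j) holomorphic_on UNIV"
proof (rule holomorphic_onI)
  fix z :: complex
  have "((\<lambda>z. \<Sum>j. c j * z ^ j) has_field_derivative (\<Sum>n. diffs c n * z ^ n)) (at z)"
    by (rule termdiffs_strong_converges_everywhere[OF assms])
  thus "(\<lambda>z. \<Sum>j. c j * z ^ j) field_differentiable at z within UNIV"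
    by (auto simp: field_differentiable_def)
qed

text \<open>
  The random function is \<open>z\<^sup>k h(z)\<close> with \<open>h 0 = X k * a k\<close>.
\<close>
lemma jensen_random_entire:
  assumes sm: "\<And>z. summable (\<lambda>j. X j \<omega> * a j * z ^ j)"
    and k: "\<forall>i<k. a i = 0" "a k \<noteq> 0" "X k \<omega> \<noteq> 0"
  defines "g \<equiv> random_entire X a \<omega>"
  shows "g holomorphic_on UNIV" "\<exists>w. g w \<noteq> 0"
    and "0 < r \<Longrightarrow> ((\<lambda>t. ln (cmod (g (of_real r * cis t)))) has_integral
           (2 * pi * (ln (cmod (X k \<omega> * a k)) + nevanlinna_N r g))) {0..2*pi}"
    and "0 < r \<Longrightarrow> r \<le> r' \<Longrightarrow> nevanlinna_N r g \<le> nevanlinna_N r' g"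
proof -
  define c where "c = (\<lambda>j. X j \<omega> * a j)"
  define h where "h = (\<lambda>z. \<Sum>j. c (j + k) * z ^ j)"
  have smc: "\<And>z. summable (\<lambda>j. c j * z ^ j)" using sm by (simp add: c_def)
  have smh: "\<And>z. summable (\<lambda>j. c (j + k) * z ^ j)"
    using smc by (simp add: summable_powser_ignore_initial_segment)
  have hol: "h holomorphic_on UNIV" unfolding h_def by (rule entire_of_everywhere_summable[OF smh])
  have h0: "h 0 = X k \<omega> * a k" by (simp add: h_def c_def)
  hence h0': "h 0 \<noteq> 0" using k by simp
  have g: "g z = z ^ k * h z" for z
  proof -
    have "g z = (\<Sum>j. c j * z ^ j)" by (simp add: g_def random_entire_def c_def)
    also have "\<dots> = (\<Sum>j. c (j + k) * z ^ (j + k)) + (\<Sum>j<k. c j * z ^ j)"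
      by (rule suminf_split_initial_segment[OF smc])
    also have "(\<Sum>j<k. c j * z ^ j) = 0" using k by (intro sum.neutral) (auto simp: c_def)
    also have "(\<Sum>j. c (j + k) * z ^ (j + k)) = (\<Sum>j. z ^ k * (c (j + k) * z ^ j))"
      by (simp add: power_add mult_ac)
    also have "\<dots> = z ^ k * h z" unfolding h_def by (rule suminf_mult[OF smh])
    finally show ?thesis by simp
  qed
  show ghol: "g holomorphic_on UNIV"
    by (rule holomorphic_transform[of "\<lambda>z. z ^ k * h z"]) (use hol g in \<open>auto intro!: holomorphic_intros\<close>)
  have "eventually (\<lambda>z. h z \<noteq> 0 \<and> z \<noteq> 0) (at 0)"
    using eventually_nonzero_entire[OF hol h0', of 0] eventually_neq_at_within[of 0 0] by eventually_elim simp
  then obtain w where "h w \<noteq> 0 \<and> w \<noteq> 0" using eventually_happens'[OF at_neq_bot] by blast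
  hence w: "g w \<noteq> 0" by (simp add: g)
  thus "\<exists>w. g w \<noteq> 0" by blast
  note J = jensen_formula[OF hol h0' _ g]
  show "((\<lambda>t. ln (cmod (g (of_real r * cis t)))) has_integral
           (2 * pi * (ln (cmod (X k \<omega> * a k)) + nevanlinna_N r g))) {0..2*pi}" if "0 < r"
    using J(2)[OF that] unfolding h0 .
  show "nevanlinna_N r g \<le> nevanlinna_N r' g" if "0 < r" "r \<le> r'"
    by (rule nevanlinna_N_mono[OF ghol w J(1) that])
qed

lemma sigma_norm_sequence:
  assumes a: "\<And>z. summable (\<lambda>j. a j * z ^ j)" and k: "a k \<noteq> 0" "0 < k"
  shows "\<exists>rr n0. \<forall>n\<ge>n0. 1 \<le> rr n \<and> sigma_norm (rr n) a = exp (real n)"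
proof -
  obtain n0 :: nat where n0: "sigma_norm 1 a \<le> real n0" using real_arch_simple by blast
  have "\<exists>r. 1 \<le> r \<and> sigma_norm r a = exp (real n)" if n: "n0 \<le> n" for n
  proof -
    have lo: "sigma_norm 1 a \<le> exp (real n)"
      using n0 n exp_ge_add_one_self[of "real n"] by linarith
    define R where "R = max 1 (exp (real n) / cmod (a k))"
    have "exp (real n) \<le> cmod (a k) * R" using k by (simp add: R_def max_def field_simps)
    also have "\<dots> \<le> cmod (a k) * R ^ k"
      using k power_increasing[of 1 k R] by (intro mult_left_mono) (auto simp: R_def)
    also have "\<dots> \<le> sigma_norm R a" by (rule sigma_norm_ge_term[OF a]) (simp add: R_def)
    finally have hi: "exp (real n) \<le> sigma_norm R a" .
    have "\<exists>r\<ge>1. r \<le> R \<and> sigma_norm r a = exp (real n)"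
      by (rule IVT'[where f="\<lambda>r. sigma_norm r a", OF lo hi]) (auto simp: R_def intro: continuous_on_subset[OF continuous_sigma_norm[OF a]])
    thus ?thesis by blast
  qed
  then obtain rr where "\<forall>n\<ge>n0. 1 \<le> rr n \<and> sigma_norm (rr n) a = exp (real n)" by metis
  thus ?thesis by blast
qed

text \<open>
  For \<open>r\<close> between \<open>rr n\<close> and \<open>rr (n + 1)\<close> monotonicity gives \<open>N r \<ge> N (rr n)\<close>, while \<open>ln \<sigma>\<close>
  differs from \<open>n\<close> by less than 1. What remains is a comparison of \<open>T\<close> with \<open>ln \<sigma>\<close>.
\<close>
lemma sequence_to_all_radii:
  fixes N :: "real \<Rightarrow> real"
  assumes f: "\<And>z. (\<lambda>j. a j * z ^ j) sums f z" and hol: "f holomorphic_on UNIV"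
    and k: "a k \<noteq> 0" "0 < k" and nc: "f z0 \<noteq> f 0"
    and rr: "\<And>n. n0 \<le> n \<Longrightarrow> 1 \<le> rr n \<and> sigma_norm (rr n) a = exp (real n)"
    and mono: "\<And>r r'. 0 < r \<Longrightarrow> r \<le> r' \<Longrightarrow> N r \<le> N r'"
    and c: "0 \<le> c" "c < c'" "0 < m"
    and N: "\<And>n. n1 \<le> n \<Longrightarrow> real n - c * ln (real n) ^ m - C \<le> N (rr n)"
  shows "\<exists>r0. \<forall>r>r0. nevanlinna_T r f \<le> N r + c' * ln (nevanlinna_T r f) ^ m"
proof -
  have a: "\<And>z. summable (\<lambda>j. a j * z ^ j)" using f sums_summable by blast
  obtain x0 where x0: "\<And>L T. x0 \<le> L \<Longrightarrow> x0 \<le> T \<Longrightarrow> T \<le> L + 1 \<Longrightarrow> T - c' * ln T ^ m \<le> L - 1 - C - c * ln L ^ m"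
    using log_power_comparison[OF c, of C] by blast
  obtain C1 where C1: "\<And>r. cmod z0 \<le> r \<Longrightarrow> ln r - C1 \<le> nevanlinna_T r f"
    using nevanlinna_T_ge_ln[OF hol nc] by blast
  define n2 where "n2 = Max {n0, n1, nat \<lceil>x0\<rceil>, 1}"
  have n2: "n0 \<le> n2" "n1 \<le> n2" "x0 \<le> real n2" "1 \<le> n2"
  proof -
    have "nat \<lceil>x0\<rceil> \<le> n2" unfolding n2_def by (intro Max_ge) auto
    thus "x0 \<le> real n2" by linarith
  qed (auto simp: n2_def intro!: Max_ge)
  define r0 where "r0 = Max {rr n2, cmod z0, exp (x0 + C1)}"
  show ?thesis
  proof (intro exI allI impI)
    fix r assume "r0 < r"
    hence r: "rr n2 < r" "cmod z0 \<le> r" "exp (x0 + C1) \<le> r" by (auto simp: r0_def)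
    have r1: "1 < r" using rr[OF n2(1)] r(1) by linarith
    define \<sigma> where "\<sigma> = sigma_norm r a"
    define L where "L = ln \<sigma>"
    have \<sigma>: "exp (real n2) < \<sigma>"
      using sigma_norm_strict_mono[OF a k, of "rr n2" r] rr[OF n2(1)] r(1) by (simp add: \<sigma>_def)
    hence \<sigma>0: "0 < \<sigma>" using exp_gt_zero less_trans by blast
    have L: "real n2 < L" using ln_less_cancel_iff[of "exp (real n2)" \<sigma>] \<sigma> \<sigma>0 by (simp add: L_def)
    define n where "n = nat \<lfloor>L\<rfloor>"
    have n: "real n \<le> L" "L < real n + 1" "n2 \<le> n" using L by (auto simp: n_def le_nat_floor)
    have "rr n \<le> r"
    proof (rule ccontr)
      assume "\<not> rr n \<le> r"
      hence "\<sigma> < exp (real n)"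
        using sigma_norm_strict_mono[OF a k, of r "rr n"] rr[of n] n(3) n2(1) r1 by (simp add: \<sigma>_def)
      moreover have "exp (real n) \<le> exp L" using n by simp
      ultimately show False using \<sigma>0 by (simp add: L_def)
    qed
    hence "N (rr n) \<le> N r" using rr[of n] n(3) n2(1) by (intro mono) auto
    moreover have "real n - c * ln (real n) ^ m - C \<le> N (rr n)" using n(3) n2(2) by (intro N) auto
    moreover have "c * ln (real n) ^ m \<le> c * ln L ^ m"
      using n n2(4) c by (intro mult_left_mono power_mono) auto
    ultimately have 1: "L - 1 - c * ln L ^ m - C \<le> N r" using n(2) by linarith
    have "1 \<le> exp (real n2)" by simp
    hence "1 \<le> sigma_norm r a" using \<sigma> unfolding \<sigma>_def by linarith
    hence T: "nevanlinna_T r f \<le> L + 1" unfolding L_def \<sigma>_def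
      using r1 by (intro nevanlinna_T_le_ln_sigma f hol) auto
    have "x0 + C1 \<le> ln r" using r(3) r1 by (simp add: ln_ge_iff)
    hence "x0 \<le> nevanlinna_T r f" using C1[OF r(2)] by linarith
    from x0[OF _ this T] n2(3) L have "nevanlinna_T r f - c' * ln (nevanlinna_T r f) ^ m \<le> L - 1 - C - c * ln L ^ m" by simp
    with 1 show "nevanlinna_T r f \<le> N r + c' * ln (nevanlinna_T r f) ^ m" by linarith
  qed
qed

section \<open>Almost sure lower bounds for the counting function\<close>

lemma ennreal_mult_le_1_imp:
  assumes "ennreal c * W \<le> 1" "0 < c"
  shows "W \<le> ennreal (1 / c)"
proof -
  have "W = ennreal (1 / c) * (ennreal c * W)"
    using assms(2) by (simp add: mult.assoc[symmetric] ennreal_mult[symmetric])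
  also have "\<dots> \<le> ennreal (1 / c) * 1" using assms(1) by (intro mult_left_mono) auto
  finally show ?thesis by simp
qed

lemma random_entire_measurable_circle:
  assumes [measurable]: "\<And>j. X j \<in> borel_measurable M"
  shows "(\<lambda>(\<omega>, t). random_entire X a \<omega> (of_real r * cis t)) \<in> borel_measurable (M \<Otimes>\<^sub>M lborel)"
  unfolding random_entire_def split_def by measurable

lemma random_entire_measurable_fst:
  assumes [measurable]: "\<And>j. X j \<in> borel_measurable M"
  shows "(\<lambda>\<omega>. random_entire X a \<omega> z) \<in> borel_measurable M"
  unfolding random_entire_def by measurable

lemma random_entire_measurable_angle:
  "(\<lambda>t. random_entire X a \<omega> (of_real r * cis t)) \<in> borel_measurable borel"
  unfolding random_entire_def by measurable

text \<open>
  The first moment method. Almost surely the circle mean of \<open>\<phi> n\<close> is at most \<open>Q n\<close> for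
  large \<open>n\<close>; the tangent inequality then bounds the mean of \<open>ln |g|\<close> from below by \<open>A n\<close>, and Jensen's
  formula converts this mean into \<open>N\<close>. The constant \<open>C\<close> is \<open>ln |X k * a k|\<close>.
\<close>
lemma (in prob_space) AE_lower_bound_of_moments:
  fixes \<phi> :: "nat \<Rightarrow> 'a \<Rightarrow> real \<Rightarrow> real"
  assumes sm: "AE \<omega> in M. \<forall>z. summable (\<lambda>j. X j \<omega> * a j * z ^ j)"
    and k: "\<forall>i<k. a i = 0" "a k \<noteq> 0" and Xk: "AE \<omega> in M. X k \<omega> \<noteq> 0"
    and \<phi>m: "\<And>n. (\<lambda>(\<omega>, t). \<phi> n \<omega> t) \<in> borel_measurable (M \<Otimes>\<^sub>M lborel)"
    and \<phi>mt: "\<And>n \<omega>. \<phi> n \<omega> \<in> borel_measurable borel" and \<phi>0: "\<And>n \<omega> t. 0 \<le> \<phi> n \<omega> t"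
    and pos: "\<And>n. n1 \<le> n \<Longrightarrow> 0 < rr n \<and> 0 < Q n \<and> 0 \<le> B n"
    and E: "\<And>n. n1 \<le> n \<Longrightarrow>
      (\<integral>\<^sup>+\<omega>. (\<integral>\<^sup>+t\<in>{0..2*pi}. ennreal (\<phi> n \<omega> t) \<partial>lborel) \<partial>M) \<le> ennreal (2 * pi * Q n * e n)"
    and e: "summable e" "\<And>n. 0 \<le> e n"
    and pw: "\<And>n \<omega> t. n1 \<le> n \<Longrightarrow> random_entire X a \<omega> (of_real (rr n) * cis t) \<noteq> 0 \<Longrightarrow>
      A n - B n * (\<phi> n \<omega> t / Q n - 1) \<le> ln (cmod (random_entire X a \<omega> (of_real (rr n) * cis t)))"
  shows "AE \<omega> in M. \<exists>C n2. \<forall>n\<ge>n2. A n - C \<le> nevanlinna_N (rr n) (random_entire X a \<omega>)"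
proof -
  let ?W = "\<lambda>n \<omega>. \<integral>\<^sup>+t\<in>{0..2*pi}. ennreal (\<phi> n \<omega> t) \<partial>lborel"
  define d where "d = (\<lambda>n. 1 / (2 * pi * Q n))"
  define Z where "Z = (\<lambda>n \<omega>. ennreal (d n) * ?W n \<omega>)"
  have [measurable]: "(\<lambda>p. \<phi> n (fst p) (snd p)) \<in> borel_measurable (M \<Otimes>\<^sub>M lborel)" for n
    using \<phi>m[of n] by (simp add: split_def)
  have [measurable]: "(\<lambda>\<omega>. ?W n \<omega>) \<in> borel_measurable M" for n
    by (intro lborel.borel_measurable_nn_integral) (auto simp: split_def)
  have Zm: "Z n \<in> borel_measurable M" for n unfolding Z_def by measurable
  have EZ: "(\<integral>\<^sup>+\<omega>. Z n \<omega> \<partial>M) \<le> ennreal (e n)" if n: "n1 \<le> n" for n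
  proof -
    have "(\<integral>\<^sup>+\<omega>. Z n \<omega> \<partial>M) \<le> ennreal (d n) * ennreal (2 * pi * Q n * e n)"
      unfolding Z_def by (subst nn_integral_cmult) (auto intro!: mult_left_mono E n)
    also have "\<dots> = ennreal (d n * (2 * pi * Q n * e n))"
      using pos[OF n] e(2)[of n] by (intro ennreal_mult[symmetric]) (auto simp: d_def)
    also have "d n * (2 * pi * Q n * e n) = e n" using pos[OF n] by (simp add: d_def)
    finally show ?thesis .
  qed
  have "AE \<omega> in M. \<exists>N. \<forall>n\<ge>N. Z n \<omega> \<le> 1"
    by (rule AE_eventually_le_1[OF Zm EZ e])
  thus ?thesis using sm Xk
  proof eventually_elim
    case (elim \<omega>)
    define g where "g = random_entire X a \<omega>"
    obtain N where N: "\<And>n. N \<le> n \<Longrightarrow> Z n \<omega> \<le> 1" using elim(1) by blast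
    note J = jensen_random_entire[where X=X and a=a and \<omega>=\<omega> and k=k, OF elim(2)[rule_format] k elim(3), folded g_def]
    obtain v where v: "g v \<noteq> 0" using J(2) by blast
    define C where "C = ln (cmod (X k \<omega> * a k))"
    show ?case unfolding g_def[symmetric]
    proof (intro exI allI impI)
      fix n assume "max N n1 \<le> n"
      hence n: "N \<le> n" "n1 \<le> n" by auto
      have r: "0 < rr n" and Q: "0 < Q n" and B: "0 \<le> B n" using pos[OF n(2)] by auto
      have d: "0 < d n" "1 / d n = 2 * pi * Q n" using Q by (auto simp: d_def)
      have nn: "?W n \<omega> \<le> ennreal (2 * pi * Q n)"
        using ennreal_mult_le_1_imp[OF N[OF n(1), unfolded Z_def] d(1)] unfolding d(2) .
      have "2 * pi * A n \<le> 2 * pi * (C + nevanlinna_N (rr n) g)"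
        by (rule mean_lower_bound[OF J(3)[OF r, folded C_def] \<phi>mt \<phi>0 nn Q B negligible_zeros_on_circle[OF J(1) v r]])
           (use pw[OF n(2), of \<omega>] in \<open>simp add: g_def\<close>)
      thus "A n - C \<le> nevanlinna_N (rr n) g" by simp
    qed
  qed
qed

text \<open>
  The first moment method for \<open>|g| / exp n\<close> raised to the power \<open>-p\<close>, with \<open>Q\<close> the power \<open>p c\<close>
  of \<open>n\<close>, so that \<open>ln Q / p = c ln n\<close>. For each fixed angle \<open>g / exp n\<close> is a normalised linear combination of the
  \<open>X j\<close>, so its negative moment is at most \<open>K\<close>.
\<close>
lemma (in prob_space) AE_lower_bound_of_negative_moment:
  assumes X [measurable]: "\<And>j. X j \<in> borel_measurable M"
    and sm: "AE \<omega> in M. \<forall>z. summable (\<lambda>j. X j \<omega> * a j * z ^ j)"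
    and a: "\<And>z. summable (\<lambda>j. a j * z ^ j)"
    and k: "\<forall>i<k. a i = 0" "a k \<noteq> 0" and Xk: "AE \<omega> in M. X k \<omega> \<noteq> 0"
    and nm: "negative_moment_bound M X p K" "0 < K" "0 < p" "1 < p * c"
    and rr: "\<And>n. n0 \<le> n \<Longrightarrow> 1 \<le> rr n \<and> sigma_norm (rr n) a = exp (real n)"
  shows "AE \<omega> in M. \<exists>C n1. \<forall>n\<ge>n1. real n - c * ln (real n) ^ 1 - C \<le> nevanlinna_N (rr n) (random_entire X a \<omega>)"
proof -
  define \<phi> where "\<phi> = (\<lambda>n \<omega> t. cmod (random_entire X a \<omega> (of_real (rr n) * cis t) / of_real (exp (real n))) powr (-p))"
  let ?g = "\<lambda>n \<omega> t. random_entire X a \<omega> (of_real (rr n) * cis t)"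
  let ?W = "\<lambda>n \<omega>. \<integral>\<^sup>+t\<in>{0..2*pi}. ennreal (\<phi> n \<omega> t) \<partial>lborel"
  define Q where "Q = (\<lambda>n::nat. real n powr (p * c))"
  note [measurable] = random_entire_measurable_circle[OF X] random_entire_measurable_fst[OF X] random_entire_measurable_angle
  have \<phi>m: "(\<lambda>(\<omega>, t). \<phi> n \<omega> t) \<in> borel_measurable (M \<Otimes>\<^sub>M lborel)" for n
    unfolding \<phi>_def using random_entire_measurable_circle[where a=a and r="rr n", OF X] by (simp add: split_def)
  have \<phi>mt: "\<phi> n \<omega> \<in> borel_measurable borel" for n \<omega>
    unfolding \<phi>_def by measurable
  interpret P: pair_sigma_finite M lborel by unfold_locales
  have inner: "(\<integral>\<^sup>+\<omega>. ennreal (\<phi> n \<omega> t) \<partial>M) \<le> ennreal K" if n: "n0 \<le> n" for n t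
  proof -
    define b where "b = (\<lambda>j. a j * (of_real (rr n) * cis t) ^ j / of_real (exp (real n)))"
    have "(\<lambda>j. (cmod (a j))\<^sup>2 * rr n ^ (2 * j)) sums ((sigma_norm (rr n) a)\<^sup>2)"
      unfolding sigma_norm_power2[OF a] by (rule summable_sums[OF sigma_summable[OF a]])
    hence "(\<lambda>j. (cmod (a j))\<^sup>2 * rr n ^ (2 * j) / (exp (real n))\<^sup>2) sums ((sigma_norm (rr n) a)\<^sup>2 / (exp (real n))\<^sup>2)"
      by (rule sums_divide)
    moreover have "(sigma_norm (rr n) a)\<^sup>2 / (exp (real n))\<^sup>2 = 1" using rr[OF n] by simp
    moreover have "(cmod (b j))\<^sup>2 = (cmod (a j))\<^sup>2 * rr n ^ (2 * j) / (exp (real n))\<^sup>2" for j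
      using rr[OF n] by (simp add: b_def norm_mult norm_divide norm_power power_mult_distrib power_divide power_even_eq)
    ultimately have b1: "(\<lambda>j. (cmod (b j))\<^sup>2) sums 1" by simp
    have bX: "b j * X j \<omega> = X j \<omega> * a j * (of_real (rr n) * cis t) ^ j / of_real (exp (real n))" for j \<omega>
      by (simp add: b_def)
    have b2: "AE \<omega> in M. summable (\<lambda>j. b j * X j \<omega>)"
      using sm by eventually_elim (simp only: bX, intro summable_divide, blast)
    have "(\<integral>\<^sup>+\<omega>. ennreal (\<phi> n \<omega> t) \<partial>M) = (\<integral>\<^sup>+\<omega>. ennreal (cmod (\<Sum>j. b j * X j \<omega>) powr (-p)) \<partial>M)"
    proof (rule nn_integral_cong_AE)
      show "AE \<omega> in M. ennreal (\<phi> n \<omega> t) = ennreal (cmod (\<Sum>j. b j * X j \<omega>) powr (-p))"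
        using sm
      proof eventually_elim
        case (elim \<omega>)
        have "(\<Sum>j. b j * X j \<omega>) = ?g n \<omega> t / of_real (exp (real n))"
          unfolding bX random_entire_def by (rule suminf_divide) (use elim in blast)
        thus ?case by (simp add: \<phi>_def)
      qed
    qed
    also have "\<dots> \<le> ennreal K" using nm(1) b1 b2 unfolding negative_moment_bound_def by blast
    finally show ?thesis .
  qed
  have E: "(\<integral>\<^sup>+\<omega>. ?W n \<omega> \<partial>M) \<le> ennreal (2 * pi * Q n * (K * real n powr (-(p*c))))"
    if n: "max n0 1 \<le> n" for n
  proof -
    have "(\<integral>\<^sup>+\<omega>. ?W n \<omega> \<partial>M) =
        (\<integral>\<^sup>+t. \<integral>\<^sup>+\<omega>. ennreal (\<phi> n \<omega> t) * indicator {0..2*pi} t \<partial>M \<partial>lborel)"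
      by (rule P.Fubini'[symmetric]) (use \<phi>m[of n] in \<open>simp add: split_def\<close>)
    also have "\<dots> = (\<integral>\<^sup>+t. (\<integral>\<^sup>+\<omega>. ennreal (\<phi> n \<omega> t) \<partial>M) * indicator {0..2*pi} t \<partial>lborel)"
    proof (intro nn_integral_cong nn_integral_multc)
      fix t :: real
      show "(\<lambda>\<omega>. ennreal (\<phi> n \<omega> t)) \<in> borel_measurable M" unfolding \<phi>_def by measurable
    qed
    also have "\<dots> \<le> (\<integral>\<^sup>+t. ennreal K * indicator {0..2*pi} t \<partial>lborel)"
      by (intro nn_integral_mono mult_right_mono inner) (use n in auto)
    also have "\<dots> = ennreal (K * (2*pi))"
      using nm by (simp add: nn_integral_cmult_indicator ennreal_mult)
    also have "K * (2*pi) = 2 * pi * Q n * (K * real n powr (-(p*c)))"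
      using n by (simp add: Q_def powr_minus)
    finally show ?thesis .
  qed
  have "AE \<omega> in M. \<exists>C n2. \<forall>n\<ge>n2. (real n - ln (Q n) / p) - C \<le> nevanlinna_N (rr n) (random_entire X a \<omega>)"
  proof (rule AE_lower_bound_of_moments[where B="\<lambda>_. 1 / p", OF sm k Xk \<phi>m \<phi>mt _ _ E])
    show "summable (\<lambda>n. K * real n powr (-(p*c)))"
      using nm by (intro summable_mult) (simp add: summable_real_powr_iff)
    show "0 \<le> K * real n powr (-(p*c))" for n using nm by simp
    show "0 \<le> \<phi> n \<omega> t" for n \<omega> t by (simp add: \<phi>_def)
    show "0 < rr n \<and> 0 < Q n \<and> 0 \<le> 1 / p" if "max n0 1 \<le> n" for n
      using that nm rr[of n] by (auto simp: Q_def)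
    fix n \<omega> t
    assume n: "max n0 1 \<le> n" and nz: "?g n \<omega> t \<noteq> 0"
    define G where "G = cmod (?g n \<omega> t)"
    have G: "0 < G" using nz by (simp add: G_def)
    have Q: "0 < Q n" using n by (simp add: Q_def)
    have phi: "\<phi> n \<omega> t = (G / exp (real n)) powr (-p)"
      unfolding \<phi>_def by (simp add: norm_divide G_def)
    have "ln (\<phi> n \<omega> t / Q n) \<le> \<phi> n \<omega> t / Q n - 1" using G Q by (intro ln_le_minus_one) (simp add: phi)
    moreover have "ln (\<phi> n \<omega> t / Q n) = - p * (ln G - real n) - ln (Q n)"
      using G Q by (simp add: phi ln_div ln_powr)
    ultimately have "p * (real n - ln (Q n) / p - 1 / p * (\<phi> n \<omega> t / Q n - 1)) \<le> p * ln G"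
      using nm by (simp add: algebra_simps)
    thus "real n - ln (Q n) / p - 1 / p * (\<phi> n \<omega> t / Q n - 1)
        \<le> ln (cmod (?g n \<omega> t))"
      using nm by (simp add: G_def)
  qed
  moreover have "ln (Q n) / p = c * ln (real n) ^ 1" for n
    using nm by (cases "n = 0") (auto simp: Q_def ln_powr)
  ultimately show ?thesis by simp
qed

text \<open>
  The tangent of the convex function \<open>x \<mapsto> x\<^sup>p\<close> at 1.
\<close>
lemma power_tangent_bound:
  fixes x p :: real
  assumes "0 \<le> x" "1 \<le> p"
  shows "x \<le> 1 + (x powr p - 1) / p"
proof (cases "x = 0")
  case True
  thus ?thesis using assms by simp
next
  case False
  hence "(x powr p) powr (1 / p) * 1 powr (1 - 1 / p) \<le> 1 / p * (x powr p) + (1 - 1 / p) * 1"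
    using assms by (intro Youngs_inequality_0) auto
  thus ?thesis using False assms by (simp add: powr_powr diff_divide_distrib)
qed

text \<open>
  Put \<open>w = \<kappa> ln n\<close> and \<open>s = w\<^sup>6\<close>. The log-integrability inequality bounds the quotient of the
  moment of order \<open>p\<close> by \<open>s\<^sup>p\<close> by \<open>(C0 p / w)\<close> to the power \<open>6 p\<close>. The choice \<open>p = w / (e C0)\<close> minimises
  it; the value is \<open>n\<close> to the power \<open>-6 \<kappa> / (e C0)\<close>, which is summable exactly when \<open>\<kappa> > e C0 / 6\<close>.
\<close>
lemma (in prob_space) AE_lower_bound_rademacher:
  assumes X [measurable]: "\<And>j. X j \<in> borel_measurable M"
    and sm: "AE \<omega> in M. \<forall>z. summable (\<lambda>j. X j \<omega> * a j * z ^ j)"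
    and a: "\<And>z. summable (\<lambda>j. a j * z ^ j)"
    and k: "\<forall>i<k. a i = 0" "a k \<noteq> 0" and Xk: "AE \<omega> in M. X k \<omega> \<noteq> 0"
    and R: "rademacher_seq M X" and C0: "log_integrability_constant M C0" and \<kappa>: "exp 1 * C0 / 6 < \<kappa>"
    and rr: "\<And>n. n0 \<le> n \<Longrightarrow> 1 \<le> rr n \<and> sigma_norm (rr n) a = exp (real n)"
  shows "AE \<omega> in M. \<exists>C n1. \<forall>n\<ge>n1. real n - \<kappa> ^ 6 * ln (real n) ^ 6 - C \<le> nevanlinna_N (rr n) (random_entire X a \<omega>)"
proof -
  have C0': "0 < C0" using C0 by (simp add: log_integrability_constant_def)
  have "0 < exp 1 * C0 / 6" using C0' by simp
  hence \<kappa>0: "0 < \<kappa>" using \<kappa> by linarith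
  define w where "w = (\<lambda>n::nat. \<kappa> * ln (real n))"
  define p where "p = (\<lambda>n. w n / (C0 * exp 1))"
  define \<phi> where "\<phi> = (\<lambda>n \<omega> t. \<bar>ln (cmod (random_entire X a \<omega> (of_real (rr n) * cis t) / of_real (sigma_norm (rr n) a)))\<bar> powr p n / (2 * pi))"
  let ?g = "\<lambda>n \<omega> t. random_entire X a \<omega> (of_real (rr n) * cis t)"
  let ?W = "\<lambda>n \<omega>. \<integral>\<^sup>+t\<in>{0..2*pi}. ennreal (\<phi> n \<omega> t) \<partial>lborel"
  define s where "s = (\<lambda>n. w n ^ 6)"
  define Q where "Q = (\<lambda>n. s n powr p n / (2 * pi))"
  define \<alpha> where "\<alpha> = 6 * \<kappa> / (C0 * exp 1)"
  have \<alpha>: "1 < \<alpha>" using \<kappa> C0' by (simp add: \<alpha>_def field_simps)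
  obtain n1 :: nat where n1: "exp (C0 * exp 1 / \<kappa>) \<le> real n1" using real_arch_simple by blast
  have big: "1 \<le> p n" "0 < w n" "0 < real n" if n: "max n0 n1 \<le> n" for n
  proof -
    have e: "exp (C0 * exp 1 / \<kappa>) \<le> real n" using n1 n by simp
    thus n0: "0 < real n" by (meson exp_gt_zero less_le_trans)
    have "C0 * exp 1 / \<kappa> \<le> ln (real n)" using e n0 by (simp add: ln_ge_iff)
    hence le: "C0 * exp 1 \<le> w n" using \<kappa>0 by (simp add: w_def field_simps)
    moreover have "0 < C0 * exp 1" using C0' by simp
    ultimately show "0 < w n" "1 \<le> p n" by (auto simp: p_def)
  qed
  have pos: "0 < rr n \<and> 0 < Q n \<and> 0 \<le> s n / p n" if n: "max n0 n1 \<le> n" for n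
    using big[OF n] rr[of n] n by (auto simp: Q_def s_def)
  note [measurable] = random_entire_measurable_circle[OF X] random_entire_measurable_angle
  have \<phi>m: "(\<lambda>(\<omega>, t). \<phi> n \<omega> t) \<in> borel_measurable (M \<Otimes>\<^sub>M lborel)" for n
    unfolding \<phi>_def using random_entire_measurable_circle[where a=a and r="rr n", OF X] by (simp add: split_def)
  have \<phi>mt: "\<phi> n \<omega> \<in> borel_measurable borel" for n \<omega>
    unfolding \<phi>_def by measurable
  have E: "(\<integral>\<^sup>+\<omega>. ?W n \<omega> \<partial>M) \<le> ennreal (2 * pi * Q n * real n powr (-\<alpha>))"
    if n: "max n0 n1 \<le> n" for n
  proof -
    note b = big[OF n]
    have "1 \<le> rr n" using rr[of n] n by simp
    hence "(\<integral>\<^sup>+\<omega>. ?W n \<omega> \<partial>M) \<le> ennreal ((C0 * p n) powr (6 * p n))"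
      unfolding \<phi>_def
      using C0[unfolded log_integrability_constant_def, THEN conjunct2, rule_format, of X a "rr n" "p n"] R a k(2) b(1)
      by auto
    also have "(C0 * p n) powr (6 * p n) = 2 * pi * Q n * real n powr (-\<alpha>)"
    proof -
      have "C0 * p n = w n / exp 1" using C0' by (simp add: p_def)
      hence "(C0 * p n) powr (6 * p n) = w n powr (6 * p n) / exp 1 powr (6 * p n)"
        using b by (simp add: powr_divide)
      also have "\<dots> = w n powr (6 * p n) * exp (- (6 * p n))"
        by (simp add: exp_powr_real exp_minus field_simps)
      also have "exp (- (6 * p n)) = real n powr (-\<alpha>)" using b by (simp add: powr_def p_def w_def \<alpha>_def)
      also have "w n powr (6 * p n) = 2 * pi * Q n"
        using b by (simp add: Q_def s_def powr_powr flip: powr_numeral)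
      finally show ?thesis .
    qed
    finally show ?thesis .
  qed
  have "AE \<omega> in M. \<exists>C n2. \<forall>n\<ge>n2. (real n - s n) - C \<le> nevanlinna_N (rr n) (random_entire X a \<omega>)"
  proof (rule AE_lower_bound_of_moments[where B="\<lambda>n. s n / p n", OF sm k Xk \<phi>m \<phi>mt _ pos E])
    show "summable (\<lambda>n. real n powr (-\<alpha>))" using \<alpha> by (simp add: summable_real_powr_iff)
    show "0 \<le> \<phi> n \<omega> t" for n \<omega> t by (simp add: \<phi>_def)
    show "0 \<le> real n powr (-\<alpha>)" for n by simp
    fix n \<omega> t
    assume n: "max n0 n1 \<le> n" and nz: "?g n \<omega> t \<noteq> 0"
    note b = big[OF n]
    have s: "0 < s n" using b by (simp add: s_def)
    define G where "G = cmod (?g n \<omega> t)"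
    have G: "0 < G" using nz by (simp add: G_def)
    define y where "y = \<bar>ln G - real n\<bar>"
    have "ln (cmod (?g n \<omega> t / of_real (sigma_norm (rr n) a))) = ln G - real n"
      using rr[of n] n G by (simp add: norm_divide G_def[symmetric] ln_div)
    hence phi: "\<phi> n \<omega> t = y powr p n / (2 * pi)"
      unfolding \<phi>_def y_def by simp
    have "y / s n \<le> 1 + ((y / s n) powr p n - 1) / p n"
      using s b by (intro power_tangent_bound) (auto simp: y_def)
    hence "s n * (y / s n) \<le> s n * (1 + ((y / s n) powr p n - 1) / p n)" using s by (intro mult_left_mono) auto
    moreover have "(y / s n) powr p n = \<phi> n \<omega> t / Q n"
      using s by (simp add: phi Q_def powr_divide y_def)
    moreover have "s n * (1 + x / p n) = s n + s n / p n * x" for x by (simp add: distrib_left)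
    moreover have "s n * (y / s n) = y" using s by simp
    ultimately have "y \<le> s n + s n / p n * (\<phi> n \<omega> t / Q n - 1)" by metis
    moreover have "real n - y \<le> ln G" by (simp add: y_def)
    ultimately show "real n - s n - s n / p n * (\<phi> n \<omega> t / Q n - 1)
        \<le> ln (cmod (?g n \<omega> t))"
      by (simp add: G_def)
  qed
  thus ?thesis by (simp add: s_def w_def power_mult_distrib)
qed

lemma (in prob_space) AE_all_radii:
  assumes X [measurable]: "\<And>j. X j \<in> borel_measurable M"
    and sm: "AE \<omega> in M. \<forall>z. summable (\<lambda>j. X j \<omega> * a j * z ^ j)"
    and f: "\<And>z. (\<lambda>j. a j * z ^ j) sums f z" and hol: "f holomorphic_on UNIV" and nc: "f z0 \<noteq> f 0"
    and k: "\<forall>i<k. a i = 0" "a k \<noteq> 0" and Xk: "AE \<omega> in M. X k \<omega> \<noteq> 0"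
    and k': "a k' \<noteq> 0" "0 < k'"
    and rr: "\<And>n. n0 \<le> n \<Longrightarrow> 1 \<le> rr n \<and> sigma_norm (rr n) a = exp (real n)"
    and c: "0 \<le> c" "c < c'" "0 < m"
    and low: "AE \<omega> in M. \<exists>C n1. \<forall>n\<ge>n1. real n - c * ln (real n) ^ m - C \<le> nevanlinna_N (rr n) (random_entire X a \<omega>)"
  shows "AE \<omega> in M. \<exists>r0. \<forall>r>r0. nevanlinna_T r f \<le> nevanlinna_N r (random_entire X a \<omega>) + c' * ln (nevanlinna_T r f) ^ m"
  using sm Xk low
proof eventually_elim
  case (elim \<omega>)
  obtain C n1 where C: "\<And>n. n1 \<le> n \<Longrightarrow> real n - c * ln (real n) ^ m - C \<le> nevanlinna_N (rr n) (random_entire X a \<omega>)"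
    using elim(3) by blast
  note J = jensen_random_entire[where X=X and a=a and \<omega>=\<omega> and k=k, OF elim(1)[rule_format] k elim(2)]
  show ?case
    by (rule sequence_to_all_radii[OF f hol k' nc rr J(4) c C])
qed

section \<open>The three cases\<close>

lemma (in prob_space) rademacher_AE_values:
  assumes "rademacher_seq M X"
  shows "AE \<omega> in M. X j \<omega> = 1 \<or> X j \<omega> = -1"
proof -
  have [measurable]: "X j \<in> borel_measurable M"
    using assms by (auto simp: rademacher_seq_def indep_vars_def)
  let ?P = "{\<omega> \<in> space M. X j \<omega> = 1}" and ?Q = "{\<omega> \<in> space M. X j \<omega> = -1}"
  have "prob (?P \<union> ?Q) = prob ?P + prob ?Q"
    by (rule finite_measure_Union) auto
  also have "prob ?P = 1 / 2" using assms unfolding rademacher_seq_def by blast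
  also have "prob ?Q = 1 / 2" using assms unfolding rademacher_seq_def by blast
  finally have "prob (?P \<union> ?Q) = 1" by simp
  hence "AE \<omega> in M. \<omega> \<in> ?P \<union> ?Q" by (rule AE_prob_1)
  thus ?thesis by eventually_elim auto
qed

theorem corollary3p3:
  fixes M :: "'w measure" and X :: "nat \<Rightarrow> 'w \<Rightarrow> complex"
    and a :: "nat \<Rightarrow> complex" and f :: "complex \<Rightarrow> complex" and \<epsilon> :: real
  assumes "prob_space M"
    and "transcendental_entire f"
    and "\<And>z. (\<lambda>j. a j * z ^ j) sums f z"
    and "\<epsilon> > 0"
  shows
    "(gaussian_seq M X \<longrightarrow>
        (AE \<omega> in M. \<exists>r0. \<forall>r>r0.
           nevanlinna_T r f \<le> nevanlinna_N r (random_entire X a \<omega>)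
             + (1 + \<epsilon>) / 2 * ln (nevanlinna_T r f))) \<and>
     (\<forall>C0. rademacher_seq M X \<and> log_integrability_constant M C0 \<longrightarrow>
        (AE \<omega> in M. \<exists>r0. \<forall>r>r0.
           nevanlinna_T r f \<le> nevanlinna_N r (random_entire X a \<omega>)
             + ((exp 1 * C0 / 6) ^ 6 + \<epsilon>) * (ln (nevanlinna_T r f)) ^ 6)) \<and>
     (steinhaus_seq M X \<longrightarrow>
        (AE \<omega> in M. \<exists>r0. \<forall>r>r0.
           nevanlinna_T r f \<le> nevanlinna_N r (random_entire X a \<omega>)
             + (1 + \<epsilon>) * ln (nevanlinna_T r f)))"
proof -
  interpret prob_space M by fact
  have hol: "f holomorphic_on UNIV" and np: "\<not> (\<exists>p. \<forall>z. f z = poly p z)"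
    using assms(2) by (auto simp: transcendental_entire_def)
  have a: "\<And>z. summable (\<lambda>j. a j * z ^ j)" using assms(3) sums_summable by blast
  obtain z0 where nc: "f z0 \<noteq> f 0"
  proof -
    have "\<not> (\<forall>z. f z = poly [:f 0:] z)" using np by blast
    thus ?thesis using that by auto
  qed
  obtain k' where k': "a k' \<noteq> 0" "0 < k'"
  proof -
    have "\<exists>k'>0. a k' \<noteq> 0"
    proof (rule ccontr)
      assume "\<not> ?thesis"
      hence "\<forall>j>0. a j = 0" by blast
      hence z: "a j = 0" if "j \<notin> {0}" for j using that by simp
      have "f z = a 0" for z
      proof -
        have "(\<lambda>j. a j * z ^ j) sums (\<Sum>j\<in>{0}. a j * z ^ j)" by (rule sums_finite) (use z in auto)
        with assms(3)[of z] show ?thesis by (simp add: sums_iff)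
      qed
      with nc show False by simp
    qed
    thus ?thesis using that by blast
  qed
  define k where "k = (LEAST k. a k \<noteq> 0)"
  have "a k \<noteq> 0" unfolding k_def by (rule LeastI[of "\<lambda>k. a k \<noteq> 0", OF k'(1)])
  moreover have "\<forall>i<k. a i = 0" unfolding k_def by (blast dest: not_less_Least)
  ultimately have k: "\<forall>i<k. a i = 0" "a k \<noteq> 0" by blast+
  obtain rr n0 where rr: "\<And>n. n0 \<le> n \<Longrightarrow> 1 \<le> rr n \<and> sigma_norm (rr n) a = exp (real n)"
    using sigma_norm_sequence[OF a k'] by blast
  have gauss: "AE \<omega> in M. \<exists>r0. \<forall>r>r0.
           nevanlinna_T r f \<le> nevanlinna_N r (random_entire X a \<omega>) + (1 + \<epsilon>) / 2 * ln (nevanlinna_T r f)"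
    if G: "gaussian_seq M X"
  proof -
    have D: "\<And>j. distributed M lborel (X j) (\<lambda>z. ennreal (exp (- (cmod z)\<^sup>2) / pi))"
      and ind: "indep_vars (\<lambda>_. borel) X UNIV" using G by (auto simp: gaussian_seq_def)
    have X: "\<And>j. X j \<in> borel_measurable M" using ind by (auto simp: indep_vars_def)
    define B where "B = enn2real (\<integral>\<^sup>+p. ennreal (cmod (plane_point p)) \<partial>plane_normal)"
    have E: "\<And>j. (\<integral>\<^sup>+\<omega>. ennreal (cmod (X j \<omega>)) \<partial>M) \<le> ennreal B"
      using gaussian_first_moment[OF D] by (simp add: B_def less_top)
    have sm: "AE \<omega> in M. \<forall>z. summable (\<lambda>j. X j \<omega> * a j * z ^ j)"
      by (rule AE_random_series_summable[OF X E _ a]) (simp add: B_def)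
    define c where "c = (1 + \<epsilon> / 2) / 2"
    \<comment> \<open>The admissible \<open>p\<close> lie between \<open>1 / c\<close> and 2.\<close>
    define p where "p = (1 / c + 2) / 2"
    have c: "1/2 < c" "c < (1 + \<epsilon>) / 2" using assms(4) by (auto simp: c_def)
    have "1 / c < 2" using c by (simp add: field_simps)
    hence p: "0 < p" "p < 2" "1 < p * c" using c by (auto simp: p_def field_simps add_pos_pos)
    obtain K where K: "0 < K" "negative_moment_bound M X p K" using gaussian_negative_moment[OF G p(1,2)] by blast
    have Xk: "AE \<omega> in M. X k \<omega> \<noteq> 0" by (rule gaussian_AE_nonzero[OF D])
    have low: "AE \<omega> in M. \<exists>C n1. \<forall>n\<ge>n1. real n - c * ln (real n) ^ 1 - C \<le> nevanlinna_N (rr n) (random_entire X a \<omega>)"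
      by (rule AE_lower_bound_of_negative_moment[OF X sm a k Xk K(2,1) p(1) p(3) rr])
    have "AE \<omega> in M. \<exists>r0. \<forall>r>r0. nevanlinna_T r f \<le> nevanlinna_N r (random_entire X a \<omega>) + (1 + \<epsilon>) / 2 * ln (nevanlinna_T r f) ^ 1"
      by (rule AE_all_radii[OF X sm assms(3) hol nc k Xk k' rr _ c(2) _ low]) (use c in auto)
    thus ?thesis by simp
  qed
  have rade: "AE \<omega> in M. \<exists>r0. \<forall>r>r0.
           nevanlinna_T r f \<le> nevanlinna_N r (random_entire X a \<omega>) + ((exp 1 * C0 / 6) ^ 6 + \<epsilon>) * (ln (nevanlinna_T r f)) ^ 6"
    if R: "rademacher_seq M X" and L: "log_integrability_constant M C0" for C0
  proof -
    have C0: "0 < C0" using L by (simp add: log_integrability_constant_def)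
    have X: "\<And>j. X j \<in> borel_measurable M" using R by (auto simp: rademacher_seq_def indep_vars_def)
    have E: "(\<integral>\<^sup>+\<omega>. ennreal (cmod (X j \<omega>)) \<partial>M) \<le> ennreal 1" for j
    proof -
      have "(\<integral>\<^sup>+\<omega>. ennreal (cmod (X j \<omega>)) \<partial>M) = (\<integral>\<^sup>+\<omega>. 1 \<partial>M)"
      proof (rule nn_integral_cong_AE)
        show "AE \<omega> in M. ennreal (cmod (X j \<omega>)) = 1"
          using rademacher_AE_values[OF R, of j] by eventually_elim auto
      qed
      thus ?thesis by (simp add: emeasure_space_1)
    qed
    have sm: "AE \<omega> in M. \<forall>z. summable (\<lambda>j. X j \<omega> * a j * z ^ j)"
      by (rule AE_random_series_summable[OF X E _ a]) simp
    have Xk: "AE \<omega> in M. X k \<omega> \<noteq> 0"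
      using rademacher_AE_values[OF R, of k] by eventually_elim auto
    define e where "e = exp 1 * C0 / 6"
    have e: "0 < e" using C0 by (simp add: e_def)
    define \<kappa> where "\<kappa> = root 6 (e ^ 6 + \<epsilon> / 2)"
    have \<kappa>6: "\<kappa> ^ 6 = e ^ 6 + \<epsilon> / 2" unfolding \<kappa>_def using e assms(4) by (intro real_root_pow_pos2) auto
    have "e = root 6 (e ^ 6)" using e by (simp add: real_root_power_cancel)
    also have "\<dots> < \<kappa>" unfolding \<kappa>_def using assms(4) by (intro real_root_less_mono) auto
    finally have \<kappa>: "exp 1 * C0 / 6 < \<kappa>" by (simp add: e_def)
    have low: "AE \<omega> in M. \<exists>C n1. \<forall>n\<ge>n1. real n - \<kappa> ^ 6 * ln (real n) ^ 6 - C \<le> nevanlinna_N (rr n) (random_entire X a \<omega>)"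
      by (rule AE_lower_bound_rademacher[OF X sm a k Xk R L \<kappa> rr])
    have c: "0 \<le> \<kappa> ^ 6" "\<kappa> ^ 6 < e ^ 6 + \<epsilon>" using \<kappa>6 e assms(4) by auto
    show ?thesis unfolding e_def[symmetric]
      by (rule AE_all_radii[OF X sm assms(3) hol nc k Xk k' rr c _ low]) auto
  qed
  have stein: "AE \<omega> in M. \<exists>r0. \<forall>r>r0.
           nevanlinna_T r f \<le> nevanlinna_N r (random_entire X a \<omega>) + (1 + \<epsilon>) * ln (nevanlinna_T r f)"
    if S: "steinhaus_seq M X"
  proof -
    obtain \<theta> :: "nat \<Rightarrow> 'w \<Rightarrow> real" where \<theta>: "indep_vars (\<lambda>_. borel) \<theta> UNIV"
      "\<And>j. distributed M lborel (\<theta> j) (indicator {0..1})"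
      "\<And>j \<omega>. \<omega> \<in> space M \<Longrightarrow> X j \<omega> = exp (2 * of_real pi * \<i> * of_real (\<theta> j \<omega>))"
      using S unfolding steinhaus_seq_def by blast
    \<comment> \<open>The variables \<open>X j\<close> are prescribed on \<open>space M\<close> only; \<open>Y j\<close> has the same formula everywhere.\<close>
    define Y where "Y = (\<lambda>j \<omega>. cis (2*pi*\<theta> j \<omega>))"
    have XY: "X j \<omega> = Y j \<omega>" if "\<omega> \<in> space M" for j \<omega>
      using \<theta>(3)[OF that, of j] by (simp add: Y_def cis_conv_exp mult_ac)
    have [measurable]: "\<theta> j \<in> borel_measurable M" for j using \<theta>(1) by (auto simp: indep_vars_def)
    have Y: "\<And>j. Y j \<in> borel_measurable M" unfolding Y_def by measurable
    have E: "\<And>j. (\<integral>\<^sup>+\<omega>. ennreal (cmod (Y j \<omega>)) \<partial>M) \<le> ennreal 1"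
      by (simp add: Y_def emeasure_space_1)
    have sm: "AE \<omega> in M. \<forall>z. summable (\<lambda>j. Y j \<omega> * a j * z ^ j)"
      by (rule AE_random_series_summable[OF Y E _ a]) simp
    define c where "c = 1 + \<epsilon> / 2"
    \<comment> \<open>The admissible \<open>p\<close> lie between \<open>1 / c\<close> and 1.\<close>
    define p where "p = (1 / c + 1) / 2"
    have c: "1 < c" "c < 1 + \<epsilon>" using assms(4) by (auto simp: c_def)
    have "1 / c < 1" using c by (simp add: field_simps)
    hence p: "0 < p" "p < 1" "1 < p * c" using c by (auto simp: p_def field_simps add_pos_pos)
    obtain K where K: "0 < K" "negative_moment_bound M Y p K"
      using steinhaus_negative_moment[OF \<theta>(1,2) _ p(1,2), of Y] by (auto simp: Y_def)
    have Yk: "AE \<omega> in M. Y k \<omega> \<noteq> 0" by (simp add: Y_def)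
    have low: "AE \<omega> in M. \<exists>C n1. \<forall>n\<ge>n1. real n - c * ln (real n) ^ 1 - C \<le> nevanlinna_N (rr n) (random_entire Y a \<omega>)"
      by (rule AE_lower_bound_of_negative_moment[OF Y sm a k Yk K(2,1) p(1) p(3) rr])
    have "AE \<omega> in M. \<exists>r0. \<forall>r>r0. nevanlinna_T r f \<le> nevanlinna_N r (random_entire Y a \<omega>) + (1 + \<epsilon>) * ln (nevanlinna_T r f) ^ 1"
      by (rule AE_all_radii[OF Y sm assms(3) hol nc k Yk k' rr _ c(2) _ low]) (use c in auto)
    thus ?thesis using AE_space
    proof eventually_elim
      case (elim \<omega>)
      have "random_entire X a \<omega> = random_entire Y a \<omega>"
        using XY[OF elim(2)] by (simp add: random_entire_def[abs_def])
      with elim(1) show ?case by simp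
    qed
  qed
  from gauss rade stein show ?thesis by blast
qed

end
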